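(* Let $\Omega\subset\mathbb{R}^d$ be a nonempty bounded open set, let $0<s<1$ and $1\le p<\infty$. (I) If $sp<\underline{\mathrm{co\,dim}}_A(\partial\Omega)$, then $W^{s,p}_0(\Omega)=W^{s,p}(\Omega)$. (II) If $\partial\Omega$ is a $(d-sp)$-homogeneous set, $sp=\underline{\mathrm{co\,dim}}_A(\partial\Omega)$ and $p>1$, then $W^{s,p}_0(\Omega)=W^{s,p}(\Omega)$. (III) If $\Omega$ is $\kappa$-plump for some $\kappa\in(0,1)$ and $sp>\overline{\mathrm{co\,dim}}_A(\partial\Omega)$, then $W^{s,p}_0(\Omega)\neq W^{s,p}(\Omega)$.
   Context: All functions are real-valued; $|A|$ denotes the Lebesgue measure of $A\subset\mathbb{R}^d$; $B(x,R)$ is the ball with center $x$ and radius $R$, $\overline B(x,R)$ the closed ball; $\mathrm{dist}(x,E)=\inf_{y\in E}|x-y|$. Fractional Sobolev space: $W^{s,p}(\Omega)=\{f\in L^p(\Omega): [f]_{W^{s,p}(\Omega)}<\infty\}$, where $[f]_{W^{s,p}(\Omega)}=\left(\int_\Omega\int_\Omega\frac{|f(x)-f(y)|^p}{|x-y|^{d+sp}}\,dy\,dx\right)^{1/p}$, with norm $\|f\|_{W^{s,p}(\Omega)}=\|f\|_{L^p(\Omega)}+[f]_{W^{s,p}(\Omega)}$. $W^{s,p}_0(\Omega)$ is the closure of $C_c^\infty(\Omega)$ (smooth functions with compact support in $\Omega$) in $W^{s,p}(\Omega)$ with respect to this norm. For $E\subset\mathbb{R}^d$ and $r>0$ put $\widetilde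 E_r=\{x\in\mathbb{R}^d:\mathrm{dist}(x,E)\le r\}$. The lower Assouad codimension $\underline{\mathrm{co\,dim}}_A(E)$ is the supremum of all $q\ge0$ for which there is a constant $C=C(q)\ge1$ such that $|\widetilde E_r\cap B(x,R)|\le C|B(x,R)|(r/R)^q$ for all $x\in E$ and $0<r<R<\mathrm{diam}\,E$. The upper Assouad codimension $\overline{\mathrm{co\,dim}}_A(E)$ is the infimum of all $q\ge0$ for which there is a constant $c=c(q)>0$ such that $|\widetilde E_r\cap B(x,R)|\ge c|B(x,R)|(r/R)^q$ for all $x\in E$ and $0<r<R<\mathrm{diam}\,E$. A set $E\subset\mathbb{R}^d$ is $\sigma$-homogeneous if there is a constant $L$ such that $|\{y\in\mathbb{R}^d:\mathrm{dist}(y,E)\le r,\ |x-y|\le\lambda r\}|\le L r^d\lambda^\sigma$ for all $x\in E$, $\lambda\ge1$ and $r>0$. A set $E\subset\mathbb{R}^d$ is $\kappa$-plump, with $\kappa\in(0,1)$, if for each $0<r<\mathrm{diam}(E)$ and each $x\in\overline E$ there is $z\in\overline B(x,r)$ such that $B(z,\kappa r)\subset E$. *)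

theory Defs
  imports "HOL-Analysis.Analysis"
begin

(* The space R^d is a type 'a :: euclidean_space with d = DIM('a).
   Functions on an open set \<Omega> are represented by total functions 'a \<Rightarrow> real.
   None of the notions below (except for test functions, which vanish
   outside \<Omega>) looks at values outside \<Omega>, and membership in the spaces is invariant
   under modification on null sets; hence two of these sets of functions are
   equal iff the corresponding sets of almost-everywhere classes are equal. *)

definition ennroot :: "real \<Rightarrow> ennreal \<Rightarrow> ennreal" where
  "ennroot p a = (if a = \<infinity> then \<infinity> else ennreal (enn2real a powr (1 / p)))"

definition Lp_norm :: "real \<Rightarrow> 'a::euclidean_space set \<Rightarrow> ('a \<Rightarrow> real) \<Rightarrow> ennreal" where
  "Lp_norm p \<Omega> f = ennroot p (\<integral>\<^sup>+x. ennreal (\<bar>f x\<bar> powr p) \<partial>lebesgue_on \<Omega>)"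

definition Lp_space :: "real \<Rightarrow> 'a::euclidean_space set \<Rightarrow> ('a \<Rightarrow> real) set" where
  "Lp_space p \<Omega> = {f. f \<in> borel_measurable (lebesgue_on \<Omega>) \<and> Lp_norm p \<Omega> f < \<infinity>}"

(* On the diagonal x = y the integrand is 0 / 0 = 0; for fixed x this concerns
   a single point, hence a null set. *)

definition gagliardo_seminorm ::
    "real \<Rightarrow> real \<Rightarrow> 'a::euclidean_space set \<Rightarrow> ('a \<Rightarrow> real) \<Rightarrow> ennreal" where
  "gagliardo_seminorm s p \<Omega> f =
     ennroot p (\<integral>\<^sup>+x. (\<integral>\<^sup>+y. ennreal (\<bar>f x - f y\<bar> powr p / norm (x - y) powr (real DIM('a) + s * p))
        \<partial>lebesgue_on \<Omega>) \<partial>lebesgue_on \<Omega>)"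

definition frac_sobolev_norm ::
    "real \<Rightarrow> real \<Rightarrow> 'a::euclidean_space set \<Rightarrow> ('a \<Rightarrow> real) \<Rightarrow> ennreal" where
  "frac_sobolev_norm s p \<Omega> f = Lp_norm p \<Omega> f + gagliardo_seminorm s p \<Omega> f"

definition frac_sobolev ::
    "real \<Rightarrow> real \<Rightarrow> 'a::euclidean_space set \<Rightarrow> ('a \<Rightarrow> real) set" where
  "frac_sobolev s p \<Omega> = {f \<in> Lp_space p \<Omega>. gagliardo_seminorm s p \<Omega> f < \<infinity>}"

(* C^k on the whole space: all iterated partial derivatives up to order k exist
   (as components of Frechet derivatives) and are continuous. *)

fun Ck :: "nat \<Rightarrow> ('a::euclidean_space \<Rightarrow> real) \<Rightarrow> bool" where
  "Ck 0 f \<longleftrightarrow> continuous_on UNIV f"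
| "Ck (Suc k) f \<longleftrightarrow> (\<forall>x. f differentiable (at x)) \<and>
     (\<forall>b\<in>Basis. Ck k (\<lambda>x. frechet_derivative f (at x) b))"

definition test_functions :: "'a::euclidean_space set \<Rightarrow> ('a \<Rightarrow> real) set" where
  "test_functions \<Omega> =
     {f. (\<forall>k. Ck k f) \<and> compact (closure {x. f x \<noteq> 0}) \<and> closure {x. f x \<noteq> 0} \<subseteq> \<Omega>}"

definition frac_sobolev_0 ::
    "real \<Rightarrow> real \<Rightarrow> 'a::euclidean_space set \<Rightarrow> ('a \<Rightarrow> real) set" where
  "frac_sobolev_0 s p \<Omega> = {f \<in> frac_sobolev s p \<Omega>.
     \<forall>\<epsilon>>0. \<exists>\<phi>\<in>test_functions \<Omega>. frac_sobolev_norm s p \<Omega> (\<lambda>x. f x - \<phi> x) < ennreal \<epsilon>}"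

(* The library's diameter is only meaningful for bounded sets; an unbounded set
   has infinite diameter, so that every real number lies below it. *)

definition less_diameter :: "real \<Rightarrow> 'a::metric_space set \<Rightarrow> bool" where
  "less_diameter r E \<longleftrightarrow> (bounded E \<longrightarrow> r < diameter E)"

(* infdist x {} = 0 by convention, but below the neighbourhoods only occur for
   sets E that contain a given point. *)

definition closed_nbhd :: "'a::metric_space set \<Rightarrow> real \<Rightarrow> 'a set" where
  "closed_nbhd E r = {x. infdist x E \<le> r}"

(* The codimensions are extended reals: the set of admissible exponents may be
   unbounded, e.g. for E = {}. *)

definition lower_assouad_codim :: "'a::euclidean_space set \<Rightarrow> ereal" where
  "lower_assouad_codim E = Sup {ereal q | q. q \<ge> 0 \<and>
     (\<exists>C\<ge>1. \<forall>x\<in>E. \<forall>r R. 0 < r \<and> r < R \<and> less_diameter R E \<longrightarrow>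
        measure lebesgue (closed_nbhd E r \<inter> ball x R)
          \<le> C * measure lebesgue (ball x R) * (r / R) powr q)}"

definition upper_assouad_codim :: "'a::euclidean_space set \<Rightarrow> ereal" where
  "upper_assouad_codim E = Inf {ereal q | q. q \<ge> 0 \<and>
     (\<exists>c>0. \<forall>x\<in>E. \<forall>r R. 0 < r \<and> r < R \<and> less_diameter R E \<longrightarrow>
        measure lebesgue (closed_nbhd E r \<inter> ball x R)
          \<ge> c * measure lebesgue (ball x R) * (r / R) powr q)}"

definition homogeneous_set :: "real \<Rightarrow> 'a::euclidean_space set \<Rightarrow> bool" where
  "homogeneous_set \<sigma> E \<longleftrightarrow>
     (\<exists>L. \<forall>x\<in>E. \<forall>t\<ge>1. \<forall>r>0.
        measure lebesgue {y. infdist y E \<le> r \<and> norm (x - y) \<le> t * r}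
          \<le> L * r ^ DIM('a) * t powr \<sigma>)"

definition plump :: "real \<Rightarrow> 'a::metric_space set \<Rightarrow> bool" where
  "plump \<kappa> E \<longleftrightarrow>
     (\<forall>r>0. less_diameter r E \<longrightarrow> (\<forall>x\<in>closure E. \<exists>z\<in>cball x r. ball z (\<kappa> * r) \<subseteq> E))"

end

theory Submission
  imports Defs
begin

text \<open>
  Why the theorem holds. A function in the fractional Sobolev space can be truncated in height, and a
  bounded function whose support is a compact subset of \<open>\<Omega>\<close> can be mollified
  (\<open>mollification_approximates\<close>). So the test functions are dense as soon as multiplication by a cutoff
  near the boundary costs little energy. By the product rule it suffices that there are functions
  equal to one near the boundary that tend to zero in \<open>\<Omega>\<close> and whose own energy tends to zero
  (\<open>density_of_test_functions\<close>).

  Such functions are linear in the logarithm of the distance to the boundary, spread over \<open>N\<close>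
  logarithmic scales. For a collar \<open>{x \<in> \<Omega>. infdist x (frontier \<Omega>) \<le> t}\<close> of measure at most \<open>B * t powr q\<close>
  their energy is at most a constant times \<open>N powr (1 - p) * \<sigma> powr (q - s * p)\<close>, where \<open>\<sigma>\<close> is the distance
  beyond which they vanish (\<open>log_cutoff_energy\<close>, \<open>density_if_thin_collars\<close>). If \<open>s * p\<close> is below the lower
  Assouad codimension, then \<open>q > s * p\<close> is possible and letting \<open>\<sigma>\<close> tend to zero is enough. If the boundary is
  homogeneous with exponent \<open>d - s * p\<close>, then \<open>q = s * p\<close>, and the factor \<open>N powr (1 - p)\<close> tends to zero when
  \<open>p > 1\<close>. The explicit cutoffs thus take the place of a weak compactness argument.

  For the negative result the constant one is not a limit of test functions. Above the upper Assouad
  codimension, every ball centred on the boundary contains so many disjoint smaller balls centred on the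
  boundary that one of them carries only a small share of the energy of a given test function
  (\<open>many_disjoint_balls\<close>, \<open>energy_concentrates\<close>). Iterating this gives a nested sequence of balls
  along which the energy decays so fast that the averages of the test function over plump balls next to
  them form a telescoping series controlled by the total energy. The averages vanish eventually, because the
  test function is zero near the boundary. Hence the first average is small if the energy is small
  (\<open>average_controlled_by_energy\<close>), whereas for a test function close to one it is close to one.
\<close>

section \<open>Smooth functions and mollifiers\<close>

lemma Ck_Suc_imp_Ck: "Ck (Suc k) f \<Longrightarrow> Ck k f"
proof (induction k arbitrary: f)
  case 0
  then show ?case
    by (simp add: continuous_at_imp_continuous_on differentiable_imp_continuous_within)
qed auto

lemma Ck_SucI:
  assumes "\<And>x. (f has_derivative D x) (at x)"
    and "\<And>b. b \<in> Basis \<Longrightarrow> Ck k (\<lambda>x. D x b)"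
  shows "Ck (Suc k) f"
proof -
  have "frechet_derivative f (at x) = D x" for x
    using frechet_derivative_at[OF assms(1)] by simp
  then show ?thesis
    using assms by (auto simp: differentiable_def)
qed

lemma Ck_SucD:
  assumes "Ck (Suc k) f"
  shows "(f has_derivative frechet_derivative f (at x)) (at x)"
    and "b \<in> Basis \<Longrightarrow> Ck k (\<lambda>x. frechet_derivative f (at x) b)"
  using assms by (auto simp: frechet_derivative_works)

lemma Ck_const: "Ck k (\<lambda>x. c)"
proof (induction k arbitrary: c)
  case (Suc k)
  show ?case by (rule Ck_SucI[where D = "\<lambda>_ _. 0"]) (auto intro: Suc)
qed simp

lemma Ck_inner: "Ck k (\<lambda>x. x \<bullet> v)"
proof (cases k)
  case (Suc j)
  show ?thesis unfolding Suc
    by (rule Ck_SucI[where D = "\<lambda>_ h. h \<bullet> v"]) (auto intro!: derivative_eq_intros Ck_const)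
qed (auto intro!: continuous_intros)

lemma Ck_add: "Ck k f \<Longrightarrow> Ck k g \<Longrightarrow> Ck k (\<lambda>x. f x + g x)"
proof (induction k arbitrary: f g)
  case (Suc k)
  let ?D = "\<lambda>f x. frechet_derivative f (at x)"
  show ?case
  proof (rule Ck_SucI[where D = "\<lambda>x h. ?D f x h + ?D g x h"])
    show "((\<lambda>x. f x + g x) has_derivative (\<lambda>h. ?D f x h + ?D g x h)) (at x)" for x
      by (intro has_derivative_add Ck_SucD(1)[OF Suc.prems(1)] Ck_SucD(1)[OF Suc.prems(2)])
    show "Ck k (\<lambda>x. ?D f x b + ?D g x b)" if "b \<in> Basis" for b
      by (intro Suc.IH Ck_SucD(2)[OF Suc.prems(1) that] Ck_SucD(2)[OF Suc.prems(2) that])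
  qed
qed (auto intro!: continuous_intros)

lemma Ck_mult: "Ck k f \<Longrightarrow> Ck k g \<Longrightarrow> Ck k (\<lambda>x. f x * g x)"
proof (induction k arbitrary: f g)
  case (Suc k)
  let ?D = "\<lambda>f x. frechet_derivative f (at x)"
  show ?case
  proof (rule Ck_SucI[where D = "\<lambda>x h. f x * ?D g x h + ?D f x h * g x"])
    show "((\<lambda>x. f x * g x) has_derivative (\<lambda>h. f x * ?D g x h + ?D f x h * g x)) (at x)" for x
      using has_derivative_mult[OF Ck_SucD(1)[OF Suc.prems(1)] Ck_SucD(1)[OF Suc.prems(2)]] .
    show "Ck k (\<lambda>x. f x * ?D g x b + ?D f x b * g x)" if "b \<in> Basis" for b
      using Suc that by (intro Ck_add Suc.IH) (auto intro: Ck_Suc_imp_Ck Ck_SucD(2) simp del: Ck.simps)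
  qed
qed (auto intro!: continuous_intros)

text \<open>The function that is smooth but flat at the origin, divided by powers of its argument.
  The powers are there because the derivative of each member of the family is a linear combination
  of two other members, so that smoothness follows by induction.\<close>

definition flat_exp :: "nat \<Rightarrow> real \<Rightarrow> real" where
  "flat_exp n t = (if t \<le> 0 then 0 else exp (- 1 / t) / t ^ n)"

lemma power_le_fact_exp:
  assumes "0 \<le> (u::real)"
  shows "u ^ m \<le> fact m * exp u"
proof -
  have "u ^ m / fact m = (\<Sum>k\<in>{m}. u ^ k / fact k)"
    by simp
  also have "\<dots> \<le> (\<Sum>k. u ^ k / fact k)"
    using summable_exp[of u] assms
    by (intro sum_le_suminf) (auto simp: field_simps)
  also have "\<dots> = exp u"
    by (simp add: exp_def scaleR_conv_of_real field_simps)
  finally show ?thesis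
    by (simp add: field_simps)
qed

text \<open>Every power of \<open>1 / t\<close> is dominated by a multiple of \<open>exp (1 / t)\<close>. The quadratic
  bound is what makes the derivative at the origin exist and vanish.\<close>

lemma flat_exp_le: "\<bar>flat_exp n t\<bar> \<le> fact (n + 2) * t\<^sup>2"
proof (cases "t \<le> 0")
  case False
  then have t: "t > 0" by simp
  have "(1 / t) ^ (n + 2) \<le> fact (n + 2) * exp (1 / t)"
    using t by (intro power_le_fact_exp) auto
  then have "exp (- 1 / t) \<le> fact (n + 2) * t ^ (n + 2)"
    using t by (simp add: field_simps exp_minus del: fact_Suc)
  then show ?thesis
    using t by (simp add: flat_exp_def divide_le_eq power_add power2_eq_square mult_ac)
qed (simp add: flat_exp_def)

lemma DERIV_flat_exp:
  "(flat_exp n has_real_derivative flat_exp (n + 2) t - real n * flat_exp (n + 1) t) (at t)"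
proof -
  consider "t < 0" | "t > 0" | "t = 0" by linarith
  then show ?thesis
  proof cases
    case 1
    have "((\<lambda>_. 0) has_real_derivative 0) (at t)" by simp
    then have "(flat_exp n has_real_derivative 0) (at t)"
      by (rule has_field_derivative_transform_within_open[where S = "{..<0}"])
        (use 1 in \<open>auto simp: flat_exp_def\<close>)
    then show ?thesis using 1 by (simp add: flat_exp_def)
  next
    case 2
    have "((\<lambda>t. exp (- 1 / t) / t ^ n) has_real_derivative
        flat_exp (n + 2) t - real n * flat_exp (n + 1) t) (at t)"
    proof -
      have "real n * t ^ (n - Suc 0) * t = real n * t ^ n"
        by (cases n) auto
      then show ?thesis
        using 2 by (auto intro!: derivative_eq_intros simp: flat_exp_def field_simps power2_eq_square)
    qed
    then show ?thesis
      by (rule has_field_derivative_transform_within_open[where S = "{0<..}"])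
        (use 2 in \<open>auto simp: flat_exp_def\<close>)
  next
    case 3
    have "(\<lambda>h. (flat_exp n (0 + h) - flat_exp n 0) / h) \<midarrow>0\<rightarrow> 0"
    proof (rule Lim_null_comparison[where g = "\<lambda>h. fact (n + 2) * \<bar>h\<bar>"])
      have "norm ((flat_exp n (0 + h) - flat_exp n 0) / h) \<le> fact (n + 2) * \<bar>h\<bar>" for h
        using flat_exp_le[of n h]
        by (cases "h = 0") (auto simp: flat_exp_def[of n 0] divide_le_eq power2_eq_square mult_ac
            simp del: fact_Suc)
      then show "\<forall>\<^sub>F h in at 0. norm ((flat_exp n (0 + h) - flat_exp n 0) / h) \<le> fact (n + 2) * \<bar>h\<bar>"
        by simp
      show "(\<lambda>h. fact (n + 2) * \<bar>h\<bar>) \<midarrow>0\<rightarrow> (0::real)"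
        by (auto intro!: tendsto_eq_intros)
    qed
    then show ?thesis
      using 3 by (simp add: DERIV_def flat_exp_def)
  qed
qed

text \<open>The chain rule leads from one member of the family to products of other members with linear
  functions; this is why the induction has to treat all \<open>n\<close> simultaneously.\<close>

lemma Ck_flat_exp_ball:
  fixes a :: real
  shows "Ck k (\<lambda>x::'a::euclidean_space. flat_exp n (a - x \<bullet> x))"
proof (induction k arbitrary: n)
  case 0
  have "continuous_on UNIV (flat_exp n)"
    by (meson DERIV_flat_exp DERIV_isCont continuous_at_imp_continuous_on)
  then show ?case
    by (auto intro!: continuous_intros continuous_on_compose2[of UNIV "flat_exp n"])
next
  case (Suc k)
  let ?f' = "\<lambda>x::'a. flat_exp (n + 2) (a - x \<bullet> x) + - real n * flat_exp (n + 1) (a - x \<bullet> x)"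
  show ?case
  proof (rule Ck_SucI[where D = "\<lambda>x h. ?f' x * (- 2 * (x \<bullet> h))"])
    show "((\<lambda>x. flat_exp n (a - x \<bullet> x)) has_derivative (\<lambda>h. ?f' x * (- 2 * (x \<bullet> h)))) (at x)" for x
    proof -
      have "((\<lambda>x. a - x \<bullet> x) has_derivative (\<lambda>h. - 2 * (x \<bullet> h))) (at x)"
        by (auto intro!: derivative_eq_intros simp: inner_commute)
      from DERIV_compose_FDERIV[OF DERIV_flat_exp this] show ?thesis
        by (simp add: mult_ac algebra_simps)
    qed
    show "Ck k (\<lambda>x. ?f' x * (- 2 * (x \<bullet> b)))" for b
      by (intro Ck_mult Ck_add Ck_const Ck_inner Suc)
  qed
qed

lemma uniformly_continuous_on_bounded_support:
  fixes f :: "'a::euclidean_space \<Rightarrow> real"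
  assumes "continuous_on UNIV f" and "\<And>x. norm x > r \<Longrightarrow> f x = 0"
  shows "uniformly_continuous_on UNIV f"
  unfolding uniformly_continuous_on_def
proof (intro allI impI)
  fix e :: real
  assume e: "e > 0"
  have "uniformly_continuous_on (cball 0 (r + 1)) f"
    by (intro compact_uniformly_continuous continuous_on_subset[OF assms(1)]) auto
  then obtain d where d: "d > 0"
    "\<And>x x'. norm x \<le> r + 1 \<Longrightarrow> norm x' \<le> r + 1 \<Longrightarrow> dist x' x < d \<Longrightarrow> dist (f x') (f x) < e"
    unfolding uniformly_continuous_on_def using e by (metis mem_cball_0)
  have "dist (f x') (f x) < e" if "dist x' x < min d 1" for x x'
  proof (cases "norm x \<le> r + 1 \<and> norm x' \<le> r + 1")
    case False
    have "\<bar>norm x - norm x'\<bar> < 1"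
      using that norm_triangle_ineq3[of x x'] by (simp add: dist_norm norm_minus_commute)
    then have "norm x > r" "norm x' > r"
      using False by auto
    then show ?thesis using assms(2) e by simp
  qed (use d that in auto)
  then show "\<exists>d>0. \<forall>x\<in>UNIV. \<forall>x'\<in>UNIV. dist x' x < d \<longrightarrow> dist (f x') (f x) < e"
    using d(1) by (intro exI[of _ "min d 1"]) auto
qed

text \<open>The remainder in the definition of the derivative is controlled independently of the base
  point. This uniformity is what allows differentiation under the integral sign below, where nothing is
  known about \<open>g\<close> except integrability.\<close>

lemma derivative_uniform:
  fixes \<phi> :: "'a::euclidean_space \<Rightarrow> real"
  assumes D: "\<And>x. (\<phi> has_derivative D x) (at x)"
    and cont: "\<And>b. b \<in> Basis \<Longrightarrow> uniformly_continuous_on UNIV (\<lambda>x. D x b)"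
    and e: "e > 0"
  shows "\<exists>d>0. \<forall>x h. norm h < d \<longrightarrow> \<bar>\<phi> (x + h) - \<phi> x - D x h\<bar> \<le> e * norm h"
proof -
  define e' where "e' = e / DIM('a)"
  have e': "e' > 0" using e by (simp add: e'_def)
  have "\<forall>b\<in>Basis. \<exists>d>0. \<forall>x x'. dist x' x < d \<longrightarrow> dist (D x' b) (D x b) < e'"
    using cont e' unfolding uniformly_continuous_on_def by (metis UNIV_I)
  then obtain d where d: "\<And>b. b \<in> Basis \<Longrightarrow> d b > 0"
    "\<And>b x x'. b \<in> Basis \<Longrightarrow> dist x' x < d b \<Longrightarrow> dist (D x' b) (D x b) < e'"
    by metis
  define \<delta> where "\<delta> = Min (d ` Basis)"
  have \<delta>: "\<delta> > 0" "\<And>b. b \<in> Basis \<Longrightarrow> \<delta> \<le> d b"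
    using d(1) by (auto simp: \<delta>_def)
  have "\<bar>\<phi> (x + h) - \<phi> x - D x h\<bar> \<le> e * norm h" if h: "norm h < \<delta>" for x h
  proof -
    have lin: "bounded_linear (D y)" for y
      using D has_derivative_bounded_linear by blast
    have "onorm (\<lambda>v. D y v - D x v) \<le> e" if y: "y \<in> ball x \<delta>" for y
    proof -
      have "onorm (\<lambda>v. D y v - D x v) \<le> (\<Sum>b\<in>Basis. norm (D y b - D x b))"
        by (intro onorm_componentwise bounded_linear_sub lin)
      also have "\<dots> \<le> (\<Sum>b\<in>(Basis::'a set). e')"
        using d(2)[of _ y x] \<delta>(2) y
        by (intro sum_mono) (fastforce simp: dist_real_def dist_commute intro: less_imp_le)
      also have "\<dots> = e" by (simp add: e'_def)
      finally show ?thesis .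
    qed
    then have "norm (\<phi> (x + h) - \<phi> x - D x ((x + h) - x)) \<le> norm ((x + h) - x) * e"
      using h \<delta>(1)
      by (intro differentiable_bound_linearization[where S = "ball x \<delta>" and f' = D])
        (auto simp: dist_norm fun_diff_def intro: has_derivative_at_withinI D mult_le_cancel_right1
          le_less_trans[OF mult_left_le_one_le])
    then show ?thesis by (simp add: mult_ac)
  qed
  then show ?thesis using \<delta>(1) by blast
qed

definition convolve :: "('a::euclidean_space \<Rightarrow> real) \<Rightarrow> ('a \<Rightarrow> real) \<Rightarrow> 'a \<Rightarrow> real" where
  "convolve g \<phi> x = (\<integral>y. g y * \<phi> (x - y) \<partial>lborel)"

lemma integrable_mult_bounded_continuous:
  fixes g \<psi> :: "'a::euclidean_space \<Rightarrow> real"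
  assumes g: "integrable lborel g" and c: "continuous_on UNIV \<psi>" and B: "\<And>x. \<bar>\<psi> x\<bar> \<le> B"
  shows "integrable lborel (\<lambda>y. g y * \<psi> (x - y))"
proof (rule Bochner_Integration.integrable_bound[where f = "\<lambda>y. B * g y"])
  have [measurable]: "\<psi> \<in> borel_measurable borel" "g \<in> borel_measurable borel"
    using c g by (auto intro: borel_measurable_continuous_onI)
  show "(\<lambda>y. g y * \<psi> (x - y)) \<in> borel_measurable lborel" by simp
  show "AE y in lborel. norm (g y * \<psi> (x - y)) \<le> norm (B * g y)"
  proof (intro AE_I2)
    fix y
    have "0 \<le> B" using B[of x] by linarith
    then show "norm (g y * \<psi> (x - y)) \<le> norm (B * g y)"
      using mult_right_mono[OF B[of "x - y"], of "\<bar>g y\<bar>"] by (simp add: abs_mult mult.commute)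
  qed
qed (use g in simp)

lemma bounded_if_bounded_support:
  fixes f :: "'a::euclidean_space \<Rightarrow> real"
  assumes "continuous_on UNIV f" and "\<And>x. norm x > r \<Longrightarrow> f x = 0"
  obtains B where "\<And>x. \<bar>f x\<bar> \<le> B"
proof -
  have "compact (f ` cball 0 r)"
    by (intro compact_continuous_image continuous_on_subset[OF assms(1)]) auto
  then obtain B where "\<And>x. norm x \<le> r \<Longrightarrow> \<bar>f x\<bar> \<le> B"
    using compact_imp_bounded[THEN bounded_iff[THEN iffD1]] by (auto) force
  then have "\<bar>f x\<bar> \<le> max B 0" for x
    using assms(2)[of x] \<open>\<And>x. norm x \<le> r \<Longrightarrow> \<bar>f x\<bar> \<le> B\<close>[of x]
    by (cases "norm x \<le> r") (auto simp: le_max_iff_disj)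
  then show ?thesis using that by blast
qed


lemma frechet_derivative_outside_support:
  fixes \<phi> :: "'a::euclidean_space \<Rightarrow> real"
  assumes "\<And>x. norm x > r \<Longrightarrow> \<phi> x = 0" and "norm x > r"
  shows "frechet_derivative \<phi> (at x) = (\<lambda>_. 0)"
proof -
  have "open {x::'a. norm x > r}"
    by (intro open_Collect_less continuous_intros)
  moreover have "((\<lambda>_. 0::real) has_derivative (\<lambda>_. 0)) (at x)"
    by simp
  ultimately have "(\<phi> has_derivative (\<lambda>_. 0)) (at x)"
    using assms by (subst has_derivative_transform_within_open[of "\<lambda>_. 0" _ _ UNIV "{x. norm x > r}"]) auto
  then show ?thesis
    using frechet_derivative_at by metis
qed

text \<open>All derivatives fall on the smooth factor: the uniform remainder estimate for \<open>\<phi>\<close> is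
  integrated against \<open>\<bar>g\<bar>\<close>.\<close>

lemma has_derivative_convolve:
  fixes g \<phi> :: "'a::euclidean_space \<Rightarrow> real"
  assumes g: "integrable lborel g"
    and \<phi>: "Ck (Suc 0) \<phi>" and r: "\<And>x. norm x > r \<Longrightarrow> \<phi> x = 0"
  shows "(convolve g \<phi> has_derivative (\<lambda>h. convolve g (\<lambda>w. frechet_derivative \<phi> (at w) h) x)) (at x)"
proof -
  let ?D = "\<lambda>w. frechet_derivative \<phi> (at w)"
  have D: "(\<phi> has_derivative ?D w) (at w)" for w
    by (rule Ck_SucD[OF \<phi>])
  have Db: "continuous_on UNIV (\<lambda>w. ?D w b)" if "b \<in> Basis" for b
    using Ck_SucD(2)[OF \<phi> that] by simp
  have D0: "?D w h = 0" if "norm w > r" for w h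
    using frechet_derivative_outside_support[OF r that] by simp
  have expand: "?D w h = (\<Sum>b\<in>Basis. (h \<bullet> b) * ?D w b)" for w h
  proof -
    have "?D w (\<Sum>b\<in>Basis. (h \<bullet> b) *\<^sub>R b) = (\<Sum>b\<in>Basis. (h \<bullet> b) * ?D w b)"
      by (simp add: linear_sum[OF has_derivative_linear[OF D]] linear_scale[OF has_derivative_linear[OF D]])
    then show ?thesis by (simp add: euclidean_representation)
  qed
  have Dh: "continuous_on UNIV (\<lambda>w. ?D w h)" for h
    by (subst expand) (intro continuous_intros Db)
  have int: "integrable lborel (\<lambda>y. g y * \<psi> (x - y))"
    if \<psi>: "continuous_on UNIV \<psi>" "\<And>w. norm w > r \<Longrightarrow> \<psi> w = 0" for \<psi> x
  proof -
    obtain B where "\<And>w. \<bar>\<psi> w\<bar> \<le> B" using bounded_if_bounded_support[OF \<psi>] by metis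
    then show ?thesis using integrable_mult_bounded_continuous[OF g \<psi>(1)] by blast
  qed
  have int\<phi>: "integrable lborel (\<lambda>y. g y * \<phi> (x - y))" for x
    using Ck_Suc_imp_Ck[OF \<phi>] by (intro int r) auto
  have intD: "integrable lborel (\<lambda>y. g y * ?D (x - y) h)" for x h
    using int[OF Dh D0] .
  define G where "G = (\<integral>y. \<bar>g y\<bar> \<partial>lborel)"
  have G: "G \<ge> 0" by (simp add: G_def)
  show ?thesis
    unfolding has_derivative_at_alt
  proof (intro conjI allI impI)
    show "bounded_linear (\<lambda>h. convolve g (\<lambda>w. ?D w h) x)"
      unfolding linear_conv_bounded_linear[symmetric] convolve_def
    proof (rule linearI)
      show "(\<integral>y. g y * ?D (x - y) (a + b) \<partial>lborel) =
        (\<integral>y. g y * ?D (x - y) a \<partial>lborel) + (\<integral>y. g y * ?D (x - y) b \<partial>lborel)" for a b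
        using linear_add[OF has_derivative_linear[OF D]]
        by (simp add: distrib_left Bochner_Integration.integral_add intD)
      show "(\<integral>y. g y * ?D (x - y) (c *\<^sub>R a) \<partial>lborel) = c *\<^sub>R (\<integral>y. g y * ?D (x - y) a \<partial>lborel)" for c a
        by (simp add: linear_scale[OF has_derivative_linear[OF D]] mult.left_commute)
    qed
    fix e :: real
    assume e: "e > 0"
    have pos: "e / (G + 1) > 0" using e G by simp
    have uc: "uniformly_continuous_on UNIV (\<lambda>w. ?D w b)" if "b \<in> Basis" for b
      using uniformly_continuous_on_bounded_support[OF Db[OF that] D0] .
    obtain d where d: "d > 0"
      "\<And>w h. norm h < d \<Longrightarrow> \<bar>\<phi> (w + h) - \<phi> w - ?D w h\<bar> \<le> e / (G + 1) * norm h"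
      using derivative_uniform[OF D uc pos] by blast
    have "norm (convolve g \<phi> y - convolve g \<phi> x - convolve g (\<lambda>w. ?D w (y - x)) x) \<le> e * norm (y - x)"
      if y: "norm (y - x) < d" for y
    proof -
      have "norm (convolve g \<phi> y - convolve g \<phi> x - convolve g (\<lambda>w. ?D w (y - x)) x)
        = \<bar>\<integral>z. g z * \<phi> (y - z) - g z * \<phi> (x - z) - g z * ?D (x - z) (y - x) \<partial>lborel\<bar>"
        by (simp add: convolve_def int\<phi> intD)
      also have "\<dots> \<le> (\<integral>z. \<bar>g z * \<phi> (y - z) - g z * \<phi> (x - z) - g z * ?D (x - z) (y - x)\<bar> \<partial>lborel)"
        by (rule integral_abs_bound)
      also have "\<dots> \<le> (\<integral>z. \<bar>g z\<bar> * (e / (G + 1) * norm (y - x)) \<partial>lborel)"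
      proof (rule integral_mono)
        fix z
        let ?r = "\<phi> (y - z) - \<phi> (x - z) - ?D (x - z) (y - x)"
        have "\<bar>?r\<bar> \<le> e / (G + 1) * norm (y - x)"
          using d(2)[OF y, of "x - z"] by (simp add: algebra_simps)
        then have "\<bar>g z\<bar> * \<bar>?r\<bar> \<le> \<bar>g z\<bar> * (e / (G + 1) * norm (y - x))"
          by (rule mult_left_mono) simp
        moreover have "g z * \<phi> (y - z) - g z * \<phi> (x - z) - g z * ?D (x - z) (y - x) = g z * ?r"
          by (simp add: right_diff_distrib)
        ultimately show "\<bar>g z * \<phi> (y - z) - g z * \<phi> (x - z) - g z * ?D (x - z) (y - x)\<bar>
            \<le> \<bar>g z\<bar> * (e / (G + 1) * norm (y - x))"
          by (simp only: abs_mult)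
      qed (use g int\<phi> intD in auto)
      also have "\<dots> = e * norm (y - x) * (G / (G + 1))"
        by (simp add: G_def)
      also have "\<dots> \<le> e * norm (y - x)"
        using e G by (intro mult_left_le) auto
      finally show ?thesis .
    qed
    then show "\<exists>d>0. \<forall>y. norm (y - x) < d \<longrightarrow>
      norm (convolve g \<phi> y - convolve g \<phi> x - convolve g (\<lambda>w. ?D w (y - x)) x) \<le> e * norm (y - x)"
      using d(1) by blast
  qed
qed

text \<open>The order drops by one because continuity, the base case, is read off from differentiability.\<close>

lemma Ck_convolve:
  fixes g \<phi> :: "'a::euclidean_space \<Rightarrow> real"
  assumes g: "integrable lborel g"
    and "Ck (Suc k) \<phi>" and "\<And>x. norm x > r \<Longrightarrow> \<phi> x = 0"
  shows "Ck k (convolve g \<phi>)"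
  using assms(2,3)
proof (induction k arbitrary: \<phi>)
  case 0
  then show ?case
    using has_derivative_convolve[OF g, of \<phi> r, THEN has_derivative_continuous]
    by (simp add: continuous_at_imp_continuous_on del: Ck.simps(2))
next
  case (Suc k)
  show ?case
  proof (rule Ck_SucI)
    have "Ck (Suc 0) \<phi>"
      using Suc.prems(1) by (induction k) (auto intro: Ck_Suc_imp_Ck simp del: Ck.simps)
    then show "(convolve g \<phi> has_derivative (\<lambda>h. convolve g (\<lambda>w. frechet_derivative \<phi> (at w) h) x)) (at x)" for x
      using has_derivative_convolve[OF g] Suc.prems(2) by blast
    show "Ck k (\<lambda>x. convolve g (\<lambda>w. frechet_derivative \<phi> (at w) b) x)" if b: "b \<in> Basis" for b
    proof (rule Suc.IH[OF Ck_SucD(2)[OF Suc.prems(1) b]])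
      show "frechet_derivative \<phi> (at x) b = 0" if "norm x > r" for x
        using frechet_derivative_outside_support[OF Suc.prems(2) that] by simp
    qed
  qed
qed

definition mollifier :: "real \<Rightarrow> 'a::euclidean_space \<Rightarrow> real" where
  "mollifier e x = flat_exp 0 (e\<^sup>2 - x \<bullet> x) / (\<integral>(y::'a). flat_exp 0 (e\<^sup>2 - y \<bullet> y) \<partial>lborel)"

lemma flat_exp_nonneg: "flat_exp n t \<ge> 0"
  by (simp add: flat_exp_def)

lemma flat_exp_0_outside:
  assumes "norm x \<ge> e" and "e > 0"
  shows "flat_exp 0 (e\<^sup>2 - x \<bullet> x) = 0"
  using power_mono[of e "norm x" 2] assms
  by (simp add: flat_exp_def power2_norm_eq_inner)

lemma flat_exp_ball_integrable:
  assumes "e > 0"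
  shows "integrable lborel (\<lambda>y::'a::euclidean_space. flat_exp 0 (e\<^sup>2 - y \<bullet> y))"
proof -
  have c: "continuous_on UNIV (\<lambda>y::'a. flat_exp 0 (e\<^sup>2 - y \<bullet> y))"
    using Ck_flat_exp_ball[of 0] by simp
  have "integrable lborel (\<lambda>y::'a. indicator (cball 0 e) y *\<^sub>R flat_exp 0 (e\<^sup>2 - y \<bullet> y))"
    by (intro borel_integrable_compact continuous_on_subset[OF c]) auto
  then show ?thesis
    by (rule Bochner_Integration.integrable_cong[THEN iffD1, rotated 2])
      (auto simp: indicator_def flat_exp_0_outside assms)
qed

lemma flat_exp_ball_integral_pos:
  assumes "e > 0"
  shows "(\<integral>(y::'a::euclidean_space). flat_exp 0 (e\<^sup>2 - y \<bullet> y) \<partial>lborel) > 0"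
proof -
  let ?f = "\<lambda>y::'a. flat_exp 0 (e\<^sup>2 - y \<bullet> y)"
  have "(\<integral>y. ?f y \<partial>lborel) \<noteq> 0"
  proof
    assume "(\<integral>y. ?f y \<partial>lborel) = 0"
    then have "AE y in lborel. ?f y = 0"
      using integral_nonneg_eq_0_iff_AE[OF flat_exp_ball_integrable[OF assms]] flat_exp_nonneg by blast
    then have "AE y in lborel. y \<notin> ball (0::'a) e"
    proof eventually_elim
      case (elim y)
      show ?case
        using elim assms power_strict_mono[of "norm y" e 2]
        by (auto simp: flat_exp_def power2_norm_eq_inner split: if_splits)
    qed
    then have "emeasure lborel (ball (0::'a) e) = 0"
      by (subst (asm) AE_iff_measurable[where N = "ball (0::'a) e"]) auto
    then show False
      using assms unit_ball_vol_pos[of "real DIM('a)"] by (simp add: emeasure_ball)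
  qed
  moreover have "(\<integral>y. ?f y \<partial>lborel) \<ge> 0"
    by (intro integral_nonneg_AE AE_I2 flat_exp_nonneg)
  ultimately show ?thesis by simp
qed

lemma mollifier:
  assumes "e > 0"
  shows mollifier_nonneg: "mollifier e x \<ge> 0"
    and mollifier_outside: "norm (x::'a::euclidean_space) \<ge> e \<Longrightarrow> mollifier e x = 0"
    and Ck_mollifier: "Ck k (mollifier e :: 'a \<Rightarrow> real)"
    and integrable_mollifier: "integrable lborel (mollifier e :: 'a \<Rightarrow> real)"
    and integral_mollifier: "(\<integral>y. mollifier e (y::'a) \<partial>lborel) = 1"
proof -
  let ?I = "\<integral>(y::'a). flat_exp 0 (e\<^sup>2 - y \<bullet> y) \<partial>lborel"
  have I: "?I > 0" by (rule flat_exp_ball_integral_pos[OF assms])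
  show "mollifier e x \<ge> 0"
    using I by (simp add: mollifier_def flat_exp_nonneg)
  show "norm x \<ge> e \<Longrightarrow> mollifier e x = 0"
    using assms by (simp add: mollifier_def flat_exp_0_outside)
  have eq: "mollifier e = (\<lambda>x::'a. (1 / ?I) * flat_exp 0 (e\<^sup>2 - x \<bullet> x))"
    by (simp add: mollifier_def fun_eq_iff)
  show "Ck k (mollifier e :: 'a \<Rightarrow> real)"
    unfolding eq by (intro Ck_mult Ck_const Ck_flat_exp_ball)
  show "integrable lborel (mollifier e :: 'a \<Rightarrow> real)"
    unfolding eq by (intro integrable_mult_right flat_exp_ball_integrable assms)
  show "(\<integral>y. mollifier e (y::'a) \<partial>lborel) = 1"
    unfolding eq using I by simp
qed

section \<open>Jensen's inequality and continuity of translations\<close>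

lemma abs_add_powr_le:
  fixes a b p :: real
  assumes "p \<ge> 0"
  shows "\<bar>a + b\<bar> powr p \<le> 2 powr p * (\<bar>a\<bar> powr p + \<bar>b\<bar> powr p)"
proof -
  have "\<bar>a + b\<bar> powr p \<le> (2 * max \<bar>a\<bar> \<bar>b\<bar>) powr p"
    using assms by (intro powr_mono2) auto
  also have "\<dots> = 2 powr p * max \<bar>a\<bar> \<bar>b\<bar> powr p"
    by (simp add: powr_mult)
  also have "\<dots> \<le> 2 powr p * (\<bar>a\<bar> powr p + \<bar>b\<bar> powr p)"
    by (intro mult_left_mono) (auto simp: max_def)
  finally show ?thesis .
qed

text \<open>The graph of the convex function \<open>t powr p\<close> lies above its tangent at \<open>m\<close>; this is a form of
  Young's inequality.\<close>

lemma powr_ge_tangent: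
  fixes m t p :: real
  assumes "m > 0" "t \<ge> 0" "p \<ge> 1"
  shows "t powr p \<ge> p * m powr (p - 1) * t - (p - 1) * m powr p"
proof (cases "t = 0")
  case True
  then show ?thesis using assms by simp
next
  case False
  have "(t powr p) powr (1 / p) * (m powr p) powr (1 - 1 / p) \<le> 1 / p * t powr p + (1 - 1 / p) * m powr p"
    using assms False by (intro Youngs_inequality_0) auto
  moreover have "(t powr p) powr (1 / p) = t" "(m powr p) powr (1 - 1 / p) = m powr (p - 1)"
    using assms by (auto simp: powr_powr right_diff_distrib)
  ultimately have "t * m powr (p - 1) \<le> 1 / p * t powr p + (1 - 1 / p) * m powr p"
    by simp
  then have "p * (t * m powr (p - 1)) \<le> p * (1 / p * t powr p + (1 - 1 / p) * m powr p)"
    using assms by (intro mult_left_mono) auto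
  then show ?thesis
    using assms by (simp add: distrib_left right_diff_distrib left_diff_distrib mult_ac)
qed

text \<open>The tangent inequality at the point \<open>m = \<bar>\<integral>z. w z * k z \<partial>M\<bar>\<close>, integrated against the weight.
  The same inequality serves for mollification, with a mollifier as the weight, and for averages over
  balls, with a normalized indicator function.\<close>

lemma jensen_powr:
  fixes w k :: "'b \<Rightarrow> real"
  assumes w: "\<And>z. w z \<ge> 0" "integrable M w" "(\<integral>z. w z \<partial>M) = 1"
    and k[measurable]: "k \<in> borel_measurable M" and wk: "integrable M (\<lambda>z. w z * k z)" and p: "p \<ge> 1"
  shows "ennreal (\<bar>\<integral>z. w z * k z \<partial>M\<bar> powr p) \<le> (\<integral>\<^sup>+z. ennreal (w z * \<bar>k z\<bar> powr p) \<partial>M)"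
proof (cases "(\<integral>\<^sup>+z. ennreal (w z * \<bar>k z\<bar> powr p) \<partial>M) = \<infinity>")
  case False
  define m where "m = \<bar>\<integral>z. w z * k z \<partial>M\<bar>"
  have [measurable]: "w \<in> borel_measurable M" using w(2) by simp
  have int: "integrable M (\<lambda>z. w z * \<bar>k z\<bar> powr p)"
    using False w(1) by (intro integrableI_nonneg) (auto simp: top.not_eq_extremum)
  have wka: "integrable M (\<lambda>z. w z * \<bar>k z\<bar>)"
    using integrable_abs[OF wk] w(1) by (simp add: abs_mult)
  have "m powr p \<le> (\<integral>z. w z * \<bar>k z\<bar> powr p \<partial>M)"
  proof (cases "m = 0")
    case True
    then show ?thesis using w(1) by (auto intro!: integral_nonneg_AE)
  next
    case False
    then have m: "m > 0" by (simp add: m_def)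
    have "m \<le> (\<integral>z. w z * \<bar>k z\<bar> \<partial>M)"
      unfolding m_def using integral_abs_bound[of M "\<lambda>z. w z * k z"] w(1) by (simp add: abs_mult)
    have "m powr p = p * m powr (p - 1) * m - (p - 1) * m powr p"
      using m powr_add[of m "p - 1" 1] by (simp add: algebra_simps)
    also have "\<dots> \<le> p * m powr (p - 1) * (\<integral>z. w z * \<bar>k z\<bar> \<partial>M) - (p - 1) * m powr p"
      using \<open>m \<le> _\<close> p by (intro diff_right_mono mult_left_mono) auto
    also have "\<dots> = (\<integral>z. p * m powr (p - 1) * (w z * \<bar>k z\<bar>) - (p - 1) * m powr p * w z \<partial>M)"
      using wka w by simp
    also have "\<dots> \<le> (\<integral>z. w z * \<bar>k z\<bar> powr p \<partial>M)"
    proof (rule integral_mono)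
      fix z
      show "p * m powr (p - 1) * (w z * \<bar>k z\<bar>) - (p - 1) * m powr p * w z \<le> w z * \<bar>k z\<bar> powr p"
        using mult_left_mono[OF powr_ge_tangent[OF m abs_ge_zero p, of "k z"] w(1)[of z]]
        by (simp add: algebra_simps)
    qed (use wka w int in auto)
    finally show ?thesis .
  qed
  then show ?thesis
    unfolding m_def using w(1) int by (subst nn_integral_eq_integral) auto
qed simp

lemma nn_integral_lborel_translate:
  fixes f :: "'b::euclidean_space \<Rightarrow> ennreal"
  assumes [measurable]: "f \<in> borel_measurable borel"
  shows "(\<integral>\<^sup>+x. f (x + c) \<partial>lborel) = (\<integral>\<^sup>+x. f x \<partial>lborel)"
proof -
  have "(\<integral>\<^sup>+x. f x \<partial>lborel) = (\<integral>\<^sup>+x. f x \<partial>(distr lborel borel ((+) c)))"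
    by (simp add: lborel_distr_plus)
  also have "\<dots> = (\<integral>\<^sup>+x. f (c + x) \<partial>lborel)"
    by (subst nn_integral_distr) auto
  finally show ?thesis by (simp add: add.commute)
qed

text \<open>Continuity of translations is phrased through the \<open>p\<close>-th power of the distance in \<open>Lp\<close>.
  Working with \<open>p\<close>-th powers throughout, the triangle inequality is replaced by the elementary estimate
  with the factor \<open>2 powr p\<close>.\<close>

definition translation_continuous :: "real \<Rightarrow> ('b::euclidean_space \<Rightarrow> real) \<Rightarrow> bool" where
  "translation_continuous p F \<longleftrightarrow>
     (\<forall>e>0. \<exists>d>0. \<forall>z. norm z < d \<longrightarrow> (\<integral>\<^sup>+x. ennreal (\<bar>F (x + z) - F x\<bar> powr p) \<partial>lborel) \<le> ennreal e)"

lemma nn_integral_powr_add_le: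
  fixes f g :: "'b \<Rightarrow> real"
  assumes [measurable]: "f \<in> borel_measurable M" "g \<in> borel_measurable M" and p: "p \<ge> 0"
  shows "(\<integral>\<^sup>+x. ennreal (\<bar>f x + g x\<bar> powr p) \<partial>M) \<le>
    ennreal (2 powr p) * ((\<integral>\<^sup>+x. ennreal (\<bar>f x\<bar> powr p) \<partial>M) + (\<integral>\<^sup>+x. ennreal (\<bar>g x\<bar> powr p) \<partial>M))"
proof -
  have "(\<integral>\<^sup>+x. ennreal (\<bar>f x + g x\<bar> powr p) \<partial>M) \<le>
    (\<integral>\<^sup>+x. ennreal (2 powr p) * (ennreal (\<bar>f x\<bar> powr p) + ennreal (\<bar>g x\<bar> powr p)) \<partial>M)"
    by (intro nn_integral_mono)
      (simp add: abs_add_powr_le[OF p] ennreal_mult'[symmetric] flip: ennreal_plus)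
  then show ?thesis
    by (simp add: nn_integral_cmult nn_integral_add)
qed

text \<open>Translations preserve the integral, so the functions on which they act continuously form
  a closed set.\<close>

lemma translation_continuous_approx:
  fixes F :: "'b::euclidean_space \<Rightarrow> real"
  assumes [measurable]: "F \<in> borel_measurable borel" and p: "p \<ge> 0"
    and approx: "\<And>e. e > 0 \<Longrightarrow> \<exists>h\<in>borel_measurable borel. translation_continuous p h \<and>
        (\<integral>\<^sup>+x. ennreal (\<bar>F x - h x\<bar> powr p) \<partial>lborel) \<le> ennreal e"
  shows "translation_continuous p F"
  unfolding translation_continuous_def
proof (intro allI impI)
  fix e :: real
  assume e: "e > 0"
  define e' where "e' = e / (3 * (2 powr p) ^ 2)"
  have e': "e' > 0" using e by (simp add: e'_def)
  obtain h where [measurable]: "h \<in> borel_measurable borel" and h: "translation_continuous p h"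
    and Fh: "(\<integral>\<^sup>+x. ennreal (\<bar>F x - h x\<bar> powr p) \<partial>lborel) \<le> ennreal e'"
    using approx[OF e'] by auto
  obtain d where d: "d > 0"
    "\<And>z. norm z < d \<Longrightarrow> (\<integral>\<^sup>+x. ennreal (\<bar>h (x + z) - h x\<bar> powr p) \<partial>lborel) \<le> ennreal e'"
    using h e' unfolding translation_continuous_def by metis
  have "(\<integral>\<^sup>+x. ennreal (\<bar>F (x + z) - F x\<bar> powr p) \<partial>lborel) \<le> ennreal e" if z: "norm z < d" for z
  proof -
    let ?I = "\<lambda>f. \<integral>\<^sup>+x. ennreal (\<bar>f x\<bar> powr p) \<partial>lborel"
    let ?c = "ennreal (2 powr p)"
    have 1: "?I (\<lambda>x. F (x + z) - h (x + z)) \<le> ennreal e'"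
      using nn_integral_lborel_translate[of "\<lambda>x. ennreal (\<bar>F x - h x\<bar> powr p)" z] Fh by simp
    have 2: "?I (\<lambda>x. h (x + z) - h x) \<le> ennreal e'"
      using d(2)[OF z] .
    have 3: "?I (\<lambda>x. h x - F x) \<le> ennreal e'"
      using Fh by (simp add: abs_minus_commute)
    have "?I (\<lambda>x. F (x + z) - F x) = ?I (\<lambda>x. ((F (x + z) - h (x + z)) + (h (x + z) - h x)) + (h x - F x))"
      by simp
    also have "\<dots> \<le> ?c * (?I (\<lambda>x. (F (x + z) - h (x + z)) + (h (x + z) - h x)) + ?I (\<lambda>x. h x - F x))"
      by (intro nn_integral_powr_add_le p) auto
    also have "\<dots> \<le> ?c * (?c * (?I (\<lambda>x. F (x + z) - h (x + z)) + ?I (\<lambda>x. h (x + z) - h x)) + ?I (\<lambda>x. h x - F x))"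
      by (intro mult_left_mono add_mono nn_integral_powr_add_le p order_refl) auto
    also have "\<dots> \<le> ?c * (?c * (ennreal e' + ennreal e') + ennreal e')"
      by (intro mult_left_mono add_mono 1 2 3) auto
    also have "\<dots> = ennreal (2 powr p * (2 powr p * (e' + e') + e'))"
      using e' by (simp add: ennreal_mult'[symmetric] flip: ennreal_plus)
    also have "\<dots> \<le> ennreal e"
    proof (intro ennreal_leI)
      have "2 powr p * e' \<le> 2 powr p * (2 powr p * e')"
        using e' p by (intro mult_left_mono) (auto intro!: ge_one_powr_ge_zero)
      then have "2 powr p * (2 powr p * (e' + e') + e') \<le> 3 * (2 powr p) ^ 2 * e'"
        by (simp add: power2_eq_square algebra_simps)
      also have "\<dots> = e" by (simp add: e'_def)
      finally show "2 powr p * (2 powr p * (e' + e') + e') \<le> e" .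
    qed
    finally show ?thesis .
  qed
  then show "\<exists>d>0. \<forall>z. norm z < d \<longrightarrow> (\<integral>\<^sup>+x. ennreal (\<bar>F (x + z) - F x\<bar> powr p) \<partial>lborel) \<le> ennreal e"
    using d(1) by blast
qed

lemma emeasure_lborel_cball_finite: "emeasure lborel (cball (x::'b::euclidean_space) r) < \<infinity>"
  by (intro emeasure_compact_finite) auto

lemma translation_continuous_continuous:
  fixes h :: "'b::euclidean_space \<Rightarrow> real"
  assumes c: "continuous_on UNIV h" and r: "\<And>x. norm x > r \<Longrightarrow> h x = 0" and p: "p \<ge> 1"
  shows "translation_continuous p h"
  unfolding translation_continuous_def
proof (intro allI impI)
  fix e :: real
  assume e: "e > 0"
  define V where "V = measure lborel (cball (0::'b) (r + 1))"
  define e' where "e' = (e / (V + 1)) powr (1 / p)"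
  have V: "V \<ge> 0" "emeasure lborel (cball (0::'b) (r + 1)) = ennreal V"
    using emeasure_lborel_cball_finite[of "0::'b" "r + 1"]
    by (simp_all add: V_def emeasure_eq_ennreal_measure less_top)
  have e': "e' > 0" "e' powr p = e / (V + 1)"
    using e V(1) p by (simp_all add: e'_def powr_powr)
  obtain d where d: "d > 0" "\<And>x x'. dist x' x < d \<Longrightarrow> dist (h x') (h x) < e'"
  proof -
    have "uniformly_continuous_on UNIV h"
      by (rule uniformly_continuous_on_bounded_support[OF c]) (rule r)
    then show ?thesis
      using that e'(1) unfolding uniformly_continuous_on_def by blast
  qed
  have "(\<integral>\<^sup>+x. ennreal (\<bar>h (x + z) - h x\<bar> powr p) \<partial>lborel) \<le> ennreal e" if z: "norm z < min d 1" for z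
  proof -
    have "(\<integral>\<^sup>+x. ennreal (\<bar>h (x + z) - h x\<bar> powr p) \<partial>lborel) \<le>
      (\<integral>\<^sup>+x. ennreal (e' powr p) * indicator (cball (0::'b) (r + 1)) x \<partial>lborel)"
    proof (rule nn_integral_mono)
      fix x
      show "ennreal (\<bar>h (x + z) - h x\<bar> powr p) \<le> ennreal (e' powr p) * indicator (cball 0 (r + 1)) x"
      proof (cases "norm x \<le> r + 1")
        case True
        have "\<bar>h (x + z) - h x\<bar> \<le> e'"
          using d(2)[of "x + z" x] z by (simp add: dist_norm less_imp_le)
        then have "\<bar>h (x + z) - h x\<bar> powr p \<le> e' powr p"
          using p by (intro powr_mono2) auto
        then show ?thesis
          using True by (simp add: ennreal_leI)
      next
        case False
        then have "norm (x + z) > r" "norm x > r"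
          using z norm_triangle_ineq4[of "x + z" z] by auto
        then show ?thesis by (simp add: r)
      qed
    qed
    also have "\<dots> = ennreal (e' powr p * V)"
      by (simp add: nn_integral_cmult_indicator V(2) ennreal_mult')
    also have "\<dots> \<le> ennreal e"
    proof (intro ennreal_leI)
      have "e / (V + 1) * V \<le> e"
        using e V(1) by (simp add: field_simps)
      then show "e' powr p * V \<le> e"
        by (simp only: e'(2))
    qed
    finally show ?thesis .
  qed
  then show "\<exists>d>0. \<forall>z. norm z < d \<longrightarrow> (\<integral>\<^sup>+x. ennreal (\<bar>h (x + z) - h x\<bar> powr p) \<partial>lborel) \<le> ennreal e"
    using d(1) by (intro exI[of _ "min d 1"]) auto
qed

definition clamp_abs :: "real \<Rightarrow> real \<Rightarrow> real" where
  "clamp_abs k t = max (- k) (min k t)"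

lemma clamp_abs:
  assumes "k \<ge> 0"
  shows "\<bar>clamp_abs k t\<bar> \<le> k" "\<bar>t\<bar> \<le> k \<Longrightarrow> clamp_abs k t = t"
    "\<bar>clamp_abs k t - clamp_abs k u\<bar> \<le> \<bar>t - u\<bar>" "\<bar>(t - clamp_abs k t) - (u - clamp_abs k u)\<bar> \<le> \<bar>t - u\<bar>"
    "\<bar>t - clamp_abs k t\<bar> \<le> \<bar>t\<bar>"
  using assms by (auto simp: clamp_abs_def)

lemma clamp_abs_measurable[measurable]: "clamp_abs k \<in> borel_measurable borel"
  unfolding clamp_abs_def[abs_def] by measurable

lemma ennreal_tendsto_0_ex_le:
  fixes f :: "nat \<Rightarrow> ennreal"
  assumes "f \<longlonglongrightarrow> 0" "e > 0"
  shows "\<exists>n. f n \<le> ennreal e"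
proof -
  have "eventually (\<lambda>n. f n < ennreal e) sequentially"
    using assms by (intro order_tendstoD(2)[OF assms(1)]) auto
  then show ?thesis
    by (auto simp: eventually_sequentially intro: less_imp_le)
qed

text \<open>A measurable function is almost everywhere the limit of continuous functions. Truncated
  in height and in support, these converge in \<open>Lp\<close> by dominated convergence.\<close>

lemma translation_continuous_bounded:
  fixes F :: "'b::euclidean_space \<Rightarrow> real"
  assumes F[measurable]: "F \<in> borel_measurable borel" and k: "\<And>x. \<bar>F x\<bar> \<le> k" "\<And>x. norm x > k \<Longrightarrow> F x = 0"
    and p: "p \<ge> 1"
  shows "translation_continuous p F"
proof (rule translation_continuous_approx)
  fix e :: real
  assume e: "e > 0"
  have k0: "k \<ge> 0" using k(1)[of 0] by linarith
  have "F measurable_on UNIV"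
    by (intro lebesgue_measurable_imp_measurable_on measurable_completion) auto
  then obtain N g where N: "negligible N" and g: "\<And>n. continuous_on UNIV (g n)"
    and lim: "\<And>x. x \<notin> N \<Longrightarrow> (\<lambda>n. g n x) \<longlonglongrightarrow> F x"
    unfolding measurable_on_def by auto
  define h where "h n x = clamp_abs k (g n x) * max 0 (min 1 (k + 1 - norm x))" for n and x :: 'b
  have h_cont: "continuous_on UNIV (h n)" for n
    unfolding h_def clamp_abs_def by (intro continuous_intros g)
  then have h_meas[measurable]: "h n \<in> borel_measurable borel" for n
    by (rule borel_measurable_continuous_onI)
  have h0: "h n x = 0" if "norm x > k + 1" for n x
    using that by (simp add: h_def)
  have "(\<lambda>n. \<integral>\<^sup>+x. ennreal (\<bar>F x - h n x\<bar> powr p) \<partial>lborel) \<longlonglongrightarrow> (\<integral>\<^sup>+x. 0 \<partial>(lborel::'b measure))"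
  proof (rule nn_integral_dominated_convergence
      [where w = "\<lambda>x. ennreal ((2 * k) powr p) * indicator (cball 0 (k + 1)) x"])
    show "AE x in lborel. ennreal (\<bar>F x - h n x\<bar> powr p)
        \<le> ennreal ((2 * k) powr p) * indicator (cball 0 (k + 1)) x" for n
    proof (intro AE_I2)
      fix x
      have "\<bar>h n x\<bar> \<le> k * 1"
        unfolding h_def abs_mult using k0 clamp_abs(1) by (intro mult_mono) auto
      then have "\<bar>F x - h n x\<bar> \<le> 2 * k"
        using k(1)[of x] by linarith
      then show "ennreal (\<bar>F x - h n x\<bar> powr p) \<le> ennreal ((2 * k) powr p) * indicator (cball 0 (k + 1)) x"
        using k(2)[of x] h0[of x n] p powr_mono2[of p "\<bar>F x - h n x\<bar>" "2 * k"]
        by (cases "norm x \<le> k + 1") (simp_all add: ennreal_leI)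
    qed
    show "(\<integral>\<^sup>+x. ennreal ((2 * k) powr p) * indicator (cball 0 (k + 1)) x \<partial>(lborel::'b measure)) < \<infinity>"
      using emeasure_lborel_cball_finite[of "0::'b" "k + 1"]
      by (simp add: nn_integral_cmult_indicator ennreal_mult_less_top)
    have "AE x in lebesgue. x \<notin> N"
      using N by (simp add: negligible_iff_null_sets AE_not_in)
    then have "AE x in lborel. x \<notin> N"
      by (simp add: AE_completion_iff)
    then show "AE x in lborel. (\<lambda>n. ennreal (\<bar>F x - h n x\<bar> powr p)) \<longlonglongrightarrow> 0"
    proof eventually_elim
      case (elim x)
      have "(\<lambda>n. h n x) \<longlonglongrightarrow> clamp_abs k (F x) * max 0 (min 1 (k + 1 - norm x))"
        unfolding h_def clamp_abs_def by (intro tendsto_intros lim elim)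
      also have "clamp_abs k (F x) = F x"
        using clamp_abs(2)[OF k0 k(1)] .
      also have "F x * max 0 (min 1 (k + 1 - norm x)) = F x"
        using k(2)[of x] by (cases "norm x > k") auto
      finally have "(\<lambda>n. \<bar>F x - h n x\<bar>) \<longlonglongrightarrow> \<bar>F x - F x\<bar>"
        by (intro tendsto_intros)
      then have "(\<lambda>n. \<bar>F x - h n x\<bar> powr p) \<longlonglongrightarrow> 0"
        using p by (intro tendsto_zero_powrI[where b = p]) auto
      then show ?case
        using tendsto_ennrealI[of "\<lambda>n. \<bar>F x - h n x\<bar> powr p" 0 sequentially] by simp
    qed
    show "(\<lambda>x. ennreal ((2 * k) powr p) * indicator (cball (0::'b) (k + 1)) x) \<in> borel_measurable lborel"
      by (intro borel_measurable_times_ennreal borel_measurable_indicator) auto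
    show "(\<lambda>x. ennreal (\<bar>F x - h n x\<bar> powr p)) \<in> borel_measurable lborel" for n
      by simp
  qed simp
  then have "\<exists>n. (\<integral>\<^sup>+x. ennreal (\<bar>F x - h n x\<bar> powr p) \<partial>lborel) \<le> ennreal e"
    using e by (intro ennreal_tendsto_0_ex_le) simp_all
  then obtain n where "(\<integral>\<^sup>+x. ennreal (\<bar>F x - h n x\<bar> powr p) \<partial>lborel) \<le> ennreal e" ..
  moreover have "translation_continuous p (h n)" for n
    by (rule translation_continuous_continuous[OF h_cont _ p]) (rule h0)
  ultimately show "\<exists>h\<in>borel_measurable borel. translation_continuous p h \<and>
      (\<integral>\<^sup>+x. ennreal (\<bar>F x - h x\<bar> powr p) \<partial>lborel) \<le> ennreal e"
    using h_meas by (intro bexI[of _ "h n"]) simp_all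
qed (use p in auto)

lemma translation_continuous_Lp:
  fixes F :: "'b::euclidean_space \<Rightarrow> real"
  assumes F[measurable]: "F \<in> borel_measurable borel" and p: "p \<ge> 1"
    and fin: "(\<integral>\<^sup>+x. ennreal (\<bar>F x\<bar> powr p) \<partial>lborel) < \<infinity>"
  shows "translation_continuous p F"
proof (rule translation_continuous_approx)
  fix e :: real
  assume e: "e > 0"
  define h where "h n x = clamp_abs (real n) (F x) * indicator (cball 0 (real n)) x" for n x
  have h_meas[measurable]: "h n \<in> borel_measurable borel" for n
    unfolding h_def by (intro borel_measurable_times borel_measurable_indicator) auto
  have h_bound: "\<bar>h n x\<bar> \<le> real n" "norm x > real n \<Longrightarrow> h n x = 0" for n x
    by (auto simp: h_def clamp_abs(1) indicator_def)
  have "(\<lambda>n. \<integral>\<^sup>+x. ennreal (\<bar>F x - h n x\<bar> powr p) \<partial>lborel) \<longlonglongrightarrow> (\<integral>\<^sup>+x. 0 \<partial>(lborel::'b measure))"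
  proof (rule nn_integral_dominated_convergence[where w = "\<lambda>x. ennreal (\<bar>F x\<bar> powr p)"])
    show "AE x in lborel. ennreal (\<bar>F x - h n x\<bar> powr p) \<le> ennreal (\<bar>F x\<bar> powr p)" for n
      using p clamp_abs(5)[of "real n"]
      by (intro AE_I2 ennreal_leI powr_mono2) (auto simp: h_def indicator_def)
    show "AE x in lborel. (\<lambda>n. ennreal (\<bar>F x - h n x\<bar> powr p)) \<longlonglongrightarrow> 0"
    proof (intro AE_I2 tendsto_eventually)
      fix x
      obtain n0 where "real n0 \<ge> max \<bar>F x\<bar> (norm x)" using real_arch_simple by blast
      then have "ennreal (\<bar>F x - h n x\<bar> powr p) = 0" if "n \<ge> n0" for n
        using that clamp_abs(2)[of "real n" "F x"] by (auto simp: h_def indicator_def)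
      then show "\<forall>\<^sub>F n in sequentially. ennreal (\<bar>F x - h n x\<bar> powr p) = 0"
        by (auto simp: eventually_sequentially)
    qed
  qed (use fin in auto)
  then have "\<exists>n. (\<integral>\<^sup>+x. ennreal (\<bar>F x - h n x\<bar> powr p) \<partial>lborel) \<le> ennreal e"
    using e by (intro ennreal_tendsto_0_ex_le) simp_all
  then obtain n where "(\<integral>\<^sup>+x. ennreal (\<bar>F x - h n x\<bar> powr p) \<partial>lborel) \<le> ennreal e" ..
  moreover have "translation_continuous p (h n)" for n
    by (rule translation_continuous_bounded[OF h_meas h_bound p])
  ultimately show "\<exists>h\<in>borel_measurable borel. translation_continuous p h \<and>
      (\<integral>\<^sup>+x. ennreal (\<bar>F x - h x\<bar> powr p) \<partial>lborel) \<le> ennreal e"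
    using h_meas by (intro bexI[of _ "h n"]) simp_all
qed (use p in auto)

section \<open>Integrals of radial kernels\<close>

lemma ex_dyadic_interval:
  fixes t :: real
  assumes "t \<ge> 1"
  shows "\<exists>j::nat. 2 ^ j \<le> t \<and> t \<le> 2 ^ Suc j"
proof -
  define j where "j = nat \<lfloor>log 2 t\<rfloor>"
  have "real j \<le> log 2 t" "log 2 t \<le> real j + 1"
    using assms by (simp_all add: j_def)
  then have "2 powr real j \<le> t" "t \<le> 2 powr (real j + 1)"
    using assms by (simp_all add: le_log_iff log_le_iff)
  then show ?thesis
    by (intro exI[of _ j]) (simp add: powr_add powr_realpow)
qed

text \<open>A kernel is compared with a step function on concentric balls. The integral is finite as
  soon as the contributions of the layers decay geometrically.\<close>

lemma nn_integral_ball_layers: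
  fixes k :: "'a::euclidean_space \<Rightarrow> ennreal" and c \<rho> :: "nat \<Rightarrow> real"
  assumes nonneg: "\<And>j. c j \<ge> 0" "\<And>j. \<rho> j \<ge> 0"
    and cover: "\<And>y. k y \<noteq> 0 \<Longrightarrow> \<exists>j. k y \<le> ennreal (c j) \<and> dist x y \<le> \<rho> j"
    and geom: "\<And>j. c j * \<rho> j ^ DIM('a) \<le> A * q ^ j" and q: "0 \<le> q" "q < 1"
  shows "(\<integral>\<^sup>+y. k y \<partial>lborel) \<le> ennreal (unit_ball_vol (real DIM('a)) * (A / (1 - q)))"
proof -
  let ?\<omega> = "unit_ball_vol (real DIM('a))"
  have pointwise: "k y \<le> (\<Sum>j. ennreal (c j) * indicator (cball x (\<rho> j)) y)" for y
  proof (cases "k y = 0")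
    case False
    then obtain j where j: "k y \<le> ennreal (c j)" "dist x y \<le> \<rho> j"
      using cover by blast
    have "k y \<le> (\<Sum>i\<in>{j}. ennreal (c i) * indicator (cball x (\<rho> i)) y)"
      using j by simp
    also have "\<dots> \<le> (\<Sum>j. ennreal (c j) * indicator (cball x (\<rho> j)) y)"
      by (intro sum_le_suminf) auto
    finally show ?thesis .
  qed simp
  have sums: "(\<lambda>j. ?\<omega> * (A * q ^ j)) sums (?\<omega> * (A / (1 - q)))"
    using sums_mult[OF geometric_sums[of q], of "?\<omega> * A"] q by (simp add: mult_ac)
  have "(\<integral>\<^sup>+y. k y \<partial>lborel) \<le> (\<integral>\<^sup>+y. (\<Sum>j. ennreal (c j) * indicator (cball x (\<rho> j)) y) \<partial>lborel)"
    by (intro nn_integral_mono pointwise)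
  also have "\<dots> = (\<Sum>j. ennreal (c j) * emeasure lborel (cball x (\<rho> j)))"
    by (subst nn_integral_suminf)
      (auto simp: nn_integral_cmult_indicator intro!: borel_measurable_times_ennreal borel_measurable_indicator)
  also have "\<dots> \<le> (\<Sum>j. ennreal (?\<omega> * (A * q ^ j)))"
  proof (intro suminf_le allI)
    show "ennreal (c j) * emeasure lborel (cball x (\<rho> j)) \<le> ennreal (?\<omega> * (A * q ^ j))" for j
    proof -
      have "ennreal (c j) * emeasure lborel (cball x (\<rho> j)) = ennreal (?\<omega> * (c j * \<rho> j ^ DIM('a)))"
        using nonneg by (simp add: emeasure_cball ennreal_mult'[symmetric] mult_ac)
      also have "\<dots> \<le> ennreal (?\<omega> * (A * q ^ j))"
        by (intro ennreal_leI mult_left_mono geom) simp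
      finally show ?thesis .
    qed
  qed auto
  also have "\<dots> = ennreal (?\<omega> * (A / (1 - q)))"
  proof -
    have "0 \<le> ?\<omega> * (A * q ^ j)" for j
    proof -
      have "0 \<le> c j * \<rho> j ^ DIM('a)" using nonneg by simp
      also have "\<dots> \<le> A * q ^ j" by (rule geom)
      finally show ?thesis by simp
    qed
    then show ?thesis
      using sums by (simp add: suminf_ennreal2 sums_iff)
  qed
  finally show ?thesis .
qed

text \<open>Layers with radii \<open>m * 2 ^ j\<close>. The constant must not depend on the centre or on \<open>m\<close>, since both
  vary in the applications.\<close>

lemma kernel_integral_far:
  fixes a :: real
  assumes "a > 0"
  shows "\<exists>C\<ge>0. \<forall>(x::'a::euclidean_space) m. m > 0 \<longrightarrow>
    (\<integral>\<^sup>+y. ennreal (norm (x - y) powr - (real DIM('a) + a)) * indicator {y. m \<le> norm (x - y)} y \<partial>lborel)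
      \<le> ennreal (C * m powr - a)"
proof -
  let ?d = "real DIM('a)"
  define q where "q = 2 powr - a"
  have q: "0 \<le> q" "q < 1" using assms by (auto simp: q_def powr_less_one)
  define C where "C = unit_ball_vol ?d * (2 ^ DIM('a) / (1 - q))"
  have "C \<ge> 0" using q by (simp add: C_def)
  moreover have "(\<integral>\<^sup>+y. ennreal (norm (x - y) powr - (?d + a)) * indicator {y. m \<le> norm (x - y)} y \<partial>lborel)
      \<le> ennreal (C * m powr - a)" if m: "m > 0" for x :: 'a and m
  proof -
    have "(\<integral>\<^sup>+y. ennreal (norm (x - y) powr - (?d + a)) * indicator {y. m \<le> norm (x - y)} y \<partial>lborel)
      \<le> ennreal (unit_ball_vol ?d * ((2 ^ DIM('a) * m powr - a) / (1 - q)))"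
    proof (rule nn_integral_ball_layers[where c = "\<lambda>j. (m * 2 ^ j) powr - (?d + a)"
          and \<rho> = "\<lambda>j. m * 2 ^ Suc j" and x = x])
      fix y
      assume "ennreal (norm (x - y) powr - (?d + a)) * indicator {y. m \<le> norm (x - y)} y \<noteq> 0"
      then have y: "m \<le> norm (x - y)" by (auto split: split_indicator_asm)
      then obtain j where j: "2 ^ j \<le> norm (x - y) / m" "norm (x - y) / m \<le> 2 ^ Suc j"
        using ex_dyadic_interval[of "norm (x - y) / m"] m by auto
      have "norm (x - y) powr - (?d + a) \<le> (m * 2 ^ j) powr - (?d + a)"
        using j(1) m assms by (intro powr_mono2') (auto simp: field_simps)
      then show "\<exists>j. ennreal (norm (x - y) powr - (?d + a)) * indicator {y. m \<le> norm (x - y)} y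
          \<le> ennreal ((m * 2 ^ j) powr - (?d + a)) \<and> dist x y \<le> m * 2 ^ Suc j"
        using j(2) m y by (intro exI[of _ j]) (auto simp: dist_norm field_simps intro!: ennreal_leI)
    next
      fix j
      have "(m * 2 ^ j) powr - (?d + a) * (m * 2 ^ Suc j) ^ DIM('a)
        = (m * 2 ^ j) powr - (?d + a) * (m * 2 ^ j) powr ?d * 2 ^ DIM('a)"
        using m by (simp add: powr_realpow power_mult_distrib mult_ac)
      also have "\<dots> = (m * 2 ^ j) powr - a * 2 ^ DIM('a)"
        by (simp flip: powr_add)
      also have "\<dots> = 2 ^ DIM('a) * m powr - a * q ^ j"
        using m by (simp add: powr_mult q_def powr_powr powr_power mult.commute flip: powr_realpow)
      finally show "(m * 2 ^ j) powr - (?d + a) * (m * 2 ^ Suc j) ^ DIM('a) \<le> 2 ^ DIM('a) * m powr - a * q ^ j"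
        by simp
    qed (use q m in auto)
    then show ?thesis by (simp add: C_def mult_ac)
  qed
  ultimately show ?thesis by blast
qed

text \<open>Layers with radii \<open>m / 2 ^ j\<close>. On the diagonal the integrand is \<open>0 powr _ = 0\<close>, which removes the
  singular point.\<close>

lemma kernel_integral_near:
  fixes b :: real
  assumes "b > 0"
  shows "\<exists>C\<ge>0. \<forall>(x::'a::euclidean_space) m. m > 0 \<longrightarrow>
    (\<integral>\<^sup>+y. ennreal (norm (x - y) powr (b - real DIM('a))) * indicator {y. norm (x - y) < m} y \<partial>lborel)
      \<le> ennreal (C * m powr b)"
proof -
  let ?d = "real DIM('a)"
  define q where "q = 2 powr - b"
  have q: "0 \<le> q" "q < 1" using assms by (auto simp: q_def powr_less_one)
  define C where "C = unit_ball_vol ?d * (2 ^ DIM('a) / (1 - q))"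
  have "C \<ge> 0" using q by (simp add: C_def)
  moreover have "(\<integral>\<^sup>+y. ennreal (norm (x - y) powr (b - ?d)) * indicator {y. norm (x - y) < m} y \<partial>lborel)
      \<le> ennreal (C * m powr b)" if m: "m > 0" for x :: 'a and m
  proof -
    have "(\<integral>\<^sup>+y. ennreal (norm (x - y) powr (b - ?d)) * indicator {y. norm (x - y) < m} y \<partial>lborel)
      \<le> ennreal (unit_ball_vol ?d * ((2 ^ DIM('a) * m powr b) / (1 - q)))"
    proof (rule nn_integral_ball_layers[where c = "\<lambda>j. (m / 2 ^ j) powr b * (m / 2 ^ Suc j) powr - ?d"
          and \<rho> = "\<lambda>j. m / 2 ^ j" and x = x])
      fix y
      assume "ennreal (norm (x - y) powr (b - ?d)) * indicator {y. norm (x - y) < m} y \<noteq> 0"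
      then have y: "norm (x - y) < m" "norm (x - y) > 0"
        by (auto split: split_indicator_asm)
      then obtain j where j: "2 ^ j \<le> m / norm (x - y)" "m / norm (x - y) \<le> 2 ^ Suc j"
        using ex_dyadic_interval[of "m / norm (x - y)"] m by auto
      have j': "norm (x - y) \<le> m / 2 ^ j" "m / 2 ^ Suc j \<le> norm (x - y)"
        using j y m by (auto simp: field_simps)
      have "norm (x - y) powr (b - ?d) = norm (x - y) powr b * norm (x - y) powr - ?d"
        by (simp flip: powr_add)
      also have "\<dots> \<le> (m / 2 ^ j) powr b * (m / 2 ^ Suc j) powr - ?d"
        using j' m assms by (intro mult_mono powr_mono2 powr_mono2') auto
      finally show "\<exists>j. ennreal (norm (x - y) powr (b - ?d)) * indicator {y. norm (x - y) < m} y
          \<le> ennreal ((m / 2 ^ j) powr b * (m / 2 ^ Suc j) powr - ?d) \<and> dist x y \<le> m / 2 ^ j"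
        using j'(1) y by (intro exI[of _ j]) (auto simp: dist_norm intro!: ennreal_leI)
    next
      fix j
      have "(m / 2 ^ Suc j) powr - ?d * (m / 2 ^ j) ^ DIM('a) = 2 ^ DIM('a)"
        using m by (simp add: powr_minus powr_realpow power_divide power_mult_distrib field_simps)
      moreover have "(m / 2 ^ j) powr b = m powr b * q ^ j"
        using m by (simp add: powr_divide q_def powr_powr powr_power powr_minus field_simps flip: powr_realpow)
      ultimately show "(m / 2 ^ j) powr b * (m / 2 ^ Suc j) powr - ?d * (m / 2 ^ j) ^ DIM('a)
          \<le> 2 ^ DIM('a) * m powr b * q ^ j"
        by (simp add: mult_ac)
    qed (use q m in auto)
    then show ?thesis by (simp add: C_def mult_ac)
  qed
  ultimately show ?thesis by blast
qed

text \<open>The logarithm \<open>ln (1 + u)\<close> is at most \<open>u\<close>, which beats the singularity of the kernel at the origin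
  because \<open>s < 1\<close>, and at most a multiple of \<open>u powr (s / 2)\<close>, which preserves the decay at infinity
  because \<open>s > 0\<close>. The integral then scales like \<open>m powr - (s * p)\<close>.\<close>

lemma log_kernel_integral:
  fixes s p :: real
  assumes s: "0 < s" "s < 1" and p: "1 \<le> p"
  shows "\<exists>C\<ge>0. \<forall>(x::'a::euclidean_space) m. m > 0 \<longrightarrow>
    (\<integral>\<^sup>+y. ennreal (ln (1 + norm (x - y) / m) powr p / norm (x - y) powr (real DIM('a) + s * p)) \<partial>lborel)
      \<le> ennreal (C * m powr - (s * p))"
proof -
  let ?d = "real DIM('a)"
  define a where "a = s * p / 2"
  define b where "b = p - s * p"
  have "a > 0" using s p by (simp add: a_def)
  have "b > 0" using s p by (simp add: b_def)
  obtain A where A: "A \<ge> 0" "\<And>(x::'a) m. m > 0 \<Longrightarrow>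
    (\<integral>\<^sup>+y. ennreal (norm (x - y) powr - (?d + a)) * indicator {y. m \<le> norm (x - y)} y \<partial>lborel) \<le> ennreal (A * m powr - a)"
    using kernel_integral_far[OF \<open>a > 0\<close>] by blast
  obtain B where B: "B \<ge> 0" "\<And>(x::'a) m. m > 0 \<Longrightarrow>
    (\<integral>\<^sup>+y. ennreal (norm (x - y) powr (b - ?d)) * indicator {y. norm (x - y) < m} y \<partial>lborel) \<le> ennreal (B * m powr b)"
    using kernel_integral_near[OF \<open>b > 0\<close>] by blast
  define K where "K = (4 / s) powr p"
  have "(\<integral>\<^sup>+y. ennreal (ln (1 + norm (x - y) / m) powr p / norm (x - y) powr (?d + s * p)) \<partial>lborel)
      \<le> ennreal ((B + K * A) * m powr - (s * p))" if m: "m > 0" for x :: 'a and m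
  proof -
    let ?near = "\<lambda>y. ennreal (norm (x - y) powr (b - ?d)) * indicator {y. norm (x - y) < m} y"
    let ?far = "\<lambda>y. ennreal (norm (x - y) powr - (?d + a)) * indicator {y. m \<le> norm (x - y)} y"
    have pointwise: "ennreal (ln (1 + norm (x - y) / m) powr p / norm (x - y) powr (?d + s * p))
      \<le> ennreal (m powr - p) * ?near y + ennreal (K * m powr - a) * ?far y" for y
    proof -
      define r where "r = norm (x - y)"
      define u where "u = r / m"
      have r: "r \<ge> 0" and u: "u \<ge> 0" using m by (simp_all add: r_def u_def)
      have l: "ln (1 + u) \<ge> 0" using u by simp
      show ?thesis
      proof (cases "r = 0")
        case True
        then show ?thesis by (simp add: r_def)
      next
        case False
        with r have r: "r > 0" by simp
        show ?thesis
        proof (cases "r < m")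
          case True
          have "ln (1 + u) \<le> u" using u by (rule ln_add_one_self_le_self)
          then have "ln (1 + u) powr p \<le> u powr p"
            using l p by (intro powr_mono2) auto
          then have "ln (1 + u) powr p / r powr (?d + s * p) \<le> u powr p / r powr (?d + s * p)"
            by (intro divide_right_mono) auto
          also have "\<dots> = m powr - p * r powr (b - ?d)"
            using r m by (simp add: u_def b_def powr_divide powr_diff powr_add powr_minus field_simps)
          finally show ?thesis
            using True by (simp add: r_def[symmetric] u_def[symmetric] ennreal_leI flip: ennreal_mult')
        next
          case False
          then have "u \<ge> 1" using m by (simp add: u_def)
          have "ln (1 + u) \<le> (1 + u) powr (s / 2) / (s / 2)"
            using u s by (intro ln_powr_bound) auto
          also have "\<dots> \<le> (2 * u) powr (s / 2) / (s / 2)"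
            using \<open>u \<ge> 1\<close> s by (intro divide_right_mono powr_mono2) auto
          also have "\<dots> = 2 powr (s / 2) * u powr (s / 2) / (s / 2)"
            by (simp add: powr_mult)
          also have "\<dots> \<le> 2 powr 1 * u powr (s / 2) / (s / 2)"
            using s by (intro divide_right_mono mult_right_mono powr_mono) auto
          also have "\<dots> = (4 / s) * u powr (s / 2)" by simp
          finally have "ln (1 + u) powr p \<le> ((4 / s) * u powr (s / 2)) powr p"
            using l p by (intro powr_mono2) auto
          also have "\<dots> = K * u powr a"
            unfolding powr_mult by (simp add: K_def a_def powr_powr)
          finally have "ln (1 + u) powr p / r powr (?d + s * p) \<le> K * u powr a / r powr (?d + s * p)"
            by (intro divide_right_mono) auto
          also have split: "r powr (?d + s * p) = r powr (?d + a) * r powr a"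
            by (simp add: a_def algebra_simps flip: powr_add)
          also have "K * u powr a / (r powr (?d + a) * r powr a) = K * m powr - a * r powr - (?d + a)"
            unfolding powr_minus u_def powr_divide using r m by (simp add: powr_divide field_simps)
          finally show ?thesis
            using False by (simp add: K_def split r_def[symmetric] u_def[symmetric] ennreal_leI flip: ennreal_mult')
        qed
      qed
    qed
    have "(\<integral>\<^sup>+y. ennreal (ln (1 + norm (x - y) / m) powr p / norm (x - y) powr (?d + s * p)) \<partial>lborel)
      \<le> (\<integral>\<^sup>+y. ennreal (m powr - p) * ?near y + ennreal (K * m powr - a) * ?far y \<partial>lborel)"
      by (intro nn_integral_mono pointwise)
    also have "\<dots> = ennreal (m powr - p) * (\<integral>\<^sup>+y. ?near y \<partial>lborel) + ennreal (K * m powr - a) * (\<integral>\<^sup>+y. ?far y \<partial>lborel)"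
      by (subst nn_integral_add) (auto simp: nn_integral_cmult)
    also have "\<dots> \<le> ennreal (m powr - p) * ennreal (B * m powr b) + ennreal (K * m powr - a) * ennreal (A * m powr - a)"
      by (intro add_mono mult_left_mono A(2) B(2) m) auto
    also have "\<dots> = ennreal (m powr - p * (B * m powr b) + K * m powr - a * (A * m powr - a))"
      using A(1) B(1) by (simp add: K_def ennreal_mult'[symmetric] flip: ennreal_plus)
    also have "m powr - p * (B * m powr b) = B * m powr - (s * p)"
      by (simp add: b_def mult.left_commute flip: powr_add)
    also have "K * m powr - a * (A * m powr - a) = K * A * (m powr - a * m powr - a)"
      by (simp add: mult_ac)
    also have "m powr - a * m powr - a = m powr - (s * p)"
      by (simp add: a_def mult.commute flip: powr_add)
    finally show ?thesis by (simp add: distrib_right)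
  qed
  moreover have "B + K * A \<ge> 0" using A(1) B(1) by (simp add: K_def)
  ultimately show ?thesis by blast
qed

section \<open>Sobolev modulars of Borel functions\<close>

lemma borel_measurable_prod_iff:
  fixes f :: "'a::euclidean_space \<times> 'b::euclidean_space \<Rightarrow> 'c::topological_space"
  shows "f \<in> borel_measurable (lborel \<Otimes>\<^sub>M lborel) \<longleftrightarrow> f \<in> borel_measurable borel"
  by (simp add: lborel_prod)

lemma nn_integral_lborel_pair:
  fixes f :: "'a::euclidean_space \<times> 'b::euclidean_space \<Rightarrow> ennreal"
  assumes "f \<in> borel_measurable borel"
  shows "(\<integral>\<^sup>+z. f z \<partial>lborel) = (\<integral>\<^sup>+x. \<integral>\<^sup>+y. f (x, y) \<partial>lborel \<partial>lborel)"
    and "(\<integral>\<^sup>+z. f z \<partial>lborel) = (\<integral>\<^sup>+y. \<integral>\<^sup>+x. f (x, y) \<partial>lborel \<partial>lborel)"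
  using lborel.nn_integral_fst[of f lborel] lborel_pair.nn_integral_snd[of f] assms
  by (simp_all add: lborel_prod borel_measurable_prod_iff)

text \<open>For Borel functions the double integral in the Gagliardo seminorm is an integral over pairs
  with respect to Lebesgue measure on the product space. In this form translation invariance,
  dominated convergence and Tonelli's theorem apply directly. All quantities below are \<open>p\<close>-th powers of
  norms.\<close>

definition slobodeckij_quotient :: "real \<Rightarrow> real \<Rightarrow> ('a::euclidean_space \<Rightarrow> real) \<Rightarrow> 'a \<times> 'a \<Rightarrow> real" where
  "slobodeckij_quotient s p u z =
     \<bar>u (fst z) - u (snd z)\<bar> powr p / norm (fst z - snd z) powr (real DIM('a) + s * p)"

definition slobodeckij_energy :: "real \<Rightarrow> real \<Rightarrow> 'a::euclidean_space set \<Rightarrow> ('a \<Rightarrow> real) \<Rightarrow> ennreal" where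
  "slobodeckij_energy s p S u = (\<integral>\<^sup>+z. ennreal (slobodeckij_quotient s p u z) * indicator (S \<times> S) z \<partial>lborel)"

definition Lp_modular :: "real \<Rightarrow> 'a::euclidean_space set \<Rightarrow> ('a \<Rightarrow> real) \<Rightarrow> ennreal" where
  "Lp_modular p S u = (\<integral>\<^sup>+x. ennreal (\<bar>u x\<bar> powr p) * indicator S x \<partial>lborel)"

definition sobolev_modular :: "real \<Rightarrow> real \<Rightarrow> 'a::euclidean_space set \<Rightarrow> ('a \<Rightarrow> real) \<Rightarrow> ennreal" where
  "sobolev_modular s p S u = Lp_modular p S u + slobodeckij_energy s p S u"

lemma slobodeckij_quotient_nonneg[simp]: "slobodeckij_quotient s p u z \<ge> 0"
  by (simp add: slobodeckij_quotient_def)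

lemma slobodeckij_quotient_measurable[measurable]:
  assumes [measurable]: "u \<in> borel_measurable borel"
  shows "slobodeckij_quotient s p u \<in> borel_measurable borel"
  unfolding slobodeckij_quotient_def[abs_def] borel_prod[symmetric] by measurable

lemma square_borel:
  fixes S :: "'a::euclidean_space set"
  assumes "S \<in> sets borel"
  shows "S \<times> S \<in> sets borel"
  using pair_measureI[OF assms assms] unfolding borel_prod .

lemma slobodeckij_quotient_add_le:
  assumes "p \<ge> 0"
  shows "slobodeckij_quotient s p (\<lambda>x. u x + v x) z
    \<le> 2 powr p * (slobodeckij_quotient s p u z + slobodeckij_quotient s p v z)"
proof -
  have "\<bar>(u (fst z) + v (fst z)) - (u (snd z) + v (snd z))\<bar> powr p
    \<le> 2 powr p * (\<bar>u (fst z) - u (snd z)\<bar> powr p + \<bar>v (fst z) - v (snd z)\<bar> powr p)"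
    using abs_add_powr_le[OF assms, of "u (fst z) - u (snd z)" "v (fst z) - v (snd z)"]
    by (simp add: algebra_simps)
  from divide_right_mono[OF this, of "norm (fst z - snd z) powr (real DIM('a) + s * p)"]
  show ?thesis
    by (simp add: slobodeckij_quotient_def flip: add_divide_distrib)
qed

lemma slobodeckij_energy_add_le:
  assumes [measurable]: "u \<in> borel_measurable borel" "v \<in> borel_measurable borel" "S \<in> sets borel" and p: "p \<ge> 0"
  shows "slobodeckij_energy s p S (\<lambda>x. u x + v x)
    \<le> ennreal (2 powr p) * (slobodeckij_energy s p S u + slobodeckij_energy s p S v)"
proof -
  note [measurable] = square_borel
  have "slobodeckij_energy s p S (\<lambda>x. u x + v x) \<le>
    (\<integral>\<^sup>+z. ennreal (2 powr p) * (ennreal (slobodeckij_quotient s p u z) * indicator (S \<times> S) z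
      + ennreal (slobodeckij_quotient s p v z) * indicator (S \<times> S) z) \<partial>lborel)"
    unfolding slobodeckij_energy_def
    by (intro nn_integral_mono)
      (auto simp: slobodeckij_quotient_add_le[OF p] ennreal_leI indicator_def
        simp flip: ennreal_plus ennreal_mult')
  then show ?thesis
    unfolding slobodeckij_energy_def by (simp add: nn_integral_cmult nn_integral_add)
qed

lemma Lp_modular_add_le:
  assumes [measurable]: "u \<in> borel_measurable borel" "v \<in> borel_measurable borel" "S \<in> sets borel" and p: "p \<ge> 0"
  shows "Lp_modular p S (\<lambda>x. u x + v x) \<le> ennreal (2 powr p) * (Lp_modular p S u + Lp_modular p S v)"
proof -
  have "Lp_modular p S (\<lambda>x. u x + v x) \<le>
    (\<integral>\<^sup>+x. ennreal (2 powr p) * (ennreal (\<bar>u x\<bar> powr p) * indicator S x + ennreal (\<bar>v x\<bar> powr p) * indicator S x) \<partial>lborel)"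
    unfolding Lp_modular_def
    by (intro nn_integral_mono)
      (auto simp: abs_add_powr_le[OF p] ennreal_leI indicator_def simp flip: ennreal_plus ennreal_mult')
  then show ?thesis
    unfolding Lp_modular_def by (simp add: nn_integral_cmult nn_integral_add)
qed

lemma sobolev_modular_add_le:
  assumes "u \<in> borel_measurable borel" "v \<in> borel_measurable borel" "S \<in> sets borel" and p: "p \<ge> 0"
  shows "sobolev_modular s p S (\<lambda>x. u x + v x)
    \<le> ennreal (2 powr p) * (sobolev_modular s p S u + sobolev_modular s p S v)"
  using add_mono[OF Lp_modular_add_le[OF assms] slobodeckij_energy_add_le[OF assms, of s]]
  by (simp add: sobolev_modular_def distrib_left add_ac)

text \<open>Dominated convergence for the Sobolev modular. Both the values and the increments have to be
  dominated; truncation of a function in height satisfies this.\<close>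

lemma sobolev_modular_dominated_tendsto_0:
  fixes u :: "nat \<Rightarrow> 'a::euclidean_space \<Rightarrow> real"
  assumes meas[measurable]: "\<And>n. u n \<in> borel_measurable borel" "w \<in> borel_measurable borel" "S \<in> sets borel"
    and p: "p \<ge> 1"
    and le: "\<And>n x. \<bar>u n x\<bar> \<le> \<bar>w x\<bar>" "\<And>n x y. \<bar>u n x - u n y\<bar> \<le> \<bar>w x - w y\<bar>"
    and lim: "\<And>x. (\<lambda>n. u n x) \<longlonglongrightarrow> 0" and fin: "sobolev_modular s p S w < \<infinity>"
  shows "(\<lambda>n. sobolev_modular s p S (u n)) \<longlonglongrightarrow> 0"
proof -
  note [measurable] = square_borel
  have "(\<lambda>n. Lp_modular p S (u n)) \<longlonglongrightarrow> (\<integral>\<^sup>+x. 0 \<partial>(lborel::'a measure))"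
    unfolding Lp_modular_def
  proof (rule nn_integral_dominated_convergence[where w = "\<lambda>x. ennreal (\<bar>w x\<bar> powr p) * indicator S x"])
    show "AE x in lborel. ennreal (\<bar>u n x\<bar> powr p) * indicator S x \<le> ennreal (\<bar>w x\<bar> powr p) * indicator S x" for n
      using p le(1) by (intro AE_I2 mult_right_mono ennreal_leI powr_mono2) auto
    show "AE x in lborel. (\<lambda>n. ennreal (\<bar>u n x\<bar> powr p) * indicator S x) \<longlonglongrightarrow> 0"
    proof (intro AE_I2)
      fix x
      have "(\<lambda>n. \<bar>u n x\<bar> powr p) \<longlonglongrightarrow> 0"
        using p tendsto_rabs_zero[OF lim[of x]] by (intro tendsto_zero_powrI[where b = p]) auto
      from tendsto_ennrealI[OF this] show "(\<lambda>n. ennreal (\<bar>u n x\<bar> powr p) * indicator S x) \<longlonglongrightarrow> 0"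
        by (cases "x \<in> S") simp_all
    qed
    show "(\<integral>\<^sup>+x. ennreal (\<bar>w x\<bar> powr p) * indicator S x \<partial>lborel) < \<infinity>"
      using fin by (simp add: sobolev_modular_def Lp_modular_def less_top)
  qed simp_all
  moreover have "(\<lambda>n. slobodeckij_energy s p S (u n)) \<longlonglongrightarrow> (\<integral>\<^sup>+z. 0 \<partial>(lborel::('a \<times> 'a) measure))"
    unfolding slobodeckij_energy_def
  proof (rule nn_integral_dominated_convergence
      [where w = "\<lambda>z. ennreal (slobodeckij_quotient s p w z) * indicator (S \<times> S) z"])
    show "AE z in lborel. ennreal (slobodeckij_quotient s p (u n) z) * indicator (S \<times> S) z
        \<le> ennreal (slobodeckij_quotient s p w z) * indicator (S \<times> S) z" for n
      unfolding slobodeckij_quotient_def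
      using p le(2) by (intro AE_I2 mult_right_mono ennreal_leI divide_right_mono powr_mono2) auto
    show "AE z in lborel. (\<lambda>n. ennreal (slobodeckij_quotient s p (u n) z) * indicator (S \<times> S) z) \<longlonglongrightarrow> 0"
    proof (intro AE_I2)
      fix z
      have "(\<lambda>n. u n (fst z) - u n (snd z)) \<longlonglongrightarrow> 0"
        using tendsto_diff[OF lim lim] by simp
      then have "(\<lambda>n. \<bar>u n (fst z) - u n (snd z)\<bar>) \<longlonglongrightarrow> 0"
        by (rule tendsto_rabs_zero)
      then have "(\<lambda>n. \<bar>u n (fst z) - u n (snd z)\<bar> powr p) \<longlonglongrightarrow> 0"
        using p by (intro tendsto_zero_powrI[where b = p]) auto
      then have "(\<lambda>n. slobodeckij_quotient s p (u n) z) \<longlonglongrightarrow> 0"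
        unfolding slobodeckij_quotient_def by (rule tendsto_divide_zero)
      from tendsto_ennrealI[OF this]
      show "(\<lambda>n. ennreal (slobodeckij_quotient s p (u n) z) * indicator (S \<times> S) z) \<longlonglongrightarrow> 0"
        by (cases "z \<in> S \<times> S") simp_all
    qed
    show "(\<integral>\<^sup>+z. ennreal (slobodeckij_quotient s p w z) * indicator (S \<times> S) z \<partial>lborel) < \<infinity>"
      using fin by (simp add: sobolev_modular_def slobodeckij_energy_def less_top)
  qed simp_all
  ultimately show ?thesis
    unfolding sobolev_modular_def using tendsto_add[of _ 0 sequentially _ 0] by simp
qed

text \<open>The increment of a product is split as
  \<open>w x * \<psi> x - w y * \<psi> y = (w x - w y) * \<psi> x + w y * (\<psi> x - \<psi> y)\<close>. The first part tends to zero by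
  dominated convergence, the second because \<open>w\<close> is bounded and the energy of the cutoffs tends to zero.\<close>

lemma sobolev_modular_cutoff_tendsto_0:
  fixes w :: "'a::euclidean_space \<Rightarrow> real" and \<psi> :: "nat \<Rightarrow> 'a \<Rightarrow> real"
  assumes meas[measurable]: "\<And>n. \<psi> n \<in> borel_measurable borel" "w \<in> borel_measurable borel" "S \<in> sets borel"
    and p: "p \<ge> 1" and K: "\<And>x. \<bar>w x\<bar> \<le> K" and \<psi>: "\<And>n x. 0 \<le> \<psi> n x" "\<And>n x. \<psi> n x \<le> 1"
    and lim: "\<And>x. x \<in> S \<Longrightarrow> (\<lambda>n. \<psi> n x) \<longlonglongrightarrow> 0" and fin: "sobolev_modular s p S w < \<infinity>"
    and energy: "(\<lambda>n. slobodeckij_energy s p S (\<psi> n)) \<longlonglongrightarrow> 0"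
  shows "(\<lambda>n. sobolev_modular s p S (\<lambda>x. w x * \<psi> n x)) \<longlonglongrightarrow> 0"
proof -
  note [measurable] = square_borel
  have K0: "K \<ge> 0" using K[of 0] by linarith
  have powr_lim: "(\<lambda>n. \<psi> n x powr p) \<longlonglongrightarrow> 0" if "x \<in> S" for x
    using p \<psi> by (intro tendsto_zero_powrI[where b = p] lim that) auto
  have powr_le1: "\<psi> n x powr p \<le> 1" for n x
    using p powr_mono2[of p "\<psi> n x" 1] \<psi> by simp
  have "(\<lambda>n. Lp_modular p S (\<lambda>x. w x * \<psi> n x)) \<longlonglongrightarrow> (\<integral>\<^sup>+x. 0 \<partial>(lborel::'a measure))"
    unfolding Lp_modular_def
  proof (rule nn_integral_dominated_convergence[where w = "\<lambda>x. ennreal (\<bar>w x\<bar> powr p) * indicator S x"])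
    show "AE x in lborel. ennreal (\<bar>w x * \<psi> n x\<bar> powr p) * indicator S x \<le> ennreal (\<bar>w x\<bar> powr p) * indicator S x" for n
      using p \<psi> by (intro AE_I2 mult_right_mono ennreal_leI powr_mono2) (auto simp: abs_mult mult_left_le)
    show "AE x in lborel. (\<lambda>n. ennreal (\<bar>w x * \<psi> n x\<bar> powr p) * indicator S x) \<longlonglongrightarrow> 0"
    proof (intro AE_I2)
      fix x
      show "(\<lambda>n. ennreal (\<bar>w x * \<psi> n x\<bar> powr p) * indicator S x) \<longlonglongrightarrow> 0"
      proof (cases "x \<in> S")
        case True
        have "(\<lambda>n. \<bar>w x * \<psi> n x\<bar> powr p) \<longlonglongrightarrow> 0"
          using tendsto_mult_right_zero[OF powr_lim[OF True], of "\<bar>w x\<bar> powr p"] \<psi>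
          by (simp add: abs_mult powr_mult)
        from tendsto_ennrealI[OF this] show ?thesis using True by simp
      qed simp
    qed
    show "(\<integral>\<^sup>+x. ennreal (\<bar>w x\<bar> powr p) * indicator S x \<partial>lborel) < \<infinity>"
      using fin by (simp add: sobolev_modular_def Lp_modular_def less_top)
  qed simp_all
  then have Lp: "(\<lambda>n. Lp_modular p S (\<lambda>x. w x * \<psi> n x)) \<longlonglongrightarrow> 0" by simp
  define R where "R n = (\<integral>\<^sup>+z. ennreal (slobodeckij_quotient s p w z * \<psi> n (fst z) powr p) * indicator (S \<times> S) z \<partial>lborel)" for n
  have [measurable]: "(\<lambda>z::'a \<times> 'a. \<psi> n (fst z) powr p) \<in> borel_measurable borel" for n
    unfolding borel_prod[symmetric] by measurable
  have "R \<longlonglongrightarrow> (\<integral>\<^sup>+z. 0 \<partial>(lborel::('a \<times> 'a) measure))"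
    unfolding R_def
  proof (rule nn_integral_dominated_convergence
      [where w = "\<lambda>z. ennreal (slobodeckij_quotient s p w z) * indicator (S \<times> S) z"])
    show "AE z in lborel. ennreal (slobodeckij_quotient s p w z * \<psi> n (fst z) powr p) * indicator (S \<times> S) z
        \<le> ennreal (slobodeckij_quotient s p w z) * indicator (S \<times> S) z" for n
      by (intro AE_I2 mult_right_mono ennreal_leI mult_left_le powr_le1) auto
    show "AE z in lborel. (\<lambda>n. ennreal (slobodeckij_quotient s p w z * \<psi> n (fst z) powr p) * indicator (S \<times> S) z) \<longlonglongrightarrow> 0"
    proof (intro AE_I2)
      fix z
      show "(\<lambda>n. ennreal (slobodeckij_quotient s p w z * \<psi> n (fst z) powr p) * indicator (S \<times> S) z) \<longlonglongrightarrow> 0"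
      proof (cases "z \<in> S \<times> S")
        case True
        then have "fst z \<in> S" by auto
        from tendsto_ennrealI[OF tendsto_mult_right_zero[OF powr_lim[OF this], of "slobodeckij_quotient s p w z"]]
        show ?thesis using True by simp
      qed simp
    qed
    show "(\<integral>\<^sup>+z. ennreal (slobodeckij_quotient s p w z) * indicator (S \<times> S) z \<partial>lborel) < \<infinity>"
      using fin by (simp add: sobolev_modular_def slobodeckij_energy_def less_top)
  qed simp_all
  then have R: "R \<longlonglongrightarrow> 0" by simp
  have quot: "slobodeckij_quotient s p (\<lambda>x. w x * \<psi> n x) z \<le>
    2 powr p * (slobodeckij_quotient s p w z * \<psi> n (fst z) powr p + K powr p * slobodeckij_quotient s p (\<psi> n) z)" for n z
  proof -
    let ?x = "fst z" and ?y = "snd z"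
    have "\<bar>w ?x * \<psi> n ?x - w ?y * \<psi> n ?y\<bar> powr p
      = \<bar>(w ?x - w ?y) * \<psi> n ?x + w ?y * (\<psi> n ?x - \<psi> n ?y)\<bar> powr p"
      by (simp add: algebra_simps)
    also have "\<dots> \<le> 2 powr p * (\<bar>(w ?x - w ?y) * \<psi> n ?x\<bar> powr p + \<bar>w ?y * (\<psi> n ?x - \<psi> n ?y)\<bar> powr p)"
      using p by (intro abs_add_powr_le) simp
    also have "\<dots> \<le> 2 powr p * (\<bar>w ?x - w ?y\<bar> powr p * \<psi> n ?x powr p + K powr p * \<bar>\<psi> n ?x - \<psi> n ?y\<bar> powr p)"
      using p \<psi> K by (auto simp: abs_mult powr_mult intro!: mult_left_mono mult_right_mono add_mono powr_mono2)
    finally show ?thesis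
      using divide_right_mono[of _ _ "norm (?x - ?y) powr (real DIM('a) + s * p)"]
      unfolding slobodeckij_quotient_def by (fastforce simp: add_divide_distrib distrib_left)
  qed
  have bound: "slobodeckij_energy s p S (\<lambda>x. w x * \<psi> n x)
    \<le> ennreal (2 powr p) * (R n + ennreal (K powr p) * slobodeckij_energy s p S (\<psi> n))" for n
  proof -
    have "slobodeckij_energy s p S (\<lambda>x. w x * \<psi> n x) \<le>
      (\<integral>\<^sup>+z. ennreal (2 powr p) * (ennreal (slobodeckij_quotient s p w z * \<psi> n (fst z) powr p) * indicator (S \<times> S) z
        + ennreal (K powr p) * (ennreal (slobodeckij_quotient s p (\<psi> n) z) * indicator (S \<times> S) z)) \<partial>lborel)"
      unfolding slobodeckij_energy_def
      by (intro nn_integral_mono)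
        (auto simp: quot ennreal_leI indicator_def simp flip: ennreal_plus ennreal_mult')
    then show ?thesis
      unfolding slobodeckij_energy_def R_def by (simp add: nn_integral_cmult nn_integral_add)
  qed
  have "(\<lambda>n. ennreal (2 powr p) * (R n + ennreal (K powr p) * slobodeckij_energy s p S (\<psi> n)))
      \<longlonglongrightarrow> ennreal (2 powr p) * (0 + ennreal (K powr p) * 0)"
    by (intro tendsto_add ennreal_tendsto_cmult R energy) auto
  then have upper: "(\<lambda>n. ennreal (2 powr p) * (R n + ennreal (K powr p) * slobodeckij_energy s p S (\<psi> n))) \<longlonglongrightarrow> 0"
    by simp
  have "(\<lambda>n. slobodeckij_energy s p S (\<lambda>x. w x * \<psi> n x)) \<longlonglongrightarrow> 0"
  proof (rule tendsto_sandwich[OF _ _ tendsto_const upper])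
    show "\<forall>\<^sub>F n in sequentially. slobodeckij_energy s p S (\<lambda>x. w x * \<psi> n x)
      \<le> ennreal (2 powr p) * (R n + ennreal (K powr p) * slobodeckij_energy s p S (\<psi> n))"
      by (rule always_eventually) (rule allI, rule bound)
  qed simp
  then show ?thesis
    unfolding sobolev_modular_def using tendsto_add[OF Lp, of _ 0] by simp
qed

lemma AE_lebesgue_on_borel_version:
  fixes f :: "'a::euclidean_space \<Rightarrow> real"
  assumes f: "f \<in> borel_measurable (lebesgue_on \<Omega>)" and \<Omega>: "open \<Omega>"
  shows "\<exists>u\<in>borel_measurable borel. AE x in lebesgue_on \<Omega>. f x = u x"
proof -
  have L: "\<Omega> \<in> sets lebesgue" using \<Omega> by auto
  have "(\<lambda>x. if x \<in> \<Omega> then f x else 0) \<in> borel_measurable (completion lborel)"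
    using f L by (simp add: borel_measurable_if)
  from completion_ex_borel_measurable_real[OF this]
  obtain u where u: "u \<in> borel_measurable lborel" "AE x in lborel. (if x \<in> \<Omega> then f x else 0) = u x"
    by blast
  have "AE x in lebesgue. x \<in> \<Omega> \<longrightarrow> f x = u x"
    using AE_completion[OF u(2)] by eventually_elim auto
  then have "AE x in lebesgue_on \<Omega>. f x = u x"
    using L by (simp add: AE_restrict_space_iff)
  then show ?thesis using u(1) by auto
qed

lemma nn_integral_lebesgue_on_borel:
  fixes g :: "'a::euclidean_space \<Rightarrow> ennreal"
  assumes "open \<Omega>"
  shows "(\<integral>\<^sup>+x. g x \<partial>lebesgue_on \<Omega>) = (\<integral>\<^sup>+x. g x * indicator \<Omega> x \<partial>lborel)"
  using assms by (simp add: nn_integral_restrict_space nn_integral_completion)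

lemma ennroot_less_top_iff: "ennroot p a < \<infinity> \<longleftrightarrow> a < \<infinity>"
  by (auto simp: ennroot_def less_top)

lemma ennroot_less:
  assumes "a < ennreal (e powr p)" "e > 0" "p \<ge> 1"
  shows "ennroot p a < ennreal e"
proof -
  have fin: "a < top" using assms(1) less_trans ennreal_less_top by blast
  have "enn2real a < e powr p"
    using assms(1) fin by (cases a) (auto simp: ennreal_less_iff)
  then have "enn2real a powr (1 / p) < (e powr p) powr (1 / p)"
    using assms by (intro powr_less_mono2) auto
  also have "\<dots> = e" using assms by (simp add: powr_powr)
  finally show ?thesis
    using fin assms by (auto simp: ennroot_def ennreal_less_iff less_top)
qed

text \<open>The passage from Lebesgue measurable functions to Borel representatives: neither of the two
  seminorms sees a null set.\<close>

lemma sobolev_modular_borel_version: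
  fixes f :: "'a::euclidean_space \<Rightarrow> real"
  assumes \<Omega>: "open \<Omega>" and u[measurable]: "u \<in> borel_measurable borel"
    and ae: "AE x in lebesgue_on \<Omega>. f x = u x"
  shows "Lp_norm p \<Omega> f = ennroot p (Lp_modular p \<Omega> u)"
    and "gagliardo_seminorm s p \<Omega> f = ennroot p (slobodeckij_energy s p \<Omega> u)"
proof -
  have B: "\<Omega> \<in> sets borel" using \<Omega> by simp
  note [measurable] = B square_borel[OF B]
  have "(\<integral>\<^sup>+x. ennreal (\<bar>f x\<bar> powr p) \<partial>lebesgue_on \<Omega>) = (\<integral>\<^sup>+x. ennreal (\<bar>u x\<bar> powr p) \<partial>lebesgue_on \<Omega>)"
    by (rule nn_integral_cong_AE) (use ae in eventually_elim, simp)
  then show "Lp_norm p \<Omega> f = ennroot p (Lp_modular p \<Omega> u)"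
    by (simp add: Lp_norm_def Lp_modular_def nn_integral_lebesgue_on_borel[OF \<Omega>])
  let ?q = "\<lambda>f x y. ennreal (\<bar>f x - f y\<bar> powr p / norm (x - y) powr (real DIM('a) + s * p))"
  have "(\<integral>\<^sup>+x. (\<integral>\<^sup>+y. ?q f x y \<partial>lebesgue_on \<Omega>) \<partial>lebesgue_on \<Omega>)
    = (\<integral>\<^sup>+x. (\<integral>\<^sup>+y. ?q u x y \<partial>lebesgue_on \<Omega>) \<partial>lebesgue_on \<Omega>)"
  proof (rule nn_integral_cong_AE)
    show "AE x in lebesgue_on \<Omega>. (\<integral>\<^sup>+y. ?q f x y \<partial>lebesgue_on \<Omega>) = (\<integral>\<^sup>+y. ?q u x y \<partial>lebesgue_on \<Omega>)"
      using ae
    proof eventually_elim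
      case (elim x)
      show ?case
        by (rule nn_integral_cong_AE) (use ae in eventually_elim, simp add: elim)
    qed
  qed
  also have "\<dots> = (\<integral>\<^sup>+x. \<integral>\<^sup>+y. ennreal (slobodeckij_quotient s p u (x, y)) * indicator (\<Omega> \<times> \<Omega>) (x, y) \<partial>lborel \<partial>lborel)"
    unfolding nn_integral_lebesgue_on_borel[OF \<Omega>]
  proof (rule nn_integral_cong)
    fix x
    show "(\<integral>\<^sup>+y. ?q u x y * indicator \<Omega> y \<partial>lborel) * indicator \<Omega> x
      = (\<integral>\<^sup>+y. ennreal (slobodeckij_quotient s p u (x, y)) * indicator (\<Omega> \<times> \<Omega>) (x, y) \<partial>lborel)"
      by (cases "x \<in> \<Omega>") (auto simp: slobodeckij_quotient_def indicator_def intro!: nn_integral_cong)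
  qed
  also have "\<dots> = slobodeckij_energy s p \<Omega> u"
    unfolding slobodeckij_energy_def by (rule nn_integral_lborel_pair(1)[symmetric]) simp
  finally show "gagliardo_seminorm s p \<Omega> f = ennroot p (slobodeckij_energy s p \<Omega> u)"
    by (simp add: gagliardo_seminorm_def)
qed

lemma frac_sobolev_borel_version:
  fixes f :: "'a::euclidean_space \<Rightarrow> real"
  assumes \<Omega>: "open \<Omega>" and u: "u \<in> borel_measurable borel"
    and ae: "AE x in lebesgue_on \<Omega>. f x = u x" and f: "f \<in> frac_sobolev s p \<Omega>"
  shows "sobolev_modular s p \<Omega> u < \<infinity>"
proof -
  have "ennroot p (Lp_modular p \<Omega> u) < \<infinity>" "ennroot p (slobodeckij_energy s p \<Omega> u) < \<infinity>"
    using f unfolding frac_sobolev_def Lp_space_def by (auto simp: sobolev_modular_borel_version[OF \<Omega> u ae])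
  then show ?thesis
    unfolding ennroot_less_top_iff by (simp add: sobolev_modular_def)
qed

lemma frac_sobolev_norm_less:
  fixes f :: "'a::euclidean_space \<Rightarrow> real"
  assumes \<Omega>: "open \<Omega>" and u: "u \<in> borel_measurable borel"
    and ae: "AE x in lebesgue_on \<Omega>. f x = u x" and p: "p \<ge> 1" and e: "e > 0"
    and less: "sobolev_modular s p \<Omega> u < ennreal ((e / 2) powr p)"
  shows "frac_sobolev_norm s p \<Omega> f < ennreal e"
proof -
  have "Lp_modular p \<Omega> u < ennreal ((e / 2) powr p)" "slobodeckij_energy s p \<Omega> u < ennreal ((e / 2) powr p)"
    using less by (auto simp: sobolev_modular_def intro: le_less_trans[rotated])
  then have "Lp_norm p \<Omega> f < ennreal (e / 2)" "gagliardo_seminorm s p \<Omega> f < ennreal (e / 2)"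
    using p e by (simp_all add: sobolev_modular_borel_version[OF \<Omega> u ae] ennroot_less)
  then have "frac_sobolev_norm s p \<Omega> f < ennreal (e / 2) + ennreal (e / 2)"
    unfolding frac_sobolev_norm_def by (rule add_strict_mono)
  also have "\<dots> = ennreal e" using e by (simp flip: ennreal_plus)
  finally show ?thesis .
qed

lemma modulars_less_if_frac_sobolev_norm_less:
  fixes u :: "'a::euclidean_space \<Rightarrow> real"
  assumes \<Omega>: "open \<Omega>" and u: "u \<in> borel_measurable borel"
    and p: "p \<ge> 1" and e: "e > 0" and less: "frac_sobolev_norm s p \<Omega> u < ennreal e"
  shows "Lp_modular p \<Omega> u < ennreal (e powr p)" "slobodeckij_energy s p \<Omega> u < ennreal (e powr p)"
proof -
  have *: "a < ennreal (e powr p)" if "ennroot p a < ennreal e" for a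
  proof (cases a)
    case (real r)
    then have "r powr (1 / p) < e" using that e by (simp add: ennroot_def ennreal_less_iff)
    then have "(r powr (1 / p)) powr p < e powr p" using p by (intro powr_less_mono2) auto
    then show ?thesis using real p by (simp add: powr_powr ennreal_less_iff)
  qed (use that in \<open>simp add: ennroot_def\<close>)
  have "Lp_norm p \<Omega> u < ennreal e" "gagliardo_seminorm s p \<Omega> u < ennreal e"
    using less unfolding frac_sobolev_norm_def by (auto intro: le_less_trans[rotated])
  then show "Lp_modular p \<Omega> u < ennreal (e powr p)" "slobodeckij_energy s p \<Omega> u < ennreal (e powr p)"
    using * by (simp_all add: sobolev_modular_borel_version[OF \<Omega> u, of u])
qed

section \<open>Density from cutoffs of small energy\<close>

lemma sobolev_modular_mono:
  assumes p: "p \<ge> 1" and "\<And>x. x \<in> S \<Longrightarrow> \<bar>u x\<bar> \<le> \<bar>w x\<bar>"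
    and "\<And>x y. x \<in> S \<Longrightarrow> y \<in> S \<Longrightarrow> \<bar>u x - u y\<bar> \<le> \<bar>w x - w y\<bar>"
  shows "sobolev_modular s p S u \<le> sobolev_modular s p S w"
  unfolding sobolev_modular_def Lp_modular_def slobodeckij_energy_def slobodeckij_quotient_def
  using assms
  by (intro add_mono nn_integral_mono)
    (auto simp: indicator_def intro!: ennreal_leI divide_right_mono powr_mono2)

lemma sobolev_modular_mono_set:
  assumes "S \<subseteq> T"
  shows "sobolev_modular s p S u \<le> sobolev_modular s p T u"
  unfolding sobolev_modular_def Lp_modular_def slobodeckij_energy_def
  using assms by (intro add_mono nn_integral_mono) (auto simp: indicator_def)

text \<open>Mollification is an average over small translations, so an estimate that holds uniformly for
  small translations carries over to the mollified function.\<close>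

lemma nn_integral_weighted_average_le:
  fixes w :: "'a::euclidean_space \<Rightarrow> real" and H :: "'b::euclidean_space \<times> 'a \<Rightarrow> ennreal"
  assumes w: "\<And>z. w z \<ge> 0" "integrable lborel w" "(\<integral>z. w z \<partial>lborel) = 1" "\<And>z. norm z \<ge> e \<Longrightarrow> w z = 0"
    and [measurable]: "H \<in> borel_measurable borel"
    and le: "\<And>z. norm z < e \<Longrightarrow> (\<integral>\<^sup>+X. H (X, z) \<partial>lborel) \<le> E"
  shows "(\<integral>\<^sup>+X. \<integral>\<^sup>+z. ennreal (w z) * H (X, z) \<partial>lborel \<partial>lborel) \<le> E"
proof -
  have [measurable]: "w \<in> borel_measurable borel" using w(2) by simp
  have meas: "(\<lambda>q. ennreal (w (snd q)) * H q) \<in> borel_measurable borel"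
  proof -
    have [measurable]: "(snd :: 'b \<times> 'a \<Rightarrow> 'a) \<in> borel_measurable borel"
      by (intro borel_measurable_continuous_onI continuous_intros)
    show ?thesis by measurable
  qed
  have [measurable]: "(\<lambda>X. H (X, z)) \<in> borel_measurable borel" for z
    using measurable_compose[of "\<lambda>X. (X, z)" borel borel H] by (simp add: borel_measurable_continuous_onI continuous_intros)
  have "(\<integral>\<^sup>+X. \<integral>\<^sup>+z. ennreal (w z) * H (X, z) \<partial>lborel \<partial>lborel)
    = (\<integral>\<^sup>+z. \<integral>\<^sup>+X. ennreal (w z) * H (X, z) \<partial>lborel \<partial>lborel)"
    using nn_integral_lborel_pair[OF meas] by simp
  also have "\<dots> = (\<integral>\<^sup>+z. ennreal (w z) * (\<integral>\<^sup>+X. H (X, z) \<partial>lborel) \<partial>lborel)"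
    by (simp add: nn_integral_cmult)
  also have "\<dots> \<le> (\<integral>\<^sup>+z. ennreal (w z) * E \<partial>lborel)"
  proof (rule nn_integral_mono)
    fix z
    show "ennreal (w z) * (\<integral>\<^sup>+X. H (X, z) \<partial>lborel) \<le> ennreal (w z) * E"
      using le[of z] w(4)[of z] by (cases "norm z < e") (auto intro: mult_left_mono)
  qed
  also have "\<dots> = E"
    using w by (simp add: nn_integral_multc nn_integral_eq_integral)
  finally show ?thesis .
qed

lemma lborel_distr_reflect:
  fixes x :: "'a::euclidean_space"
  shows "distr lborel borel (\<lambda>z. x - z) = lborel"
  using lborel_affine[of "-1" x] by (simp add: density_1)

lemma convolve_commute:
  fixes g \<phi> :: "'a::euclidean_space \<Rightarrow> real"
  assumes [measurable]: "g \<in> borel_measurable borel" "\<phi> \<in> borel_measurable borel"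
  shows "convolve g \<phi> x = (\<integral>z. \<phi> z * g (x - z) \<partial>lborel)"
proof -
  have "convolve g \<phi> x = (\<integral>y. g y * \<phi> (x - y) \<partial>(distr lborel borel (\<lambda>z. x - z)))"
    by (simp add: convolve_def lborel_distr_reflect)
  also have "\<dots> = (\<integral>z. \<phi> z * g (x - z) \<partial>lborel)"
    by (subst integral_distr) (simp_all add: mult.commute)
  finally show ?thesis .
qed

lemma mollification_test_function:
  fixes g :: "'a::euclidean_space \<Rightarrow> real"
  assumes g: "integrable lborel g" and C: "compact C" "\<And>x. x \<notin> C \<Longrightarrow> g x = 0"
    and e: "e > 0" and sub: "{x + y |x y. x \<in> C \<and> y \<in> cball 0 e} \<subseteq> \<Omega>"
  shows "convolve g (mollifier e) \<in> test_functions \<Omega>"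
proof -
  let ?D = "{x + y |x y. x \<in> C \<and> y \<in> cball 0 e}"
  have D: "compact ?D" by (intro compact_sums C) simp
  have "{x. convolve g (mollifier e) x \<noteq> 0} \<subseteq> ?D"
  proof
    fix x
    assume "x \<in> {x. convolve g (mollifier e) x \<noteq> 0}"
    then have "\<exists>y. g y * mollifier e (x - y) \<noteq> 0"
      by (auto simp: convolve_def intro!: Bochner_Integration.integral_eq_zero_AE AE_I2)
    then obtain y where y: "g y \<noteq> 0" "mollifier e (x - y) \<noteq> 0" by auto
    then have "y \<in> C" "norm (x - y) \<le> e"
      using C(2) mollifier_outside[OF e, of "x - y"] by force+
    then show "x \<in> ?D"
      by (intro CollectI exI[of _ y] exI[of _ "x - y"]) auto
  qed
  then have "closure {x. convolve g (mollifier e) x \<noteq> 0} \<subseteq> ?D"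
    using D compact_imp_closed by (intro closure_minimal) auto
  moreover have "compact (closure {x. convolve g (mollifier e) x \<noteq> 0})"
    using calculation D by (meson closed_closure compact_closure bounded_subset compact_imp_bounded closure_subset order_trans)
  moreover have "Ck k (convolve g (mollifier e))" for k
    by (rule Ck_convolve[OF g Ck_mollifier[OF e], where r = e]) (simp add: mollifier_outside[OF e])
  ultimately show ?thesis
    using sub by (auto simp: test_functions_def)
qed

lemma powr_divide_root:
  fixes a b p q :: real
  assumes "p \<ge> 1" "a \<ge> 0" "b \<ge> 0"
  shows "(a / b powr (q / p)) powr p = a powr p / b powr q"
  using assms by (simp add: powr_divide powr_powr)

text \<open>The quotient with denominator \<open>norm (x - y) powr ((d + s * p) / p)\<close> turns the increments of \<open>g\<close>
  into a function \<open>G\<close> in \<open>Lp\<close> of the product space. Since a diagonal translation leaves \<open>x - y\<close>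
  unchanged, mollifying \<open>g\<close> means averaging \<open>G\<close> over diagonal translations, and continuity of translations
  in \<open>Lp\<close> gives convergence of the energies.\<close>

lemma mollification_approximates:
  fixes g :: "'a::euclidean_space \<Rightarrow> real"
  assumes [measurable]: "g \<in> borel_measurable borel" and K: "\<And>x. \<bar>g x\<bar> \<le> K"
    and C: "compact C" "\<And>x. x \<notin> C \<Longrightarrow> g x = 0" and \<Omega>: "open \<Omega>" "C \<subseteq> \<Omega>"
    and p: "p \<ge> 1" and fin: "sobolev_modular s p UNIV g < \<infinity>" and e: "e > 0"
  shows "\<exists>\<phi>\<in>test_functions \<Omega>. sobolev_modular s p UNIV (\<lambda>x. g x - \<phi> x) \<le> ennreal e"
proof -
  let ?q = "real DIM('a) + s * p"
  define G where "G z = (g (fst z) - g (snd z)) / norm (fst z - snd z) powr (?q / p)" for z :: "'a \<times> 'a"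
  have G_powr: "\<bar>G z\<bar> powr p = slobodeckij_quotient s p g z" for z
    using p by (simp add: G_def slobodeckij_quotient_def abs_divide powr_divide_root)
  have G[measurable]: "G \<in> borel_measurable borel"
    unfolding G_def[abs_def] borel_prod[symmetric] by measurable
  have int_g: "integrable lborel g"
    by (rule integrableI_bounded_set[of C _ _ K])
      (use C K emeasure_compact_finite[OF C(1)] compact_imp_closed in \<open>auto intro: borel_closed\<close>)
  have "translation_continuous p g"
    using fin by (intro translation_continuous_Lp p) (simp_all add: sobolev_modular_def Lp_modular_def)
  then obtain d1 where d1: "d1 > 0"
    "\<And>z. norm z < d1 \<Longrightarrow> (\<integral>\<^sup>+x. ennreal (\<bar>g (x + z) - g x\<bar> powr p) \<partial>lborel) \<le> ennreal (e / 2)"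
    using e unfolding translation_continuous_def by (meson half_gt_zero)
  have "translation_continuous p G"
    using fin by (intro translation_continuous_Lp p G)
      (simp_all add: sobolev_modular_def slobodeckij_energy_def G_powr)
  then obtain d2 where d2: "d2 > 0"
    "\<And>z. norm z < d2 \<Longrightarrow> (\<integral>\<^sup>+x. ennreal (\<bar>G (x + z) - G x\<bar> powr p) \<partial>lborel) \<le> ennreal (e / 2)"
    using e unfolding translation_continuous_def by (meson half_gt_zero)
  obtain d3 where d3: "d3 > 0" "{x + y |x y. x \<in> C \<and> y \<in> cball 0 d3} \<subseteq> \<Omega>"
  proof -
    obtain r where "r > 0" "(\<Union>x\<in>C. cball x r) \<subseteq> \<Omega>"
      using compact_subset_open_imp_cball_epsilon_subset[OF C(1) \<Omega>] by blast
    then show ?thesis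
      by (intro that[of r]) (auto simp: dist_norm subset_iff, metis add_diff_cancel_left' norm_minus_commute)
  qed
  define h where "h = min d1 (min (d2 / 2) d3)"
  have h: "h > 0" "h \<le> d1" "h \<le> d2 / 2" "h \<le> d3"
    using d1(1) d2(1) d3(1) by (auto simp: h_def)
  let ?m = "mollifier h :: 'a \<Rightarrow> real"
  define \<phi> where "\<phi> = convolve g ?m"
  note m = mollifier_nonneg[OF h(1), where 'a = 'a] integrable_mollifier[OF h(1), where 'a = 'a]
    integral_mollifier[OF h(1), where 'a = 'a]
  have m_meas[measurable]: "?m \<in> borel_measurable borel"
    using m(2) by simp
  have m_int: "integrable lborel (\<lambda>z. ?m z * k z)" if "k \<in> borel_measurable borel" "\<And>z. \<bar>k z\<bar> \<le> B" for k :: "'a \<Rightarrow> real" and B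
  proof (rule Bochner_Integration.integrable_bound[where f = "\<lambda>z. B * ?m z"])
    show "AE z in lborel. norm (?m z * k z) \<le> norm (B * ?m z)"
    proof (intro AE_I2)
      fix z
      have "\<bar>k z\<bar> \<le> \<bar>B\<bar>" using that(2)[of z] by simp
      then show "norm (?m z * k z) \<le> norm (B * ?m z)"
        by (simp add: abs_mult mult.commute mult_right_mono)
    qed
  qed (use m(2) that(1) in simp_all)
  have diff: "\<phi> x - g x = (\<integral>z. ?m z * (g (x - z) - g x) \<partial>lborel)" for x
  proof -
    have "(\<integral>z. ?m z * (g (x - z) - g x) \<partial>lborel) = (\<integral>z. ?m z * g (x - z) - ?m z * g x \<partial>lborel)"
      by (simp add: right_diff_distrib)
    also have "\<dots> = (\<integral>z. ?m z * g (x - z) \<partial>lborel) - (\<integral>z. ?m z * g x \<partial>lborel)"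
      using m_int[of "\<lambda>z. g (x - z)" K] K m(2) by (intro Bochner_Integration.integral_diff) auto
    finally show ?thesis
      using m(3) by (simp add: \<phi>_def convolve_commute)
  qed
  have bound2: "\<bar>g a - g b\<bar> \<le> 2 * K" for a b
    using K[of a] K[of b] by linarith
  have "Lp_modular p UNIV (\<lambda>x. g x - \<phi> x) \<le> ennreal (e / 2)"
  proof -
    let ?H = "\<lambda>q::'a \<times> 'a. ennreal (\<bar>g (fst q - snd q) - g (fst q)\<bar> powr p)"
    have "Lp_modular p UNIV (\<lambda>x. g x - \<phi> x) = (\<integral>\<^sup>+x. ennreal (\<bar>\<phi> x - g x\<bar> powr p) \<partial>lborel)"
      by (simp add: Lp_modular_def abs_minus_commute)
    also have "\<dots> \<le> (\<integral>\<^sup>+x. \<integral>\<^sup>+z. ennreal (?m z) * ?H (x, z) \<partial>lborel \<partial>lborel)"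
    proof (rule nn_integral_mono)
      fix x
      have "ennreal (\<bar>\<phi> x - g x\<bar> powr p) \<le> (\<integral>\<^sup>+z. ennreal (?m z * \<bar>g (x - z) - g x\<bar> powr p) \<partial>lborel)"
        unfolding diff by (intro jensen_powr m p m_int[of _ "2 * K"] bound2) simp_all
      then show "ennreal (\<bar>\<phi> x - g x\<bar> powr p) \<le> (\<integral>\<^sup>+z. ennreal (?m z) * ?H (x, z) \<partial>lborel)"
        using m(1) by (simp add: ennreal_mult')
    qed
    also have "\<dots> \<le> ennreal (e / 2)"
    proof (rule nn_integral_weighted_average_le[of ?m h])
      show "?H \<in> borel_measurable borel"
        unfolding borel_prod[symmetric] by measurable
      show "(\<integral>\<^sup>+x. ?H (x, z) \<partial>lborel) \<le> ennreal (e / 2)" if "norm z < h" for z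
        using d1(2)[of "- z"] that h by simp
    qed (use m mollifier_outside[OF h(1)] in auto)
    finally show ?thesis .
  qed
  moreover have "slobodeckij_energy s p UNIV (\<lambda>x. g x - \<phi> x) \<le> ennreal (e / 2)"
  proof -
    let ?H = "\<lambda>q::('a \<times> 'a) \<times> 'a. ennreal (\<bar>G (fst q - (snd q, snd q)) - G (fst q)\<bar> powr p)"
    have "slobodeckij_energy s p UNIV (\<lambda>x. g x - \<phi> x) = (\<integral>\<^sup>+X. ennreal (slobodeckij_quotient s p (\<lambda>x. g x - \<phi> x) X) \<partial>lborel)"
      by (simp add: slobodeckij_energy_def)
    also have "\<dots> \<le> (\<integral>\<^sup>+X. \<integral>\<^sup>+z. ennreal (?m z) * ?H (X, z) \<partial>lborel \<partial>lborel)"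
    proof (rule nn_integral_mono)
      fix X :: "'a \<times> 'a"
      obtain x y where X: "X = (x, y)" by (cases X)
      let ?k = "\<lambda>z. G ((x, y) - (z, z)) - G (x, y)"
      let ?W = "norm (x - y) powr (?q / p)"
      have k: "?k z = ((g (x - z) - g x) - (g (y - z) - g y)) / ?W" for z
        by (simp add: G_def diff_divide_distrib)
      have [measurable]: "?k \<in> borel_measurable borel"
        unfolding k by measurable
      have "\<bar>?k z\<bar> \<le> (2 * K + 2 * K) / ?W" for z
      proof -
        have "\<bar>(g (x - z) - g x) - (g (y - z) - g y)\<bar> \<le> 2 * K + 2 * K"
          using bound2[of "x - z" x] bound2[of "y - z" y] by linarith
        then show ?thesis
          unfolding k abs_divide by (simp add: divide_right_mono)
      qed
      then have int_k: "integrable lborel (\<lambda>z. ?m z * ?k z)"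
        by (intro m_int[of _ "(2 * K + 2 * K) / ?W"]) auto
      have "(\<integral>z. ?m z * ?k z \<partial>lborel) = ((\<phi> x - g x) - (\<phi> y - g y)) / ?W"
      proof -
        have "(\<phi> x - g x) - (\<phi> y - g y)
          = (\<integral>z. ?m z * (g (x - z) - g x) - ?m z * (g (y - z) - g y) \<partial>lborel)"
          unfolding diff
          by (intro Bochner_Integration.integral_diff[symmetric] m_int[of _ "2 * K"] bound2) simp_all
        also have "\<dots> = (\<integral>z. ?m z * ((g (x - z) - g x) - (g (y - z) - g y)) \<partial>lborel)"
          by (simp add: right_diff_distrib)
        finally show ?thesis
          unfolding k by simp
      qed
      then have "slobodeckij_quotient s p (\<lambda>x. g x - \<phi> x) (x, y) = \<bar>\<integral>z. ?m z * ?k z \<partial>lborel\<bar> powr p"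
        using p by (simp add: slobodeckij_quotient_def abs_divide powr_divide_root)
          (simp add: abs_minus_commute algebra_simps)
      moreover have "ennreal (\<bar>\<integral>z. ?m z * ?k z \<partial>lborel\<bar> powr p) \<le> (\<integral>\<^sup>+z. ennreal (?m z * \<bar>?k z\<bar> powr p) \<partial>lborel)"
        by (intro jensen_powr m p int_k) simp_all
      ultimately show "ennreal (slobodeckij_quotient s p (\<lambda>x. g x - \<phi> x) X) \<le> (\<integral>\<^sup>+z. ennreal (?m z) * ?H (X, z) \<partial>lborel)"
        using m(1) by (simp add: X ennreal_mult')
    qed
    also have "\<dots> \<le> ennreal (e / 2)"
    proof (rule nn_integral_weighted_average_le[of ?m h])
      have "(\<lambda>q::('a \<times> 'a) \<times> 'a. fst q - (snd q, snd q)) \<in> borel_measurable borel"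
        by (intro borel_measurable_continuous_onI continuous_intros)
      moreover have "(fst :: ('a \<times> 'a) \<times> 'a \<Rightarrow> _) \<in> borel_measurable borel"
        by (intro borel_measurable_continuous_onI continuous_intros)
      ultimately show "?H \<in> borel_measurable borel"
        by measurable
      show "(\<integral>\<^sup>+X. ?H (X, z) \<partial>lborel) \<le> ennreal (e / 2)" if z: "norm z < h" for z
      proof -
        have "norm (- z, - z) \<le> norm (- z) + norm (- z)" by (rule norm_Pair_le)
        then have "norm (- z, - z) < d2" using z h by simp
        moreover have eq: "X + (- z, - z) = X - (z, z)" for X :: "'a \<times> 'a"
          by (cases X) simp
        ultimately show ?thesis using d2(2)[of "(- z, - z)"] unfolding eq by simp
      qed
    qed (use m mollifier_outside[OF h(1)] in auto)
    finally show ?thesis .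
  qed
  ultimately have "sobolev_modular s p UNIV (\<lambda>x. g x - \<phi> x) \<le> ennreal (e / 2) + ennreal (e / 2)"
    unfolding sobolev_modular_def by (rule add_mono)
  also have "\<dots> = ennreal e" using e by (simp flip: ennreal_plus)
  finally have "sobolev_modular s p UNIV (\<lambda>x. g x - \<phi> x) \<le> ennreal e" .
  moreover have "\<phi> \<in> test_functions \<Omega>"
    unfolding \<phi>_def using d3(2) h
    by (intro mollification_test_function[OF int_g C]) (auto simp: subset_iff intro: order_trans)
  ultimately show ?thesis by blast
qed


text \<open>A function supported in a compact subset \<open>C\<close> of \<open>\<Omega>\<close> can be extended by zero: the pairs that are
  added to the energy have one point in \<open>C\<close> and the other outside \<open>\<Omega>\<close>, so their distance is bounded below
  and the kernel is integrable there.\<close>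

lemma extension_by_zero_energy:
  fixes g :: "'a::euclidean_space \<Rightarrow> real"
  assumes g[measurable]: "g \<in> borel_measurable borel" and K: "\<And>x. \<bar>g x\<bar> \<le> K"
    and C: "compact C" "\<And>x. x \<notin> C \<Longrightarrow> g x = 0" and \<Omega>: "open \<Omega>" "C \<subseteq> \<Omega>"
    and sp: "0 < s" "1 \<le> p" and fin: "sobolev_modular s p \<Omega> g < \<infinity>"
  shows "sobolev_modular s p UNIV g < \<infinity>"
proof -
  let ?q = "real DIM('a) + s * p"
  have \<Omega>_borel[measurable]: "\<Omega> \<in> sets borel" using \<Omega> by simp
  note [measurable] = square_borel[OF \<Omega>_borel]
  have C_borel[measurable]: "C \<in> sets borel" by (intro borel_closed compact_imp_closed C)
  obtain r where r: "r > 0" "(\<Union>x\<in>C. cball x r) \<subseteq> \<Omega>"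
    using compact_subset_open_imp_cball_epsilon_subset[OF C(1) \<Omega>] by blast
  have far: "r \<le> norm (x - y)" if "x \<in> C" "y \<notin> \<Omega>" for x y
  proof (rule ccontr)
    assume "\<not> r \<le> norm (x - y)"
    then have "y \<in> cball x r" by (simp add: dist_norm)
    then show False using that r(2) by blast
  qed
  have K0: "K \<ge> 0" using K[of 0] by linarith
  have "s * p > 0" using sp by simp
  from kernel_integral_far[OF this, where 'a = 'a]
  obtain A where A: "\<And>(x::'a) m. m > 0 \<Longrightarrow>
    (\<integral>\<^sup>+y. ennreal (norm (x - y) powr - ?q) * indicator {y. m \<le> norm (x - y)} y \<partial>lborel) \<le> ennreal (A * m powr - (s * p))"
    by blast
  define T where "T z = ennreal (K powr p) * indicator C (fst z) *
     (ennreal (norm (fst z - snd z) powr - ?q) * indicator {y. r \<le> norm (fst z - y)} (snd z))" for z :: "'a \<times> 'a"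
  have ind: "indicator {y. r \<le> norm (fst z - y)} (snd z) = (indicator {r..} (norm (fst z - snd z)) :: ennreal)" for z :: "'a \<times> 'a"
    by (simp add: indicator_def)
  have T_meas[measurable]: "T \<in> borel_measurable borel"
    unfolding T_def[abs_def] ind borel_prod[symmetric] by measurable
  define T' where "T' z = T (snd z, fst z)" for z
  have T'_meas[measurable]: "T' \<in> borel_measurable borel"
  proof -
    have "(\<lambda>z::'a \<times> 'a. (snd z, fst z)) \<in> borel_measurable borel"
      by (intro borel_measurable_continuous_onI continuous_intros)
    then show ?thesis unfolding T'_def[abs_def] by measurable
  qed
  have T_fin: "(\<integral>\<^sup>+z. T z \<partial>lborel) < \<infinity>"
  proof -
    have "(\<integral>\<^sup>+z. T z \<partial>lborel) = (\<integral>\<^sup>+x. \<integral>\<^sup>+y. T (x, y) \<partial>lborel \<partial>lborel)"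
      by (rule nn_integral_lborel_pair(1)) simp
    also have "\<dots> \<le> (\<integral>\<^sup>+x. ennreal (K powr p) * ennreal (A * r powr - (s * p)) * indicator C x \<partial>lborel)"
    proof (rule nn_integral_mono)
      fix x
      have "(\<integral>\<^sup>+y. T (x, y) \<partial>lborel) = ennreal (K powr p) * indicator C x *
          (\<integral>\<^sup>+y. ennreal (norm (x - y) powr - ?q) * indicator {y. r \<le> norm (x - y)} y \<partial>lborel)"
        unfolding T_def fst_conv snd_conv by (rule nn_integral_cmult) measurable
      also have "\<dots> \<le> ennreal (K powr p) * indicator C x * ennreal (A * r powr - (s * p))"
        by (intro mult_left_mono A r) auto
      finally show "(\<integral>\<^sup>+y. T (x, y) \<partial>lborel) \<le> ennreal (K powr p) * ennreal (A * r powr - (s * p)) * indicator C x"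
        by (simp add: mult_ac)
    qed
    also have "\<dots> = ennreal (K powr p) * ennreal (A * r powr - (s * p)) * emeasure lborel C"
      by (rule nn_integral_cmult_indicator) simp
    also have "\<dots> < \<infinity>"
      using emeasure_compact_finite[OF C(1)] by (simp add: ennreal_mult_less_top)
    finally show ?thesis .
  qed
  have T'_fin: "(\<integral>\<^sup>+z. T' z \<partial>lborel) < \<infinity>"
    using T_fin nn_integral_lborel_pair(2)[OF T_meas] nn_integral_lborel_pair(1)[OF T'_meas]
    by (simp add: T'_def)
  have pointwise: "ennreal (slobodeckij_quotient s p g z)
    \<le> ennreal (slobodeckij_quotient s p g z) * indicator (\<Omega> \<times> \<Omega>) z + T z + T' z" for z
  proof -
    obtain x y where z: "z = (x, y)" by (cases z)
    have one: "ennreal (slobodeckij_quotient s p g (x, y)) \<le> T (x, y)" if "x \<in> C" "y \<notin> \<Omega>" for x y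
    proof -
      have "g y = 0" using that C(2) \<Omega>(2) by blast
      then have "slobodeckij_quotient s p g (x, y) \<le> K powr p * norm (x - y) powr - ?q"
        using K[of x] sp
        unfolding slobodeckij_quotient_def powr_minus divide_inverse
        by (intro mult_mono powr_mono2) auto
      then show ?thesis
        using far[OF that] that by (simp add: T_def ennreal_leI flip: ennreal_mult')
    qed
    consider "x \<in> \<Omega>" "y \<in> \<Omega>" | "x \<in> C" "y \<notin> \<Omega>" | "x \<notin> \<Omega>" "y \<in> C" | "x \<notin> C" "y \<notin> C"
      using \<Omega>(2) by blast
    then show ?thesis
    proof cases
      case 1
      then show ?thesis by (simp add: z add_increasing2)
    next
      case 2
      then show ?thesis using one[OF 2] by (simp add: z add_increasing2)
    next
      case 3
      have "slobodeckij_quotient s p g (x, y) = slobodeckij_quotient s p g (y, x)"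
        by (simp add: slobodeckij_quotient_def abs_minus_commute norm_minus_commute)
      then show ?thesis using one[OF 3(2,1)] 3 by (simp add: z T'_def add_increasing)
    next
      case 4
      then have "slobodeckij_quotient s p g (x, y) = 0" by (simp add: slobodeckij_quotient_def C(2))
      then show ?thesis by (simp add: z)
    qed
  qed
  have "slobodeckij_energy s p UNIV g \<le> (\<integral>\<^sup>+z. ennreal (slobodeckij_quotient s p g z) * indicator (\<Omega> \<times> \<Omega>) z + T z + T' z \<partial>lborel)"
    unfolding slobodeckij_energy_def by (intro nn_integral_mono) (use pointwise in simp)
  also have "\<dots> = slobodeckij_energy s p \<Omega> g + (\<integral>\<^sup>+z. T z \<partial>lborel) + (\<integral>\<^sup>+z. T' z \<partial>lborel)"
    unfolding slobodeckij_energy_def by (simp add: nn_integral_add)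
  also have "\<dots> < \<infinity>"
    using fin T_fin T'_fin by (simp add: sobolev_modular_def)
  finally have "slobodeckij_energy s p UNIV g < \<infinity>" .
  moreover have "Lp_modular p UNIV g = Lp_modular p \<Omega> g"
    unfolding Lp_modular_def using C(2) \<Omega>(2) by (intro nn_integral_cong) (auto simp: indicator_def)
  ultimately show ?thesis
    using fin by (simp add: sobolev_modular_def)
qed

lemma ennreal_tendsto_0_obtains:
  fixes f :: "nat \<Rightarrow> ennreal"
  assumes "f \<longlonglongrightarrow> 0" "e > 0"
  obtains n where "f n \<le> ennreal e"
  using ennreal_tendsto_0_ex_le[OF assms] by blast

text \<open>The criterion behind both positive results. A function is truncated in height, multiplied by
  \<open>1 - \<psi> n\<close>, which makes its support compact in \<open>\<Omega>\<close>, and then mollified. Only the second step uses the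
  geometry of \<open>\<Omega>\<close>, through the existence of cutoffs with small energy.\<close>

proposition density_of_test_functions:
  fixes \<psi> :: "nat \<Rightarrow> 'a::euclidean_space \<Rightarrow> real"
  assumes \<Omega>: "open \<Omega>" "bounded \<Omega>" and s: "0 < s" and p: "1 \<le> p"
    and \<psi>_meas[measurable]: "\<And>n. \<psi> n \<in> borel_measurable borel"
    and \<psi>: "\<And>n x. 0 \<le> \<psi> n x" "\<And>n x. \<psi> n x \<le> 1"
    and near: "\<And>n. \<exists>r>0. \<forall>x. infdist x (frontier \<Omega>) < r \<longrightarrow> \<psi> n x = 1"
    and lim: "\<And>x. x \<in> \<Omega> \<Longrightarrow> (\<lambda>n. \<psi> n x) \<longlonglongrightarrow> 0"
    and energy: "(\<lambda>n. slobodeckij_energy s p \<Omega> (\<psi> n)) \<longlonglongrightarrow> 0"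
  shows "frac_sobolev_0 s p \<Omega> = frac_sobolev s p \<Omega>"
proof (intro equalityI subsetI)
  fix f
  assume f: "f \<in> frac_sobolev s p \<Omega>"
  then obtain u where u[measurable]: "u \<in> borel_measurable borel" and ae: "AE x in lebesgue_on \<Omega>. f x = u x"
    using AE_lebesgue_on_borel_version[OF _ \<Omega>(1)] by (auto simp: frac_sobolev_def Lp_space_def)
  have u_fin: "sobolev_modular s p \<Omega> u < \<infinity>"
    by (rule frac_sobolev_borel_version[OF \<Omega>(1) u ae f])
  have \<Omega>_borel[measurable]: "\<Omega> \<in> sets borel" using \<Omega> by simp
  have "\<exists>\<phi>\<in>test_functions \<Omega>. frac_sobolev_norm s p \<Omega> (\<lambda>x. f x - \<phi> x) < ennreal \<epsilon>" if \<epsilon>: "\<epsilon> > 0" for \<epsilon>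
  proof -
    let ?M = "sobolev_modular s p \<Omega>" and ?c = "2 powr p :: real"
    \<comment> \<open>The modular has to be below \<open>e\<close>; two quasi-triangle inequalities cost the factor \<open>3 * (2 powr p)\<^sup>2\<close>.\<close>
    define e where "e = (\<epsilon> / 2) powr p"
    define \<delta> where "\<delta> = e / (4 * ?c\<^sup>2)"
    have e: "e > 0" and \<delta>: "\<delta> > 0" using \<epsilon> by (auto simp: e_def \<delta>_def)
    have "(\<lambda>n. ?M (\<lambda>x. u x - clamp_abs (real n) (u x))) \<longlonglongrightarrow> 0"
    proof (rule sobolev_modular_dominated_tendsto_0[OF _ u \<Omega>_borel p _ _ _ u_fin])
      show "(\<lambda>n. u x - clamp_abs (real n) (u x)) \<longlonglongrightarrow> 0" for x
      proof (rule tendsto_eventually)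
        obtain n0 where "real n0 \<ge> \<bar>u x\<bar>" using real_arch_simple by blast
        then show "\<forall>\<^sub>F n in sequentially. u x - clamp_abs (real n) (u x) = 0"
          unfolding eventually_sequentially by (intro exI[of _ n0]) (auto simp: clamp_abs(2))
      qed
    qed (auto simp: clamp_abs)
    then obtain N where N: "?M (\<lambda>x. u x - clamp_abs (real N) (u x)) \<le> ennreal \<delta>"
      by (rule ennreal_tendsto_0_obtains[OF _ \<delta>])
    define w where "w x = clamp_abs (real N) (u x)" for x
    have w[measurable]: "w \<in> borel_measurable borel" unfolding w_def[abs_def] by measurable
    have w_bound: "\<bar>w x\<bar> \<le> real N" for x by (simp add: w_def clamp_abs(1))
    have "?M w \<le> ?M u"
      by (intro sobolev_modular_mono p) (auto simp: w_def clamp_abs(3) clamp_abs_def)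
    with u_fin have w_fin: "?M w < \<infinity>" by simp
    have "(\<lambda>n. ?M (\<lambda>x. w x * \<psi> n x)) \<longlonglongrightarrow> 0"
      by (rule sobolev_modular_cutoff_tendsto_0[OF \<psi>_meas w \<Omega>_borel p w_bound \<psi> lim w_fin energy])
    then obtain n where n: "?M (\<lambda>x. w x * \<psi> n x) \<le> ennreal \<delta>"
      by (rule ennreal_tendsto_0_obtains[OF _ \<delta>])
    obtain r where r: "r > 0" "\<And>x. infdist x (frontier \<Omega>) < r \<Longrightarrow> \<psi> n x = 1"
      using near by blast
    define g where "g x = (w x + - w x * \<psi> n x) * indicator \<Omega> x" for x
    have g[measurable]: "g \<in> borel_measurable borel"
      unfolding g_def[abs_def] by measurable
    have g_bound: "\<bar>g x\<bar> \<le> real N" for x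
    proof -
      have "\<bar>g x\<bar> \<le> \<bar>w x\<bar> * \<bar>1 - \<psi> n x\<bar>"
        by (simp add: g_def indicator_def abs_mult[symmetric] right_diff_distrib)
      also have "\<dots> \<le> \<bar>w x\<bar>" using \<psi> by (intro mult_left_le) (auto simp: abs_le_iff le_diff_eq)
      finally show ?thesis using w_bound order_trans by blast
    qed
    have "?M g = ?M (\<lambda>x. w x + - w x * \<psi> n x)"
      by (intro antisym sobolev_modular_mono p) (auto simp: g_def)
    also have "\<dots> \<le> ennreal ?c * (?M w + ?M (\<lambda>x. - w x * \<psi> n x))"
      using p by (intro sobolev_modular_add_le) auto
    also have "?M (\<lambda>x. - w x * \<psi> n x) \<le> ?M (\<lambda>x. w x * \<psi> n x)"
      by (intro sobolev_modular_mono p) (auto simp: abs_minus_commute)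
    also have "ennreal ?c * (?M w + ?M (\<lambda>x. w x * \<psi> n x)) < \<infinity>"
      using w_fin le_less_trans[OF n] by (simp add: ennreal_mult_less_top)
    finally have g_fin: "?M g < \<infinity>" by (simp add: mult_left_mono)
    \<comment> \<open>The cutoff equals one at distances below \<open>r\<close> from the boundary, so that \<open>C\<close> contains the support of \<open>g\<close>.\<close>
    define C where "C = closure \<Omega> \<inter> {x. r \<le> infdist x (frontier \<Omega>)}"
    have "closed {x. r \<le> infdist x (frontier \<Omega>)}"
      by (intro closed_Collect_le continuous_intros)
    then have C: "compact C"
      using \<Omega>(2) by (auto simp: C_def compact_eq_bounded_closed intro: bounded_subset[of "closure \<Omega>"])
    have C_sub: "C \<subseteq> \<Omega>"
    proof
      fix x assume x: "x \<in> C"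
      then have "x \<notin> frontier \<Omega>" using r(1) by (auto simp: C_def)
      then show "x \<in> \<Omega>" using x \<Omega>(1) by (auto simp: C_def frontier_def interior_open)
    qed
    have g0: "g x = 0" if "x \<notin> C" for x
    proof (cases "x \<in> \<Omega>")
      case True
      then have "\<psi> n x = 1" using that closure_subset by (intro r(2)) (force simp: C_def)
      then show ?thesis by (simp add: g_def)
    qed (simp add: g_def)
    have g_fin': "sobolev_modular s p UNIV g < \<infinity>"
      by (rule extension_by_zero_energy[OF g g_bound C _ \<Omega>(1) C_sub s p g_fin]) (rule g0)
    have "\<exists>\<phi>\<in>test_functions \<Omega>. sobolev_modular s p UNIV (\<lambda>x. g x - \<phi> x) \<le> ennreal \<delta>"
      by (rule mollification_approximates[OF g g_bound C _ \<Omega>(1) C_sub p g_fin' \<delta>]) (rule g0)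
    then obtain \<phi> where \<phi>: "\<phi> \<in> test_functions \<Omega>" "sobolev_modular s p UNIV (\<lambda>x. g x - \<phi> x) \<le> ennreal \<delta>"
      by blast
    have \<phi>_meas[measurable]: "\<phi> \<in> borel_measurable borel"
    proof -
      have "Ck 0 \<phi>" using \<phi>(1) by (simp add: test_functions_def)
      then show ?thesis by (simp add: borel_measurable_continuous_onI)
    qed
    have rest: "?M (\<lambda>x. g x - \<phi> x) \<le> ennreal \<delta>"
      using sobolev_modular_mono_set[of \<Omega> UNIV] \<phi>(2) order_trans by blast
    have "?M (\<lambda>x. u x - \<phi> x) \<le> ?M (\<lambda>x. (u x - w x) + (w x * \<psi> n x + (g x - \<phi> x)))"
      by (intro sobolev_modular_mono p) (auto simp: g_def)
    also have "\<dots> \<le> ennreal ?c * (?M (\<lambda>x. u x - w x) + ?M (\<lambda>x. w x * \<psi> n x + (g x - \<phi> x)))"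
      using p by (intro sobolev_modular_add_le) auto
    also have "\<dots> \<le> ennreal ?c * (ennreal \<delta> + ennreal ?c * (?M (\<lambda>x. w x * \<psi> n x) + ?M (\<lambda>x. g x - \<phi> x)))"
      using p N by (intro mult_left_mono add_mono sobolev_modular_add_le) (auto simp: w_def)
    also have "\<dots> \<le> ennreal ?c * (ennreal \<delta> + ennreal ?c * (ennreal \<delta> + ennreal \<delta>))"
      by (intro mult_left_mono add_mono n rest) auto
    also have "\<dots> = ennreal (?c * (\<delta> + ?c * (\<delta> + \<delta>)))"
      using \<delta> by (simp flip: ennreal_plus ennreal_mult')
    also have "\<dots> < ennreal e"
    proof (intro ennreal_lessI e)
      have "?c \<ge> 1" using p by (intro ge_one_powr_ge_zero) auto
      then have "?c * \<delta> \<le> ?c * (?c * \<delta>)" using \<delta> by (intro mult_left_mono) auto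
      then have "?c * (\<delta> + ?c * (\<delta> + \<delta>)) \<le> 3 * ?c\<^sup>2 * \<delta>"
        by (simp add: power2_eq_square algebra_simps)
      also have "\<dots> < 4 * ?c\<^sup>2 * \<delta>" using \<delta> by simp
      also have "\<dots> = e" by (simp add: \<delta>_def)
      finally show "?c * (\<delta> + ?c * (\<delta> + \<delta>)) < e" .
    qed
    finally have "?M (\<lambda>x. u x - \<phi> x) < ennreal e" .
    moreover have "AE x in lebesgue_on \<Omega>. f x - \<phi> x = u x - \<phi> x"
      using ae by eventually_elim simp
    ultimately have "frac_sobolev_norm s p \<Omega> (\<lambda>x. f x - \<phi> x) < ennreal \<epsilon>"
      using \<epsilon> by (intro frac_sobolev_norm_less[OF \<Omega>(1) _ _ p]) (auto simp: e_def)
    then show ?thesis using \<phi>(1) by blast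
  qed
  then show "f \<in> frac_sobolev_0 s p \<Omega>"
    using f by (simp add: frac_sobolev_0_def)
qed (simp add: frac_sobolev_0_def)

section \<open>Logarithmic cutoffs and thin collars\<close>

text \<open>The cutoff falls from one at distance \<open>\<tau>\<close> to zero at distance \<open>exp N * \<tau>\<close>, linearly in the
  logarithm of the distance, so that each of the \<open>N\<close> logarithmic scales carries the same share of the
  variation.\<close>

definition log_cutoff :: "nat \<Rightarrow> real \<Rightarrow> real \<Rightarrow> real" where
  "log_cutoff N \<tau> t = max 0 (1 - ln (max t \<tau> / \<tau>) / real N)"

lemma log_cutoff_simps:
  assumes "\<tau> > 0" "N \<ge> 1"
  shows log_cutoff_nonneg: "0 \<le> log_cutoff N \<tau> t"
    and log_cutoff_le_1: "log_cutoff N \<tau> t \<le> 1"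
    and log_cutoff_below: "t \<le> \<tau> \<Longrightarrow> log_cutoff N \<tau> t = 1"
    and log_cutoff_above: "exp (real N) * \<tau> \<le> t \<Longrightarrow> log_cutoff N \<tau> t = 0"
proof -
  show "0 \<le> log_cutoff N \<tau> t" by (simp add: log_cutoff_def)
  have "ln (max t \<tau> / \<tau>) \<ge> 0" using assms by (intro ln_ge_zero) (simp add: field_simps)
  then show "log_cutoff N \<tau> t \<le> 1" using assms by (simp add: log_cutoff_def)
  show "t \<le> \<tau> \<Longrightarrow> log_cutoff N \<tau> t = 1" using assms by (simp add: log_cutoff_def max_absorb2)
  assume t: "exp (real N) * \<tau> \<le> t"
  then have "exp (real N) \<le> max t \<tau> / \<tau>" using assms by (simp add: field_simps)
  then have "real N \<le> ln (max t \<tau> / \<tau>)"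
    using ln_ge_iff[of "max t \<tau> / \<tau>" "real N"] assms by auto
  then show "log_cutoff N \<tau> t = 0" using assms by (simp add: log_cutoff_def field_simps)
qed

text \<open>The increment is governed by the point that is closer to the boundary, with distances below
  \<open>\<tau>\<close> counted as \<open>\<tau>\<close>.\<close>

lemma log_cutoff_diff_le:
  assumes "\<tau> > 0" "N \<ge> 1" and le: "max t \<tau> \<le> max u \<tau>" and h: "\<bar>u - t\<bar> \<le> h"
  shows "\<bar>log_cutoff N \<tau> t - log_cutoff N \<tau> u\<bar> \<le> ln (1 + h / max t \<tau>) / real N"
proof -
  have pos: "max t \<tau> > 0" "max u \<tau> > 0" using assms(1) by auto
  have "max u \<tau> \<le> max t \<tau> + h" using h by auto
  then have ratio: "max u \<tau> / max t \<tau> \<le> 1 + h / max t \<tau>"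
    using pos by (simp add: field_simps)
  have "\<bar>log_cutoff N \<tau> t - log_cutoff N \<tau> u\<bar> \<le> \<bar>ln (max u \<tau> / \<tau>) / real N - ln (max t \<tau> / \<tau>) / real N\<bar>"
  proof -
    have "\<bar>max 0 (1 - A) - max 0 (1 - B)\<bar> \<le> \<bar>B - A\<bar>" for A B :: real
      by (auto simp: max_def)
    then show ?thesis by (simp only: log_cutoff_def)
  qed
  also have "\<dots> = \<bar>ln (max u \<tau> / max t \<tau>)\<bar> / real N"
    using pos assms(1) by (simp add: ln_div abs_divide flip: diff_divide_distrib)
  also have "\<dots> = ln (max u \<tau> / max t \<tau>) / real N"
    using le pos by simp
  also have "\<dots> \<le> ln (1 + h / max t \<tau>) / real N"
  proof -
    have "0 < max u \<tau> / max t \<tau>" using pos by simp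
    then have "ln (max u \<tau> / max t \<tau>) \<le> ln (1 + h / max t \<tau>)" using ratio by (subst ln_le_cancel_iff) auto
    then show ?thesis by (simp add: divide_right_mono)
  qed
  finally show ?thesis .
qed

lemma ex_exp_interval:
  fixes v :: real
  assumes "\<tau> > 0" "\<tau> \<le> v" "v < exp (real N) * \<tau>"
  shows "\<exists>j<N. exp (real j) * \<tau> \<le> v \<and> v \<le> exp (real (Suc j)) * \<tau>"
proof -
  define l where "l = ln (v / \<tau>)"
  define j where "j = nat \<lfloor>l\<rfloor>"
  have v: "v = exp l * \<tau>" using assms by (simp add: l_def)
  have "l \<ge> 0" using assms by (simp add: l_def)
  then have "real j \<le> l" "l \<le> real (Suc j)"
    using real_of_int_floor_add_one_ge[of l] by (simp_all add: j_def add.commute)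
  moreover have "l < real N" using assms v by simp
  then have "j < N" using \<open>real j \<le> l\<close> by simp
  ultimately show ?thesis using assms(1) v by auto
qed

text \<open>By symmetry only pairs have to be considered in which \<open>x\<close> is at least as close to \<open>E\<close> as \<open>y\<close>.
  Integrating over \<open>y\<close> first gives a multiple of \<open>m x powr - (s * p)\<close>, where \<open>m x = max (infdist x E) \<tau>\<close>, and
  what remains is an integral over the collar where the cutoff varies, which is split into its
  logarithmic layers.\<close>

lemma log_cutoff_energy:
  fixes s p :: real
  assumes s: "0 < s" "s < 1" and p: "1 \<le> p"
  shows "\<exists>C\<ge>0. \<forall>(\<Omega>::'a::euclidean_space set) E \<tau> N. open \<Omega> \<longrightarrow> \<tau> > 0 \<longrightarrow> N \<ge> 1 \<longrightarrow>
    slobodeckij_energy s p \<Omega> (\<lambda>x. log_cutoff N \<tau> (infdist x E)) \<le>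
      ennreal (C * real N powr - p) *
      (\<Sum>j<N. ennreal ((exp (real j) * \<tau>) powr - (s * p)) * emeasure lborel {x\<in>\<Omega>. infdist x E \<le> exp (real (Suc j)) * \<tau>})"
proof -
  let ?q = "real DIM('a) + s * p"
  obtain C where C: "C \<ge> 0" "\<And>(x::'a) m. m > 0 \<Longrightarrow>
    (\<integral>\<^sup>+y. ennreal (ln (1 + norm (x - y) / m) powr p / norm (x - y) powr ?q) \<partial>lborel) \<le> ennreal (C * m powr - (s * p))"
    using log_kernel_integral[OF s p, where 'a = 'a] by blast
  have main: "slobodeckij_energy s p \<Omega> (\<lambda>x. log_cutoff N \<tau> (infdist x E)) \<le>
      ennreal (2 * C * real N powr - p) *
      (\<Sum>j<N. ennreal ((exp (real j) * \<tau>) powr - (s * p)) * emeasure lborel {x\<in>\<Omega>. infdist x E \<le> exp (real (Suc j)) * \<tau>})"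
    if \<Omega>: "open \<Omega>" and \<tau>: "\<tau> > 0" and N: "N \<ge> 1" for \<Omega> E :: "'a set" and \<tau> N
  proof -
    have \<Omega>_borel[measurable]: "\<Omega> \<in> sets borel" using \<Omega> by simp
    note [measurable] = square_borel[OF \<Omega>_borel]
    have infdist_meas[measurable]: "(\<lambda>x::'a. infdist x E) \<in> borel_measurable borel"
      by (intro borel_measurable_continuous_onI continuous_intros)
    define \<Psi> where "\<Psi> x = log_cutoff N \<tau> (infdist x E)" for x
    define m where "m x = max (infdist x E) \<tau>" for x
    have m_meas[measurable]: "m \<in> borel_measurable borel" unfolding m_def[abs_def] by measurable
    have m_pos: "m x > 0" for x using \<tau> by (simp add: m_def)
    let ?\<sigma> = "exp (real N) * \<tau>"
    let ?layer = "\<lambda>j. {x\<in>\<Omega>. infdist x E \<le> exp (real (Suc j)) * \<tau>}"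
    have layer[measurable]: "?layer j \<in> sets borel" for j by measurable
    define a where "a z = indicator {x. m x < ?\<sigma>} (fst z) * ennreal (real N powr - p *
      (ln (1 + norm (fst z - snd z) / m (fst z)) powr p / norm (fst z - snd z) powr ?q))" for z
    have a_meas[measurable]: "a \<in> borel_measurable borel"
      unfolding a_def[abs_def] borel_prod[symmetric] by measurable
    \<comment> \<open>The kernel \<open>a\<close> dominates the quotient when the first point is the closer one.\<close>
    have half: "ennreal (slobodeckij_quotient s p \<Psi> (x, y)) \<le> a (x, y)" if "m x \<le> m y" for x y
    proof (cases "m x < ?\<sigma>")
      case True
      have "\<bar>\<Psi> x - \<Psi> y\<bar> \<le> ln (1 + norm (x - y) / m x) / real N"
        using that \<tau> N infdist_triangle_abs[of y E x] unfolding \<Psi>_def m_def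
        by (intro log_cutoff_diff_le) (auto simp: dist_norm norm_minus_commute)
      then have "\<bar>\<Psi> x - \<Psi> y\<bar> powr p \<le> (ln (1 + norm (x - y) / m x) / real N) powr p"
        using p by (intro powr_mono2) auto
      also have "\<dots> = ln (1 + norm (x - y) / m x) powr p / real N powr p"
        by (rule powr_divide)
      also have "\<dots> = real N powr - p * ln (1 + norm (x - y) / m x) powr p"
        by (simp add: powr_minus divide_inverse mult.commute)
      finally have "slobodeckij_quotient s p \<Psi> (x, y) \<le>
          real N powr - p * (ln (1 + norm (x - y) / m x) powr p / norm (x - y) powr ?q)"
        unfolding slobodeckij_quotient_def by (simp add: divide_right_mono)
      then show ?thesis using True by (simp add: a_def ennreal_leI)
    next
      case False
      then have "?\<sigma> \<le> m x" "?\<sigma> \<le> m y" using that by auto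
      moreover have "?\<sigma> > \<tau>" using \<tau> N by simp
      ultimately have "?\<sigma> \<le> infdist x E" "?\<sigma> \<le> infdist y E" by (auto simp: m_def)
      then show ?thesis
        using log_cutoff_above[OF \<tau> N] by (simp add: slobodeckij_quotient_def \<Psi>_def)
    qed
    define a' where "a' z = a (snd z, fst z)" for z
    have a'_meas[measurable]: "a' \<in> borel_measurable borel"
    proof -
      have "(\<lambda>z::'a \<times> 'a. (snd z, fst z)) \<in> borel_measurable borel"
        by (intro borel_measurable_continuous_onI continuous_intros)
      then show ?thesis unfolding a'_def[abs_def] by measurable
    qed
    have pointwise: "ennreal (slobodeckij_quotient s p \<Psi> z) \<le> a z + a' z" for z
    proof -
      obtain x y where z: "z = (x, y)" by (cases z)
      have sym: "slobodeckij_quotient s p \<Psi> (x, y) = slobodeckij_quotient s p \<Psi> (y, x)"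
        by (simp add: slobodeckij_quotient_def abs_minus_commute norm_minus_commute)
      show ?thesis
        using half[of x y] half[of y x]
        by (cases "m x \<le> m y") (auto simp: z a'_def sym intro: add_increasing add_increasing2)
    qed
    define A where "A = (\<integral>\<^sup>+z. a z * indicator (\<Omega> \<times> \<Omega>) z \<partial>lborel)"
    have meas': "(\<lambda>z. a' z * indicator (\<Omega> \<times> \<Omega>) z) \<in> borel_measurable borel"
      by measurable
    have "(\<integral>\<^sup>+z. a' z * indicator (\<Omega> \<times> \<Omega>) z \<partial>lborel)
      = (\<integral>\<^sup>+y. \<integral>\<^sup>+x. a (y, x) * indicator (\<Omega> \<times> \<Omega>) (x, y) \<partial>lborel \<partial>lborel)"
      unfolding nn_integral_lborel_pair(2)[OF meas'] by (simp add: a'_def)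
    also have "\<dots> = (\<integral>\<^sup>+y. \<integral>\<^sup>+x. a (y, x) * indicator (\<Omega> \<times> \<Omega>) (y, x) \<partial>lborel \<partial>lborel)"
      by (intro nn_integral_cong) (auto simp: indicator_def)
    also have "\<dots> = A"
      unfolding A_def by (rule nn_integral_lborel_pair(1)[symmetric]) simp
    finally have A': "(\<integral>\<^sup>+z. a' z * indicator (\<Omega> \<times> \<Omega>) z \<partial>lborel) = A" .
    have "slobodeckij_energy s p \<Omega> \<Psi> \<le> (\<integral>\<^sup>+z. a z * indicator (\<Omega> \<times> \<Omega>) z + a' z * indicator (\<Omega> \<times> \<Omega>) z \<partial>lborel)"
      unfolding slobodeckij_energy_def
      by (intro nn_integral_mono) (use pointwise in \<open>auto simp: indicator_def\<close>)
    also have "\<dots> = A + A"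
      by (subst nn_integral_add) (simp_all add: A' A_def)
    finally have energy: "slobodeckij_energy s p \<Omega> \<Psi> \<le> A + A" .
    have sum_bound: "indicator {x. m x < ?\<sigma>} x * ennreal (m x powr - (s * p)) * indicator \<Omega> x
      \<le> (\<Sum>j<N. ennreal ((exp (real j) * \<tau>) powr - (s * p)) * indicator (?layer j) x)" for x
    proof (cases "m x < ?\<sigma> \<and> x \<in> \<Omega>")
      case True
      then obtain j where j: "j < N" "exp (real j) * \<tau> \<le> m x" "m x \<le> exp (real (Suc j)) * \<tau>"
        using ex_exp_interval[OF \<tau>, of "m x" N] by (auto simp: m_def)
      have "m x powr - (s * p) \<le> (exp (real j) * \<tau>) powr - (s * p)"
        using j(2) \<tau> s p by (intro powr_mono2') auto
      then have "indicator {x. m x < ?\<sigma>} x * ennreal (m x powr - (s * p)) * indicator \<Omega> x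
        \<le> (\<Sum>i\<in>{j}. ennreal ((exp (real i) * \<tau>) powr - (s * p)) * indicator (?layer i) x)"
        using True j(3) by (simp add: m_def ennreal_leI)
      also have "\<dots> \<le> (\<Sum>j<N. ennreal ((exp (real j) * \<tau>) powr - (s * p)) * indicator (?layer j) x)"
        using j(1) by (intro sum_mono2) auto
      finally show ?thesis .
    qed (auto simp: indicator_def)
    have "A = (\<integral>\<^sup>+x. \<integral>\<^sup>+y. a (x, y) * indicator (\<Omega> \<times> \<Omega>) (x, y) \<partial>lborel \<partial>lborel)"
      unfolding A_def by (rule nn_integral_lborel_pair(1)) simp
    also have "\<dots> \<le> (\<integral>\<^sup>+x. ennreal (real N powr - p * C) *
       (indicator {x. m x < ?\<sigma>} x * ennreal (m x powr - (s * p)) * indicator \<Omega> x) \<partial>lborel)"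
    proof (rule nn_integral_mono)
      fix x
      let ?k = "\<lambda>y. ennreal (ln (1 + norm (x - y) / m x) powr p / norm (x - y) powr ?q)"
      have "(\<integral>\<^sup>+y. a (x, y) * indicator (\<Omega> \<times> \<Omega>) (x, y) \<partial>lborel)
        \<le> (\<integral>\<^sup>+y. (indicator {x. m x < ?\<sigma>} x * indicator \<Omega> x * ennreal (real N powr - p)) * ?k y \<partial>lborel)"
        by (intro nn_integral_mono) (auto simp: a_def indicator_def simp flip: ennreal_mult')
      also have "\<dots> = (indicator {x. m x < ?\<sigma>} x * indicator \<Omega> x * ennreal (real N powr - p)) * (\<integral>\<^sup>+y. ?k y \<partial>lborel)"
        by (rule nn_integral_cmult) measurable
      also have "\<dots> \<le> (indicator {x. m x < ?\<sigma>} x * indicator \<Omega> x * ennreal (real N powr - p)) * ennreal (C * m x powr - (s * p))"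
        by (intro mult_left_mono C m_pos) auto
      also have "\<dots> = ennreal (real N powr - p * C) * (indicator {x. m x < ?\<sigma>} x * ennreal (m x powr - (s * p)) * indicator \<Omega> x)"
        using C(1) by (simp add: ennreal_mult' mult_ac)
      finally show "(\<integral>\<^sup>+y. a (x, y) * indicator (\<Omega> \<times> \<Omega>) (x, y) \<partial>lborel) \<le> \<dots>" .
    qed
    also have "\<dots> \<le> (\<integral>\<^sup>+x. ennreal (real N powr - p * C) *
       (\<Sum>j<N. ennreal ((exp (real j) * \<tau>) powr - (s * p)) * indicator (?layer j) x) \<partial>lborel)"
      by (intro nn_integral_mono mult_left_mono sum_bound) simp
    also have "\<dots> = ennreal (real N powr - p * C) *
       (\<Sum>j<N. ennreal ((exp (real j) * \<tau>) powr - (s * p)) * emeasure lborel (?layer j))"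
    proof -
      have meas: "(\<lambda>x. ennreal c * indicator (?layer j) x) \<in> borel_measurable lborel" for c j
        by (intro borel_measurable_times_ennreal borel_measurable_indicator) (simp_all add: layer)
      have "(\<integral>\<^sup>+x. (\<Sum>j<N. ennreal ((exp (real j) * \<tau>) powr - (s * p)) * indicator (?layer j) x) \<partial>lborel)
        = (\<Sum>j<N. \<integral>\<^sup>+x. ennreal ((exp (real j) * \<tau>) powr - (s * p)) * indicator (?layer j) x \<partial>lborel)"
        by (intro nn_integral_sum meas)
      also have "\<dots> = (\<Sum>j<N. ennreal ((exp (real j) * \<tau>) powr - (s * p)) * emeasure lborel (?layer j))"
        by (intro sum.cong refl nn_integral_cmult_indicator) (use layer in simp)
      finally have eq: "(\<integral>\<^sup>+x. (\<Sum>j<N. ennreal ((exp (real j) * \<tau>) powr - (s * p)) * indicator (?layer j) x) \<partial>lborel)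
        = (\<Sum>j<N. ennreal ((exp (real j) * \<tau>) powr - (s * p)) * emeasure lborel (?layer j))" .
      show ?thesis
        unfolding eq[symmetric] by (intro nn_integral_cmult borel_measurable_sum meas)
    qed
    finally have A_le: "A \<le> \<dots>" .
    have "slobodeckij_energy s p \<Omega> \<Psi> \<le> 2 * A"
      using energy by (simp add: mult_2)
    also have "\<dots> \<le> 2 * (ennreal (real N powr - p * C) *
       (\<Sum>j<N. ennreal ((exp (real j) * \<tau>) powr - (s * p)) * emeasure lborel (?layer j)))"
      by (intro mult_left_mono A_le) simp
    also have "2 * (ennreal (real N powr - p * C) * X) = ennreal (2 * C * real N powr - p) * X" for X
      using C(1) by (simp add: ennreal_mult' mult_ac)
    finally show ?thesis unfolding \<Psi>_def .
  qed
  show ?thesis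
    using C(1) main by (intro exI[of _ "2 * C"]) auto
qed

lemma frontier_nonempty:
  fixes \<Omega> :: "'a::euclidean_space set"
  assumes "bounded \<Omega>" "\<Omega> \<noteq> {}"
  shows "frontier \<Omega> \<noteq> {}"
  using assms frontier_eq_empty not_bounded_UNIV by blast

text \<open>A line through a point of \<open>\<Omega>\<close> meets the boundary on both sides of that point. Positivity of the
  diameter is what makes the range of radii in the definition of the codimensions nonempty.\<close>

lemma frontier_diameter_pos:
  fixes \<Omega> :: "'a::euclidean_space set"
  assumes \<Omega>: "open \<Omega>" "bounded \<Omega>" "\<Omega> \<noteq> {}"
  shows "diameter (frontier \<Omega>) > 0"
proof -
  obtain x where x: "x \<in> \<Omega>" using \<Omega> by blast
  obtain b :: 'a where b: "b \<in> Basis" using nonempty_Basis by blast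
  obtain B where B: "B > 0" "\<And>y. y \<in> \<Omega> \<Longrightarrow> norm y < B" using \<Omega>(2) by (meson bounded_pos_less)
  have ray: "\<exists>t\<in>{0<..}. x + (t * c) *\<^sub>R b \<in> frontier \<Omega>" if c: "\<bar>c\<bar> = 1" for c :: real
  proof -
    let ?S = "(\<lambda>t. x + (t * c) *\<^sub>R b) ` {0..2 * B}"
    have "connected ?S"
      by (intro connected_continuous_image continuous_intros) simp
    moreover have "?S \<inter> \<Omega> \<noteq> {}"
    proof -
      have "x \<in> ?S" by (rule image_eqI[of _ _ 0]) (use B in auto)
      then show ?thesis using x by blast
    qed
    moreover have "?S - \<Omega> \<noteq> {}"
    proof -
      have "norm ((2 * B * c) *\<^sub>R b) = 2 * B" using B b c by (simp add: abs_mult)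
      then have "2 * B \<le> norm (x + (2 * B * c) *\<^sub>R b) + norm x"
        using norm_triangle_ineq4[of "x + (2 * B * c) *\<^sub>R b" x] by simp
      then have "x + (2 * B * c) *\<^sub>R b \<notin> \<Omega>" using B(2)[of "x + (2 * B * c) *\<^sub>R b"] B(2)[OF x] by auto
      moreover have "x + (2 * B * c) *\<^sub>R b \<in> ?S" using B by (intro imageI) auto
      ultimately show ?thesis by blast
    qed
    ultimately have "?S \<inter> frontier \<Omega> \<noteq> {}" by (rule connected_Int_frontier)
    then obtain t where t: "t \<ge> 0" "x + (t * c) *\<^sub>R b \<in> frontier \<Omega>" by auto
    moreover have "t \<noteq> 0" using t x \<Omega>(1) by (auto simp: frontier_def interior_open)
    ultimately show ?thesis by (intro bexI[of _ t]) auto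
  qed
  obtain t u where tu: "t > 0" "u > 0" "x + (t * 1) *\<^sub>R b \<in> frontier \<Omega>" "x + (u * - 1) *\<^sub>R b \<in> frontier \<Omega>"
    using ray[of 1] ray[of "-1"] by auto
  have "bounded (frontier \<Omega>)" using \<Omega>(2) compact_frontier_bounded compact_imp_bounded by blast
  from diameter_bounded_bound[OF this tu(3,4)]
  have "norm ((t + u) *\<^sub>R b) \<le> diameter (frontier \<Omega>)" by (simp add: dist_norm algebra_simps)
  then show ?thesis using tu(1,2) b by simp
qed


text \<open>With collars of measure \<open>B * t powr q\<close> each of the \<open>N\<close> layers contributes at most a multiple of
  \<open>\<sigma> powr (q - s * p)\<close>, where \<open>\<sigma> = exp N * \<tau>\<close> is the outer radius. Together with the factor \<open>N powr - p\<close>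
  the energy is at most a multiple of \<open>N powr (1 - p) * \<sigma> powr (q - s * p)\<close>. This tends to zero if \<open>\<sigma>\<close> does
  and \<open>q > s * p\<close>, and also in the critical case \<open>q = s * p\<close> if \<open>p > 1\<close> and \<open>N\<close> tends to infinity.\<close>

proposition density_if_thin_collars:
  fixes \<Omega> :: "'a::euclidean_space set"
  assumes \<Omega>: "open \<Omega>" "bounded \<Omega>" "\<Omega> \<noteq> {}" and s: "0 < s" "s < 1" and p: "1 \<le> p"
    and t0: "t0 > 0" and B: "B \<ge> 0" and q: "s * p \<le> q" "1 < p \<or> s * p < q"
    and collar: "\<And>t. 0 < t \<Longrightarrow> t \<le> t0 \<Longrightarrow>
      emeasure lborel {x\<in>\<Omega>. infdist x (frontier \<Omega>) \<le> t} \<le> ennreal (B * t powr q)"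
  shows "frac_sobolev_0 s p \<Omega> = frac_sobolev s p \<Omega>"
proof -
  let ?E = "frontier \<Omega>"
  \<comment> \<open>The cutoff \<open>\<psi> n\<close> uses \<open>Suc n\<close> logarithmic scales and vanishes beyond distance \<open>t0 / Suc n\<close>.\<close>
  define \<tau> where "\<tau> n = t0 / real (Suc n) * exp (- real (Suc n))" for n
  define \<psi> where "\<psi> n x = log_cutoff (Suc n) (\<tau> n) (infdist x ?E)" for n x
  have \<tau>: "\<tau> n > 0" for n using t0 by (simp add: \<tau>_def)
  have \<sigma>: "exp (real (Suc n)) * \<tau> n = t0 / real (Suc n)" for n
    by (simp add: \<tau>_def exp_minus field_simps del: of_nat_Suc)
  obtain C where C: "C \<ge> 0" "\<And>(\<Omega>::'a set) E \<tau> N. open \<Omega> \<Longrightarrow> \<tau> > 0 \<Longrightarrow> N \<ge> 1 \<Longrightarrow>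
    slobodeckij_energy s p \<Omega> (\<lambda>x. log_cutoff N \<tau> (infdist x E)) \<le>
      ennreal (C * real N powr - p) *
      (\<Sum>j<N. ennreal ((exp (real j) * \<tau>) powr - (s * p)) * emeasure lborel {x\<in>\<Omega>. infdist x E \<le> exp (real (Suc j)) * \<tau>})"
    using log_cutoff_energy[OF s p, where 'a = 'a] by blast
  define a where "a = p - 1 + (q - s * p)"
  have a: "a > 0" using q p by (auto simp: a_def)
  define K where "K = C * (B * exp q * t0 powr (q - s * p))"
  have K: "K \<ge> 0" using C(1) B by (simp add: K_def)
  have bound: "slobodeckij_energy s p \<Omega> (\<psi> n) \<le> ennreal (K * real (Suc n) powr - a)" for n
  proof -
    let ?N = "real (Suc n)"
    have term_le: "ennreal ((exp (real j) * \<tau> n) powr - (s * p)) * emeasure lborel {x\<in>\<Omega>. infdist x ?E \<le> exp (real (Suc j)) * \<tau> n}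
      \<le> ennreal (B * exp q * (t0 / ?N) powr (q - s * p))" if j: "j < Suc n" for j
    proof -
      let ?v = "exp (real j) * \<tau> n"
      have v: "?v > 0" using \<tau> by simp
      have ev: "exp (real (Suc j)) * \<tau> n = exp 1 * ?v" by (simp add: exp_add)
      have "exp (real (Suc j)) * \<tau> n \<le> exp ?N * \<tau> n"
        using j \<tau>[of n] by (intro mult_right_mono) auto
      then have le: "exp (real (Suc j)) * \<tau> n \<le> t0 / ?N" using \<sigma>[of n] by simp
      also have "\<dots> \<le> t0" using t0 by (simp add: field_simps)
      finally have "emeasure lborel {x\<in>\<Omega>. infdist x ?E \<le> exp (real (Suc j)) * \<tau> n}
        \<le> ennreal (B * (exp (real (Suc j)) * \<tau> n) powr q)"
        using \<tau>[of n] by (intro collar) auto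
      then have "ennreal (?v powr - (s * p)) * emeasure lborel {x\<in>\<Omega>. infdist x ?E \<le> exp (real (Suc j)) * \<tau> n}
        \<le> ennreal (?v powr - (s * p)) * ennreal (B * (exp 1 * ?v) powr q)"
        unfolding ev by (intro mult_left_mono) auto
      also have "\<dots> = ennreal (?v powr - (s * p) * (B * (exp 1 * ?v) powr q))"
        by (simp add: ennreal_mult')
      also have "?v powr - (s * p) * (B * (exp 1 * ?v) powr q) = B * exp q * (?v powr - (s * p) * ?v powr q)"
      proof -
        have "(exp 1 * ?v) powr q = exp 1 powr q * ?v powr q" by (rule powr_mult)
        also have "exp 1 powr q = exp q" by (simp add: powr_def)
        finally show ?thesis by (simp add: mult_ac)
      qed
      also have "?v powr - (s * p) * ?v powr q = ?v powr (q - s * p)"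
        by (simp flip: powr_add)
      also have "B * exp q * ?v powr (q - s * p) \<le> B * exp q * (t0 / ?N) powr (q - s * p)"
      proof (intro mult_left_mono powr_mono2)
        have "?v \<le> exp (real (Suc j)) * \<tau> n" using \<tau>[of n] by (intro mult_right_mono) auto
        then show "?v \<le> t0 / ?N" using le by linarith
      qed (use q v B in auto)
      finally show ?thesis by (simp add: ennreal_leI)
    qed
    have "slobodeckij_energy s p \<Omega> (\<psi> n) \<le> ennreal (C * ?N powr - p) *
      (\<Sum>j<Suc n. ennreal ((exp (real j) * \<tau> n) powr - (s * p)) * emeasure lborel {x\<in>\<Omega>. infdist x ?E \<le> exp (real (Suc j)) * \<tau> n})"
      unfolding \<psi>_def[abs_def] by (rule C(2)[OF \<Omega>(1) \<tau>]) simp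
    also have "\<dots> \<le> ennreal (C * ?N powr - p) * (\<Sum>j<Suc n. ennreal (B * exp q * (t0 / ?N) powr (q - s * p)))"
      by (intro mult_left_mono sum_mono term_le) auto
    also have "\<dots> = ennreal (C * ?N powr - p) * ennreal (?N * (B * exp q * (t0 / ?N) powr (q - s * p)))"
      using B by (simp add: ennreal_mult' ennreal_of_nat_eq_real_of_nat del: of_nat_Suc sum.lessThan_Suc)
    also have "\<dots> = ennreal (C * ?N powr - p * (?N * (B * exp q * (t0 / ?N) powr (q - s * p))))"
      using C(1) by (simp add: ennreal_mult' del: of_nat_Suc)
    also have "C * ?N powr - p * (?N * (B * exp q * (t0 / ?N) powr (q - s * p))) = K * ?N powr - a"
    proof -
      have split: "(t0 / ?N) powr (q - s * p) = t0 powr (q - s * p) * ?N powr - (q - s * p)"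
        unfolding powr_divide powr_minus by (rule divide_inverse)
      have "C * ?N powr - p * (?N * (B * exp q * (t0 / ?N) powr (q - s * p)))
        = K * (?N powr - p * (?N powr 1 * ?N powr - (q - s * p)))"
        unfolding split K_def by (simp add: mult_ac del: of_nat_Suc)
      also have "?N powr - p * (?N powr 1 * ?N powr - (q - s * p)) = ?N powr (- p + (1 + - (q - s * p)))"
        by (simp only: powr_add)
      also have "- p + (1 + - (q - s * p)) = - a" by (simp add: a_def)
      finally show ?thesis .
    qed
    finally show ?thesis .
  qed
  show ?thesis
  proof (rule density_of_test_functions[OF \<Omega>(1,2) s(1) p])
    show "\<psi> n \<in> borel_measurable borel" for n
    proof -
      have "continuous_on UNIV (\<psi> n)"
        using \<tau>[of n] unfolding \<psi>_def log_cutoff_def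
        by (intro continuous_intros) (auto simp: max_def)
      then show ?thesis by (rule borel_measurable_continuous_onI)
    qed
    show "0 \<le> \<psi> n x" "\<psi> n x \<le> 1" for n x
      using \<tau>[of n] by (auto simp: \<psi>_def log_cutoff_nonneg log_cutoff_le_1)
    show "\<exists>r>0. \<forall>x. infdist x ?E < r \<longrightarrow> \<psi> n x = 1" for n
      using \<tau>[of n] by (intro exI[of _ "\<tau> n"]) (auto simp: \<psi>_def log_cutoff_below)
    show "(\<lambda>n. \<psi> n x) \<longlonglongrightarrow> 0" if x: "x \<in> \<Omega>" for x
    proof -
      have "x \<notin> ?E" using x \<Omega>(1) by (auto simp: frontier_def interior_open)
      then have pos: "infdist x ?E > 0"
        using frontier_nonempty[OF \<Omega>(2,3)] by (simp add: infdist_pos_not_in_closed)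
      have "(\<lambda>n. t0 / real (Suc n)) \<longlonglongrightarrow> 0"
        using LIMSEQ_Suc[OF lim_const_over_n[of t0]] by simp
      then have "\<forall>\<^sub>F n in sequentially. t0 / real (Suc n) < infdist x ?E"
        using pos by (rule order_tendstoD)
      then have "\<forall>\<^sub>F n in sequentially. \<psi> n x = 0"
      proof eventually_elim
        case (elim n)
        then show ?case
          using log_cutoff_above[OF \<tau>[of n], of "Suc n" "infdist x ?E"] \<sigma>[of n] by (simp add: \<psi>_def)
      qed
      then show ?thesis by (rule tendsto_eventually)
    qed
    have "(\<lambda>n. real (Suc n) powr - a) \<longlonglongrightarrow> 0"
      using a by (intro tendsto_neg_powr filterlim_compose[OF filterlim_real_sequentially filterlim_Suc]) simp
    then have "(\<lambda>n. ennreal (K * real (Suc n) powr - a)) \<longlonglongrightarrow> ennreal (K * 0)"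
      by (intro tendsto_ennrealI tendsto_mult tendsto_const)
    then have upper: "(\<lambda>n. ennreal (K * real (Suc n) powr - a)) \<longlonglongrightarrow> 0" by simp
    show "(\<lambda>n. slobodeckij_energy s p \<Omega> (\<psi> n)) \<longlonglongrightarrow> 0"
    proof (rule tendsto_sandwich[OF _ _ tendsto_const upper])
      show "\<forall>\<^sub>F n in sequentially. slobodeckij_energy s p \<Omega> (\<psi> n) \<le> ennreal (K * real (Suc n) powr - a)"
        by (rule always_eventually) (rule allI, rule bound)
    qed simp
  qed
qed

text \<open>The codimension bounds the collar in balls of a fixed radius, and finitely many of these cover
  the compact boundary.\<close>

lemma thin_collars_if_lower_assouad_codim:
  fixes \<Omega> :: "'a::euclidean_space set"
  assumes \<Omega>: "open \<Omega>" "bounded \<Omega>" "\<Omega> \<noteq> {}" and codim: "ereal \<sigma> < lower_assouad_codim (frontier \<Omega>)"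
  shows "\<exists>q>\<sigma>. \<exists>B\<ge>0. \<exists>t0>0. \<forall>t. 0 < t \<longrightarrow> t \<le> t0 \<longrightarrow>
    emeasure lborel {x\<in>\<Omega>. infdist x (frontier \<Omega>) \<le> t} \<le> ennreal (B * t powr q)"
proof -
  let ?E = "frontier \<Omega>"
  obtain q C where q: "\<sigma> < q" and C: "C \<ge> 1" "\<And>x r R. x \<in> ?E \<Longrightarrow> 0 < r \<Longrightarrow> r < R \<Longrightarrow> less_diameter R ?E \<Longrightarrow>
     measure lebesgue (closed_nbhd ?E r \<inter> ball x R) \<le> C * measure lebesgue (ball x R) * (r / R) powr q"
    using codim unfolding lower_assouad_codim_def less_Sup_iff by auto
  define R where "R = diameter ?E / 2"
  have R: "R > 0" "less_diameter R ?E"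
    using frontier_diameter_pos[OF \<Omega>] by (auto simp: R_def less_diameter_def)
  have E: "compact ?E" "?E \<noteq> {}" using \<Omega> compact_frontier_bounded frontier_nonempty by blast+
  obtain F where F: "finite F" "F \<subseteq> ?E" "?E \<subseteq> (\<Union>x\<in>F. ball x (R / 2))"
  proof (rule compactE_image[OF E(1), of ?E "\<lambda>x. ball x (R / 2)"])
    show "?E \<subseteq> (\<Union>x\<in>?E. ball x (R / 2))" using R(1) by force
  qed auto
  define \<omega> where "\<omega> = unit_ball_vol (real DIM('a)) * R ^ DIM('a)"
  have ball_meas: "measure lebesgue (ball x R) = \<omega>" for x :: 'a
    using R(1) by (simp add: content_ball \<omega>_def)
  define B where "B = real (card F) * (C * \<omega> * R powr - q)"
  have "B \<ge> 0" using C(1) R(1) by (simp add: B_def \<omega>_def)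
  moreover have "emeasure lborel {x\<in>\<Omega>. infdist x ?E \<le> t} \<le> ennreal (B * t powr q)" if t: "0 < t" "t \<le> R / 4" for t
  proof -
    let ?P = "\<lambda>x. closed_nbhd ?E t \<inter> ball x R"
    have nbhd: "closed (closed_nbhd ?E t)"
      unfolding closed_nbhd_def by (intro closed_Collect_le continuous_intros)
    have P_borel: "?P x \<in> sets borel" for x
      using borel_closed[OF nbhd] by auto
    have P_le: "emeasure lborel (?P x) \<le> ennreal (C * \<omega> * R powr - q * t powr q)" if "x \<in> F" for x
    proof -
      have "emeasure lborel (?P x) \<le> emeasure lborel (ball x R)"
        by (intro emeasure_mono) auto
      also have "\<dots> < \<infinity>" by (rule emeasure_lborel_ball_finite)
      finally have "emeasure lborel (?P x) = ennreal (measure lborel (?P x))"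
        by (intro emeasure_eq_ennreal_measure) auto
      also have "measure lborel (?P x) = measure lebesgue (?P x)"
        using P_borel by (simp add: measure_completion)
      also have "\<dots> \<le> C * measure lebesgue (ball x R) * (t / R) powr q"
      proof (rule C(2)[OF _ t(1) _ R(2)])
        show "x \<in> ?E" using that F(2) by blast
        show "t < R" using t R(1) by simp
      qed
      also have "\<dots> = C * \<omega> * R powr - q * t powr q"
      proof -
        have "(t / R) powr q = t powr q * R powr - q"
          unfolding powr_divide powr_minus by (rule divide_inverse)
        then show ?thesis unfolding ball_meas by (simp add: mult_ac)
      qed
      finally show ?thesis by (simp add: ennreal_leI)
    qed
    have "{x\<in>\<Omega>. infdist x ?E \<le> t} \<subseteq> (\<Union>x\<in>F. ?P x)"
    proof
      fix y assume y: "y \<in> {x\<in>\<Omega>. infdist x ?E \<le> t}"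
      obtain z where z: "z \<in> ?E" "infdist y ?E = dist y z"
        using infdist_attains_inf[OF frontier_closed E(2)] by blast
      then obtain x where x: "x \<in> F" "dist x z < R / 2" using F(3) by auto
      have "dist x y \<le> dist x z + dist y z" by (metis dist_commute dist_triangle)
      then have "dist x y < R" using x z y t R(1) by auto
      then show "y \<in> (\<Union>x\<in>F. ?P x)" using y x by (auto simp: closed_nbhd_def)
    qed
    then have "emeasure lborel {x\<in>\<Omega>. infdist x ?E \<le> t} \<le> emeasure lborel (\<Union>x\<in>F. ?P x)"
    proof (rule emeasure_mono)
      have "(\<Union>x\<in>F. ?P x) \<in> sets borel" using F(1) P_borel by (intro sets.finite_UN)
      then show "(\<Union>x\<in>F. ?P x) \<in> sets lborel" by (simp only: sets_lborel)
    qed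
    also have "\<dots> \<le> (\<Sum>x\<in>F. emeasure lborel (?P x))"
      using P_borel F(1) by (intro emeasure_subadditive_finite) (simp_all add: image_subset_iff)
    also have "\<dots> \<le> (\<Sum>x\<in>F. ennreal (C * \<omega> * R powr - q * t powr q))"
      by (intro sum_mono P_le)
    also have "\<dots> = ennreal (B * t powr q)"
      using C(1) R(1) by (simp add: B_def \<omega>_def ennreal_of_nat_eq_real_of_nat mult_ac flip: ennreal_mult')
    finally show ?thesis .
  qed
  ultimately show ?thesis
    using q R(1) by (intro exI[of _ q] conjI exI[of _ B] exI[of _ "R / 4"]) auto
qed

text \<open>One ball of radius \<open>D\<close>, written as \<open>(D / t) * t\<close>, already contains \<open>\<Omega>\<close>.\<close>

lemma thin_collars_if_homogeneous:
  fixes \<Omega> :: "'a::euclidean_space set"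
  assumes \<Omega>: "open \<Omega>" "bounded \<Omega>" "\<Omega> \<noteq> {}" and hom: "homogeneous_set (real DIM('a) - \<sigma>) (frontier \<Omega>)"
  shows "\<exists>B\<ge>0. \<forall>t. 0 < t \<longrightarrow> t \<le> 1 \<longrightarrow>
    emeasure lborel {x\<in>\<Omega>. infdist x (frontier \<Omega>) \<le> t} \<le> ennreal (B * t powr \<sigma>)"
proof -
  let ?E = "frontier \<Omega>" and ?d = "real DIM('a)"
  obtain L where L: "\<And>x t r. x \<in> ?E \<Longrightarrow> t \<ge> 1 \<Longrightarrow> r > 0 \<Longrightarrow>
      measure lebesgue {y. infdist y ?E \<le> r \<and> norm (x - y) \<le> t * r} \<le> L * r ^ DIM('a) * t powr (?d - \<sigma>)"
    using hom unfolding homogeneous_set_def by blast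
  obtain x where x: "x \<in> ?E" using frontier_nonempty[OF \<Omega>(2,3)] by blast
  have "bounded (insert x \<Omega>)" using \<Omega>(2) by simp
  then obtain D0 where D0: "\<And>y. y \<in> \<Omega> \<Longrightarrow> dist x y \<le> D0"
    by (auto simp: bounded_any_center[where a = x])
  define D where "D = max D0 1"
  have D: "D \<ge> 1" "\<And>y. y \<in> \<Omega> \<Longrightarrow> norm (x - y) \<le> D"
    using D0 by (auto simp: D_def dist_norm le_max_iff_disj)
  define B where "B = \<bar>L\<bar> * D powr (?d - \<sigma>)"
  have bound: "emeasure lborel {x\<in>\<Omega>. infdist x ?E \<le> t} \<le> ennreal (B * t powr \<sigma>)" if t: "0 < t" "t \<le> 1" for t
  proof -
    let ?A = "{y. infdist y ?E \<le> t \<and> norm (x - y) \<le> (D / t) * t}"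
    have "closed ({y. infdist y ?E \<le> t} \<inter> {y. norm (x - y) \<le> (D / t) * t})"
      by (intro closed_Int closed_Collect_le continuous_intros)
    then have A: "?A \<in> sets borel" by (simp add: borel_closed Collect_conj_eq)
    have "{x\<in>\<Omega>. infdist x ?E \<le> t} \<subseteq> ?A" using D(2) t by auto
    then have "emeasure lborel {x\<in>\<Omega>. infdist x ?E \<le> t} \<le> emeasure lborel ?A"
      using A by (intro emeasure_mono) auto
    also have "\<dots> = ennreal (measure lebesgue ?A)"
    proof -
      have "bounded ?A"
        by (rule bounded_subset[of "cball x ((D / t) * t)"]) (auto simp: dist_norm)
      then show ?thesis
        using A emeasure_bounded_finite[of ?A] by (simp add: emeasure_eq_ennreal_measure less_top measure_completion)
    qed
    also have "measure lebesgue ?A \<le> L * t ^ DIM('a) * (D / t) powr (?d - \<sigma>)"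
      using x t D(1) by (intro L) (auto simp: field_simps)
    also have "\<dots> = L * D powr (?d - \<sigma>) * (t powr ?d * t powr - (?d - \<sigma>))"
    proof -
      have "(D / t) powr (?d - \<sigma>) = D powr (?d - \<sigma>) * t powr - (?d - \<sigma>)"
        unfolding powr_divide powr_minus by (rule divide_inverse)
      then show ?thesis using t(1) by (simp add: powr_realpow)
    qed
    also have "t powr ?d * t powr - (?d - \<sigma>) = t powr \<sigma>"
      by (simp flip: powr_add)
    also have "L * D powr (?d - \<sigma>) * t powr \<sigma> \<le> B * t powr \<sigma>"
      unfolding B_def by (intro mult_right_mono) auto
    finally show ?thesis by (simp add: ennreal_leI)
  qed
  show ?thesis
  proof (intro exI[of _ B] conjI allI impI)
    show "B \<ge> 0" by (simp add: B_def)
  qed (rule bound)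
qed

section \<open>Averages over plump balls\<close>

definition set_average :: "'a::euclidean_space set \<Rightarrow> ('a \<Rightarrow> real) \<Rightarrow> real" where
  "set_average P u = (\<integral>y. indicator P y / measure lborel P * u y \<partial>lborel)"

lemma set_average_diff_const_le:
  fixes u :: "'a::euclidean_space \<Rightarrow> real"
  assumes P[measurable]: "P \<in> sets borel" and fin: "emeasure lborel P < \<infinity>" and pos: "measure lborel P > 0"
    and u[measurable]: "u \<in> borel_measurable borel" and K: "\<And>x. \<bar>u x\<bar> \<le> K" and p: "p \<ge> 1"
  shows "ennreal (\<bar>set_average P u - c\<bar> powr p)
    \<le> (\<integral>\<^sup>+y. ennreal (indicator P y / measure lborel P * \<bar>u y - c\<bar> powr p) \<partial>lborel)"
proof -
  let ?w = "\<lambda>y. indicator P y / measure lborel P :: real"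
  have w_int: "integrable lborel ?w"
    using fin by (intro integrable_divide integrable_real_indicator) auto
  have w_one: "(\<integral>y. ?w y \<partial>lborel) = 1"
    using pos fin by simp
  have wk: "integrable lborel (\<lambda>y. ?w y * k y)" if "k \<in> borel_measurable borel" "\<And>y. \<bar>k y\<bar> \<le> B" for k B
  proof (rule Bochner_Integration.integrable_bound[where f = "\<lambda>y. B * ?w y"])
    show "AE y in lborel. norm (?w y * k y) \<le> norm (B * ?w y)"
    proof (intro AE_I2)
      fix y
      have "\<bar>k y\<bar> \<le> \<bar>B\<bar>" using that(2)[of y] by simp
      then show "norm (?w y * k y) \<le> norm (B * ?w y)"
        using pos by (simp add: indicator_def abs_mult divide_right_mono)
    qed
    show "integrable lborel (\<lambda>y. B * ?w y)" using w_int by (rule integrable_mult_right)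
  qed (use that(1) in simp)
  have "set_average P u - c = (\<integral>y. ?w y * u y \<partial>lborel) - (\<integral>y. ?w y * c \<partial>lborel)"
  proof -
    have "(\<integral>y. ?w y * c \<partial>lborel) = (\<integral>y. ?w y \<partial>lborel) * c" by (rule integral_mult_left_zero)
    then show ?thesis unfolding w_one by (simp add: set_average_def)
  qed
  also have "\<dots> = (\<integral>y. ?w y * u y - ?w y * c \<partial>lborel)"
    by (intro Bochner_Integration.integral_diff[symmetric] wk[OF _ K] wk[of "\<lambda>_. c" "\<bar>c\<bar>"]) auto
  also have "\<dots> = (\<integral>y. ?w y * (u y - c) \<partial>lborel)"
    by (simp add: right_diff_distrib)
  finally have eq: "set_average P u - c = \<dots>" .
  have "\<bar>u y - c\<bar> \<le> K + \<bar>c\<bar>" for y using K[of y] by linarith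
  then have "integrable lborel (\<lambda>y. ?w y * (u y - c))"
    by (intro wk[of _ "K + \<bar>c\<bar>"]) auto
  then show ?thesis
    unfolding eq using w_int w_one pos p
    by (intro jensen_powr) simp_all
qed

text \<open>Two applications of Jensen's inequality bound the difference of two averages by the mean of
  \<open>\<bar>u y - u z\<bar> powr p\<close>, and the kernel of the energy is bounded below on a set of bounded diameter.\<close>

lemma set_average_diff_le_energy:
  fixes u :: "'a::euclidean_space \<Rightarrow> real"
  assumes P[measurable]: "P \<in> sets borel" "emeasure lborel P < \<infinity>" "measure lborel P > 0"
    and Q[measurable]: "Q \<in> sets borel" "emeasure lborel Q < \<infinity>" "measure lborel Q > 0"
    and S[measurable]: "S \<in> sets borel" and sub: "P \<subseteq> S" "Q \<subseteq> S"
    and M: "\<And>y z. y \<in> S \<Longrightarrow> z \<in> S \<Longrightarrow> norm (y - z) \<le> M"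
    and u[measurable]: "u \<in> borel_measurable borel" and K: "\<And>x. \<bar>u x\<bar> \<le> K" and p: "p \<ge> 1" and s: "s > 0"
  shows "ennreal (\<bar>set_average P u - set_average Q u\<bar> powr p)
    \<le> ennreal (M powr (real DIM('a) + s * p) / (measure lborel P * measure lborel Q)) * slobodeckij_energy s p S u"
proof -
  let ?q = "real DIM('a) + s * p"
  let ?c = "M powr ?q / (measure lborel P * measure lborel Q)"
  note [measurable] = square_borel[OF S]
  have "ennreal (\<bar>set_average P u - set_average Q u\<bar> powr p)
    \<le> (\<integral>\<^sup>+y. ennreal (indicator P y / measure lborel P * \<bar>u y - set_average Q u\<bar> powr p) \<partial>lborel)"
    by (rule set_average_diff_const_le[OF P u K p])
  also have "\<dots> \<le> (\<integral>\<^sup>+y. \<integral>\<^sup>+z. ennreal ?c * (ennreal (slobodeckij_quotient s p u (y, z)) * indicator (S \<times> S) (y, z)) \<partial>lborel \<partial>lborel)"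
  proof (rule nn_integral_mono)
    fix y
    have "ennreal (indicator P y / measure lborel P * \<bar>u y - set_average Q u\<bar> powr p)
      = ennreal (indicator P y / measure lborel P) * ennreal (\<bar>set_average Q u - u y\<bar> powr p)"
      by (subst ennreal_mult'[symmetric]) (use P(3) in \<open>simp_all add: abs_minus_commute\<close>)
    also have "\<dots> \<le> ennreal (indicator P y / measure lborel P) *
        (\<integral>\<^sup>+z. ennreal (indicator Q z / measure lborel Q * \<bar>u z - u y\<bar> powr p) \<partial>lborel)"
      by (intro mult_left_mono set_average_diff_const_le[OF Q u K p]) simp
    also have "\<dots> = (\<integral>\<^sup>+z. ennreal (indicator P y / measure lborel P) *
        ennreal (indicator Q z / measure lborel Q * \<bar>u z - u y\<bar> powr p) \<partial>lborel)"
      by (rule nn_integral_cmult[symmetric]) simp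
    also have "\<dots> \<le> (\<integral>\<^sup>+z. ennreal ?c * (ennreal (slobodeckij_quotient s p u (y, z)) * indicator (S \<times> S) (y, z)) \<partial>lborel)"
    proof (rule nn_integral_mono)
      fix z
      show "ennreal (indicator P y / measure lborel P) * ennreal (indicator Q z / measure lborel Q * \<bar>u z - u y\<bar> powr p)
        \<le> ennreal ?c * (ennreal (slobodeckij_quotient s p u (y, z)) * indicator (S \<times> S) (y, z))"
      proof (cases "y \<in> P \<and> z \<in> Q \<and> y \<noteq> z")
        case True
        then have yz: "norm (y - z) \<le> M" "norm (y - z) > 0" using M sub by auto
        have "\<bar>u z - u y\<bar> powr p = norm (y - z) powr ?q * slobodeckij_quotient s p u (y, z)"
          using yz by (simp add: slobodeckij_quotient_def abs_minus_commute)
        also have "\<dots> \<le> M powr ?q * slobodeckij_quotient s p u (y, z)"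
          using yz s p by (intro mult_right_mono powr_mono2) auto
        finally have "1 / measure lborel P * (1 / measure lborel Q * \<bar>u z - u y\<bar> powr p)
          \<le> 1 / measure lborel P * (1 / measure lborel Q * (M powr ?q * slobodeckij_quotient s p u (y, z)))"
          using P(3) Q(3) by (intro mult_left_mono) auto
        then have "1 / measure lborel P * (1 / measure lborel Q * \<bar>u z - u y\<bar> powr p) \<le> ?c * slobodeckij_quotient s p u (y, z)"
          by simp
        then have "ennreal (1 / measure lborel P * (1 / measure lborel Q * \<bar>u z - u y\<bar> powr p)) \<le> ennreal (?c * slobodeckij_quotient s p u (y, z))"
          by (rule ennreal_leI)
        then have "ennreal (1 / measure lborel P) * ennreal (1 / measure lborel Q * \<bar>u z - u y\<bar> powr p)
          \<le> ennreal ?c * ennreal (slobodeckij_quotient s p u (y, z))"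
          using P(3) Q(3) by (simp only: ennreal_mult' [symmetric] divide_nonneg_pos zero_le_one
              powr_ge_zero mult_nonneg_nonneg mult_pos_pos order.strict_implies_order)
        moreover have "y \<in> S" "z \<in> S" using True sub by auto
        ultimately show ?thesis using True by simp
      qed (auto simp: indicator_def)
    qed
    finally show "ennreal (indicator P y / measure lborel P * \<bar>u y - set_average Q u\<bar> powr p) \<le> \<dots>" .
  qed
  also have "\<dots> = (\<integral>\<^sup>+z. ennreal ?c * (ennreal (slobodeckij_quotient s p u z) * indicator (S \<times> S) z) \<partial>lborel)"
    by (rule nn_integral_lborel_pair(1)[symmetric]) measurable
  also have "\<dots> = ennreal ?c * slobodeckij_energy s p S u"
    unfolding slobodeckij_energy_def by (rule nn_integral_cmult) measurable
  finally show ?thesis .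
qed

lemma maximal_separated_subset:
  fixes A :: "'a::metric_space set"
  assumes A: "compact A" and r: "r > 0"
  shows "\<exists>F. finite F \<and> F \<subseteq> A \<and> (\<forall>x\<in>F. \<forall>y\<in>F. x \<noteq> y \<longrightarrow> r \<le> dist x y) \<and> (\<forall>a\<in>A. \<exists>y\<in>F. dist a y < r)"
proof -
  define sep where "sep F \<longleftrightarrow> finite F \<and> F \<subseteq> A \<and> (\<forall>x\<in>F. \<forall>y\<in>F. x \<noteq> y \<longrightarrow> r \<le> dist x y)" for F
  obtain D where D: "finite D" "A \<subseteq> (\<Union>x\<in>D. ball x (r / 2))"
  proof (rule compactE_image[OF A, of A "\<lambda>x. ball x (r / 2)"])
    show "A \<subseteq> (\<Union>x\<in>A. ball x (r / 2))" using r by force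
  qed auto
  have card_le: "card F \<le> card D" if F: "sep F" for F
  proof -
    have "\<forall>x\<in>F. \<exists>d\<in>D. dist d x < r / 2" using F D(2) by (fastforce simp: sep_def)
    then obtain c where c: "\<And>x. x \<in> F \<Longrightarrow> c x \<in> D" "\<And>x. x \<in> F \<Longrightarrow> dist (c x) x < r / 2" by metis
    have "inj_on c F"
    proof (rule inj_onI, rule ccontr)
      fix x y assume xy: "x \<in> F" "y \<in> F" "c x = c y" "x \<noteq> y"
      have "dist x y \<le> dist (c x) x + dist (c y) y"
        using xy(3) dist_triangle3[of x y "c x"] by simp
      then show False using c(2)[OF xy(1)] c(2)[OF xy(2)] F xy by (force simp: sep_def)
    qed
    then show ?thesis using c(1) D(1) by (intro card_inj_on_le) auto
  qed
  have "sep {}" by (simp add: sep_def)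
  moreover have "\<forall>G. sep G \<longrightarrow> card G < Suc (card D)" using card_le by (simp add: less_Suc_eq_le)
  ultimately have "\<exists>F. sep F \<and> (\<forall>G. sep G \<longrightarrow> card G \<le> card F)"
    by (rule ex_has_greatest_nat)
  then obtain F where F: "sep F" "\<And>G. sep G \<Longrightarrow> card G \<le> card F" by blast
  have "\<exists>y\<in>F. dist a y < r" if a: "a \<in> A" for a
  proof (rule ccontr)
    assume "\<not> ?thesis"
    then have far: "\<And>y. y \<in> F \<Longrightarrow> r \<le> dist a y" by force
    then have "a \<notin> F" using r by force
    moreover have "sep (insert a F)"
      using F(1) a far by (auto simp: sep_def dist_commute)
    ultimately show False using F(2)[of "insert a F"] F(1) by (simp add: sep_def)
  qed
  then show ?thesis using F(1) by (auto simp: sep_def)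
qed

text \<open>The volume bound for neighbourhoods forces a maximal separated subset of \<open>E\<close> inside a ball of
  radius \<open>R\<close> to have at least about \<open>l powr (q - d)\<close> points at scale \<open>l * R\<close>. Since \<open>q < \<sigma>\<close>, replacing \<open>q\<close> by the
  mean of \<open>q\<close> and \<open>\<sigma>\<close> absorbs the constants once \<open>l\<close> is small.\<close>

lemma many_disjoint_balls:
  fixes E :: "'a::euclidean_space set"
  assumes E: "compact E" and q: "q < \<sigma>" and c: "c > 0"
    and lower: "\<And>x r R. x \<in> E \<Longrightarrow> 0 < r \<Longrightarrow> r < R \<Longrightarrow> less_diameter R E \<Longrightarrow>
        measure lebesgue (closed_nbhd E r \<inter> ball x R) \<ge> c * measure lebesgue (ball x R) * (r / R) powr q"
  shows "\<exists>l>0. l \<le> 1 / 4 \<and> (\<forall>x\<in>E. \<forall>R>0. less_diameter R E \<longrightarrow>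
    (\<exists>F. finite F \<and> F \<subseteq> E \<and> (\<forall>y\<in>F. ball y (l * R) \<subseteq> ball x R) \<and>
      (\<forall>y\<in>F. \<forall>z\<in>F. y \<noteq> z \<longrightarrow> ball y (l * R) \<inter> ball z (l * R) = {}) \<and>
      1 \<le> real (card F) * l powr (real DIM('a) - (q + \<sigma>) / 2)))"
proof -
  let ?d = "real DIM('a)"
  define \<gamma> where "\<gamma> = (\<sigma> - q) / 2"
  have \<gamma>: "\<gamma> > 0" using q by (simp add: \<gamma>_def)
  define c' where "c' = c * 2 powr q / 6 ^ DIM('a)"
  have c': "c' > 0" using c by (simp add: c'_def)
  define l where "l = min (1 / 4) (c' powr (1 / \<gamma>))"
  have l: "l > 0" "l \<le> 1 / 4" using c' by (auto simp: l_def)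
  have "l powr \<gamma> \<le> (c' powr (1 / \<gamma>)) powr \<gamma>"
    using l \<gamma> by (intro powr_mono2) (auto simp: l_def)
  then have l_c': "l powr \<gamma> \<le> c'" using \<gamma> c' by (simp add: powr_powr)
  have "\<exists>F. finite F \<and> F \<subseteq> E \<and> (\<forall>y\<in>F. ball y (l * R) \<subseteq> ball x R) \<and>
      (\<forall>y\<in>F. \<forall>z\<in>F. y \<noteq> z \<longrightarrow> ball y (l * R) \<inter> ball z (l * R) = {}) \<and>
      1 \<le> real (card F) * l powr (?d - (q + \<sigma>) / 2)"
    if x: "x \<in> E" and R: "R > 0" "less_diameter R E" for x R
  proof -
    have lR: "l * R > 0" "l * R \<le> R / 4" using l R by auto
    \<comment> \<open>The radius \<open>3 * R / 4\<close> leaves room for neighbourhoods of width \<open>l * R \<le> R / 4\<close> on both sides.\<close>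
    let ?A = "E \<inter> cball x (3 * R / 4)"
    have "compact ?A" using E by (intro compact_Int_closed) auto
    then have "\<exists>F. finite F \<and> F \<subseteq> ?A \<and> (\<forall>y\<in>F. \<forall>z\<in>F. y \<noteq> z \<longrightarrow> 2 * (l * R) \<le> dist y z) \<and>
        (\<forall>a\<in>?A. \<exists>y\<in>F. dist a y < 2 * (l * R))"
      by (rule maximal_separated_subset) (use lR(1) in simp)
    then obtain F where F: "finite F" "F \<subseteq> ?A"
      and sep: "\<forall>y\<in>F. \<forall>z\<in>F. y \<noteq> z \<longrightarrow> 2 * (l * R) \<le> dist y z"
      and near: "\<forall>a\<in>?A. \<exists>y\<in>F. dist a y < 2 * (l * R)"
      by blast
    have inside: "ball y (l * R) \<subseteq> ball x R" if "y \<in> F" for y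
    proof
      fix z assume "z \<in> ball y (l * R)"
      then have "dist y z < l * R" by simp
      moreover have "dist x y \<le> 3 * R / 4" using that F(2) by auto
      ultimately have "dist x z < R" using lR R(1) dist_triangle[of x z y] by linarith
      then show "z \<in> ball x R" by simp
    qed
    have disjoint: "ball y (l * R) \<inter> ball z (l * R) = {}" if "y \<in> F" "z \<in> F" "y \<noteq> z" for y z
    proof -
      have "2 * (l * R) \<le> dist y z" using sep that by blast
      moreover have "dist y z \<le> dist y v + dist z v" for v by (rule dist_triangle2)
      ultimately have "\<not> (dist y v < l * R \<and> dist z v < l * R)" for v by (smt (verit))
      then show ?thesis by auto
    qed
    have half: "less_diameter (R / 2) E" using R by (auto simp: less_diameter_def)
    have "c * measure lebesgue (ball x (R / 2)) * ((l * R) / (R / 2)) powr q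
      \<le> measure lebesgue (closed_nbhd E (l * R) \<inter> ball x (R / 2))"
    proof (rule lower[OF x lR(1) _ half])
      show "l * R < R / 2" using lR R(1) by linarith
    qed
    also have "\<dots> \<le> measure lebesgue (\<Union>y\<in>F. ball y (3 * (l * R)))"
    proof (rule measure_mono_fmeasurable)
      show "closed_nbhd E (l * R) \<inter> ball x (R / 2) \<subseteq> (\<Union>y\<in>F. ball y (3 * (l * R)))"
      proof
        fix v assume v: "v \<in> closed_nbhd E (l * R) \<inter> ball x (R / 2)"
        obtain e where e: "e \<in> E" "infdist v E = dist v e"
          using infdist_attains_inf[of E v] compact_imp_closed[OF E] x by blast
        have "dist v e \<le> l * R" using v e by (simp add: closed_nbhd_def)
        moreover have "dist x e \<le> dist x v + dist v e" by (rule dist_triangle)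
        ultimately have "e \<in> E \<inter> cball x (3 * R / 4)" using e(1) v lR by auto
        then obtain y where y: "y \<in> F" "dist e y < 2 * (l * R)" using near by blast
        have "dist y v \<le> dist v e + dist e y" by (metis dist_commute dist_triangle)
        then have "dist y v < 3 * (l * R)" using \<open>dist v e \<le> l * R\<close> y(2) by linarith
        then show "v \<in> (\<Union>y\<in>F. ball y (3 * (l * R)))" using y(1) by auto
      qed
      have "closed (closed_nbhd E (l * R))"
        unfolding closed_nbhd_def by (intro closed_Collect_le continuous_intros)
      then show "closed_nbhd E (l * R) \<inter> ball x (R / 2) \<in> sets lebesgue" by auto
      show "(\<Union>y\<in>F. ball y (3 * (l * R))) \<in> lmeasurable"
        using F(1) by (intro fmeasurable.finite_UN) auto
    qed
    also have "\<dots> \<le> (\<Sum>y\<in>F. measure lebesgue (ball y (3 * (l * R))))"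
      using F(1) by (intro measure_UNION_le) auto
    also have "\<dots> = real (card F) * (unit_ball_vol ?d * (3 * (l * R)) ^ DIM('a))"
      using lR(1) by (simp add: content_ball)
    finally have "c * (unit_ball_vol ?d * (R / 2) ^ DIM('a)) * ((l * R) / (R / 2)) powr q
      \<le> real (card F) * (unit_ball_vol ?d * (3 * (l * R)) ^ DIM('a))"
      using R(1) by (simp add: content_ball)
    also have "(l * R) / (R / 2) = 2 * l" using R(1) by simp
    also have "(2 * l) powr q = 2 powr q * l powr q" by (rule powr_mult)
    also have "(R / 2) ^ DIM('a) = R ^ DIM('a) / 2 ^ DIM('a)" by (rule power_divide)
    also have "(3 * (l * R)) ^ DIM('a) = 3 ^ DIM('a) * l powr ?d * R ^ DIM('a)"
      using l(1) by (simp add: power_mult_distrib powr_realpow)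
    finally have "(unit_ball_vol ?d * R ^ DIM('a)) * (c * 2 powr q / 2 ^ DIM('a) * l powr q)
      \<le> (unit_ball_vol ?d * R ^ DIM('a)) * (real (card F) * 3 ^ DIM('a) * l powr ?d)"
      by (simp add: mult_ac)
    then have "c * 2 powr q / 2 ^ DIM('a) * l powr q \<le> real (card F) * 3 ^ DIM('a) * l powr ?d"
      using R(1) by (subst (asm) mult_le_cancel_left_pos) auto
    then have "c' * l powr q \<le> real (card F) * l powr ?d"
      by (simp add: c'_def field_simps flip: power_mult_distrib)
    then have "c' * l powr q * l powr (- q - \<gamma>) \<le> real (card F) * l powr ?d * l powr (- q - \<gamma>)"
      by (rule mult_right_mono) simp
    then have "c' * l powr (- \<gamma>) \<le> real (card F) * l powr (?d - q - \<gamma>)"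
      by (simp add: mult.assoc algebra_simps flip: powr_add)
    moreover have "1 \<le> c' * l powr (- \<gamma>)"
      using l_c' l(1) by (simp add: powr_minus field_simps)
    moreover have "?d - q - \<gamma> = ?d - (q + \<sigma>) / 2" by (simp add: \<gamma>_def field_simps)
    ultimately have "1 \<le> real (card F) * l powr (?d - (q + \<sigma>) / 2)" by simp
    then show ?thesis
      using F(1,2) inside disjoint by (intro exI[of _ F]) auto
  qed
  then show ?thesis using l by blast
qed

text \<open>Pigeonhole principle: the energies over disjoint balls add up to at most the total energy, so
  one of them is at most the average.\<close>

lemma energy_concentrates:
  fixes u :: "'a::euclidean_space \<Rightarrow> real"
  assumes u[measurable]: "u \<in> borel_measurable borel" and \<Omega>[measurable]: "\<Omega> \<in> sets borel"
    and F: "finite F" "\<And>y. y \<in> F \<Longrightarrow> ball y r \<subseteq> B"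
      "\<And>y z. y \<in> F \<Longrightarrow> z \<in> F \<Longrightarrow> y \<noteq> z \<Longrightarrow> ball y r \<inter> ball z r = {}"
    and card: "1 \<le> real (card F) * a"
  shows "\<exists>y\<in>F. slobodeckij_energy s p (\<Omega> \<inter> ball y r) u \<le> ennreal a * slobodeckij_energy s p (\<Omega> \<inter> B) u"
proof -
  let ?e = "\<lambda>A. slobodeckij_energy s p (\<Omega> \<inter> A) u"
  have "F \<noteq> {}" using card by auto
  then obtain y where y: "y \<in> F" "\<And>z. z \<in> F \<Longrightarrow> ?e (ball y r) \<le> ?e (ball z r)"
    using F(1) ex_min_if_finite[of "(\<lambda>y. ?e (ball y r)) ` F"] by (auto simp: not_less)
  have [measurable]: "(\<Omega> \<inter> ball z r) \<times> (\<Omega> \<inter> ball z r) \<in> sets borel" for z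
    by (intro square_borel) auto
  have "of_nat (card F) * ?e (ball y r) = (\<Sum>z\<in>F. ?e (ball y r))" by simp
  also have "\<dots> \<le> (\<Sum>z\<in>F. ?e (ball z r))" by (intro sum_mono y(2))
  also have "\<dots> = (\<integral>\<^sup>+x. (\<Sum>z\<in>F. ennreal (slobodeckij_quotient s p u x) *
      indicator ((\<Omega> \<inter> ball z r) \<times> (\<Omega> \<inter> ball z r)) x) \<partial>lborel)"
    unfolding slobodeckij_energy_def by (rule nn_integral_sum[symmetric]) measurable
  also have "\<dots> \<le> ?e B"
    unfolding slobodeckij_energy_def
  proof (rule nn_integral_mono)
    fix x
    let ?I = "\<lambda>z. (indicator ((\<Omega> \<inter> ball z r) \<times> (\<Omega> \<inter> ball z r)) x :: ennreal)"
    have "(\<Sum>z\<in>F. ?I z) \<le> indicator ((\<Omega> \<inter> B) \<times> (\<Omega> \<inter> B)) x"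
    proof (cases "\<exists>z\<in>F. x \<in> (\<Omega> \<inter> ball z r) \<times> (\<Omega> \<inter> ball z r)")
      case True
      then obtain z where z: "z \<in> F" "x \<in> (\<Omega> \<inter> ball z r) \<times> (\<Omega> \<inter> ball z r)" by blast
      have "?I v = 0" if "v \<in> F - {z}" for v
        using F(3)[of z v] z that by (fastforce simp: indicator_def)
      then have "(\<Sum>z\<in>F. ?I z) = ?I z"
        using sum.mono_neutral_right[OF F(1), of "{z}" ?I] z(1) by simp
      also have "\<dots> \<le> indicator ((\<Omega> \<inter> B) \<times> (\<Omega> \<inter> B)) x"
        using z F(2)[OF z(1)] by (fastforce simp: indicator_def)
      finally show ?thesis .
    next
      case False
      then have "(\<Sum>z\<in>F. ?I z) = 0" by (intro sum.neutral) (simp add: indicator_def)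
      then show ?thesis by simp
    qed
    then show "(\<Sum>z\<in>F. ennreal (slobodeckij_quotient s p u x) * ?I z)
      \<le> ennreal (slobodeckij_quotient s p u x) * indicator ((\<Omega> \<inter> B) \<times> (\<Omega> \<inter> B)) x"
      unfolding sum_distrib_left[symmetric] by (rule mult_left_mono) simp
  qed
  finally have sum_le: "of_nat (card F) * ?e (ball y r) \<le> ?e B" .
  have a: "a \<ge> 0"
  proof (rule ccontr)
    assume "\<not> a \<ge> 0"
    then have "real (card F) * a \<le> 0" by (intro mult_nonneg_nonpos) auto
    then show False using card by simp
  qed
  have "?e (ball y r) = 1 * ?e (ball y r)" by simp
  also have "\<dots> \<le> ennreal (real (card F) * a) * ?e (ball y r)"
    using card by (intro mult_right_mono) auto
  also have "\<dots> = ennreal a * (of_nat (card F) * ?e (ball y r))"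
    using a by (simp add: ennreal_mult' ennreal_of_nat_eq_real_of_nat mult_ac)
  also have "\<dots> \<le> ennreal a * ?e B"
    by (intro mult_left_mono sum_le) simp
  finally show ?thesis using y(1) by blast
qed


lemma set_average_eq_0:
  assumes "\<And>y. y \<in> P \<Longrightarrow> u y = 0"
  shows "set_average P u = 0"
proof -
  have "(\<lambda>y. indicator P y / measure lborel P * u y) = (\<lambda>_. 0)"
    using assms by (auto simp: indicator_def)
  then show ?thesis by (simp only: set_average_def Bochner_Integration.integral_zero)
qed

lemma telescoping_geometric_bound:
  fixes a :: "nat \<Rightarrow> real"
  assumes step: "\<And>n. \<bar>a n - a (Suc n)\<bar> \<le> D * \<theta> ^ n" and \<theta>: "0 \<le> \<theta>" "\<theta> < 1"
    and zero: "a N = 0"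
  shows "\<bar>a 0\<bar> \<le> D / (1 - \<theta>)"
proof -
  have D: "D \<ge> 0" using step[of 0] by (simp add: order_trans[OF abs_ge_zero])
  have "\<bar>a 0 - a n\<bar> \<le> D * (\<Sum>k<n. \<theta> ^ k)" for n
  proof (induction n)
    case (Suc n)
    have "\<bar>a 0 - a (Suc n)\<bar> \<le> \<bar>a 0 - a n\<bar> + \<bar>a n - a (Suc n)\<bar>" by simp
    also have "\<dots> \<le> D * (\<Sum>k<n. \<theta> ^ k) + D * \<theta> ^ n" by (intro add_mono Suc step)
    finally show ?case by (simp add: distrib_left)
  qed simp
  from this[of N] zero have "\<bar>a 0\<bar> \<le> D * (\<Sum>k<N. \<theta> ^ k)" by simp
  also have "\<dots> \<le> D * (1 / (1 - \<theta>))"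
  proof (rule mult_left_mono[OF _ D])
    have "(\<Sum>k<N. \<theta> ^ k) = (1 - \<theta> ^ N) / (1 - \<theta>)" using \<theta> by (simp add: sum_gp_strict)
    also have "\<dots> \<le> 1 / (1 - \<theta>)" using \<theta> by (intro divide_right_mono) auto
    finally show "(\<Sum>k<N. \<theta> ^ k) \<le> 1 / (1 - \<theta>)" .
  qed
  finally show ?thesis by simp
qed

lemma test_function_continuous:
  assumes "u \<in> test_functions \<Omega>"
  shows "continuous_on UNIV u"
proof -
  have "Ck 0 u" using assms unfolding test_functions_def mem_Collect_eq by (elim conjE allE)
  then show ?thesis by simp
qed

lemma test_function_bounded:
  fixes u :: "'a::euclidean_space \<Rightarrow> real"
  assumes u: "u \<in> test_functions \<Omega>"
  shows "\<exists>K. \<forall>x. \<bar>u x\<bar> \<le> K"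
proof -
  let ?supp = "closure {x. u x \<noteq> 0}"
  have "compact ?supp" using u unfolding test_functions_def mem_Collect_eq by (elim conjE)
  then have "bounded ?supp" by (rule compact_imp_bounded)
  then have "\<exists>r. \<forall>x\<in>?supp. norm x \<le> r" by (rule bounded_iff[THEN iffD1])
  then obtain r where r: "\<forall>x\<in>?supp. norm x \<le> r" ..
  have outside: "u x = 0" if "norm x > r" for x
  proof (rule ccontr)
    assume "u x \<noteq> 0"
    then have "x \<in> ?supp" by (intro subsetD[OF closure_subset]) simp
    then have "norm x \<le> r" by (rule bspec[OF r])
    then show False using that by simp
  qed
  show ?thesis
  proof (rule bounded_if_bounded_support[OF test_function_continuous[OF u], of r])
    show "u x = 0" if "norm x > r" for x by (rule outside[OF that])
  next
    fix B assume "\<And>x. \<bar>u x\<bar> \<le> B"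
    then show ?thesis by blast
  qed
qed

text \<open>Starting from \<open>x0\<close>, the pigeonhole principle selects nested balls of radii \<open>\<rho> n = l ^ n * R\<close>, centred
  on the boundary, whose energies decay like \<open>l powr (t * n)\<close> with \<open>t > d - s * p\<close>. Each contains a ball
  inside \<open>\<Omega>\<close> of comparable size, because \<open>\<Omega>\<close> is plump. The averages of \<open>u\<close> over consecutive such balls differ by
  at most a constant times \<open>(\<rho> n powr (s * p - d) * l powr (t * n) * \<eta>) powr (1 / p)\<close>, which is summable in \<open>n\<close>.
  Since \<open>u\<close> vanishes near the boundary, the averages are eventually zero, and telescoping bounds
  the first one.\<close>

proposition average_controlled_by_energy:
  fixes \<Omega> :: "'a::euclidean_space set"
  assumes \<Omega>: "open \<Omega>" "bounded \<Omega>" and \<kappa>: "0 < \<kappa>" "\<kappa> < 1" "plump \<kappa> \<Omega>"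
    and x0: "x0 \<in> frontier \<Omega>" and R: "0 < R" "R < diameter (frontier \<Omega>)"
    and s: "0 < s" and p: "1 \<le> p" and q: "q < s * p" and c: "c > 0"
    and lower: "\<And>x r R. x \<in> frontier \<Omega> \<Longrightarrow> 0 < r \<Longrightarrow> r < R \<Longrightarrow> less_diameter R (frontier \<Omega>) \<Longrightarrow>
        measure lebesgue (closed_nbhd (frontier \<Omega>) r \<inter> ball x R) \<ge> c * measure lebesgue (ball x R) * (r / R) powr q"
  shows "\<exists>P D. P \<in> sets borel \<and> P \<subseteq> \<Omega> \<and> emeasure lborel P < \<infinity> \<and> measure lborel P > 0 \<and> D \<ge> 0 \<and>
    (\<forall>u\<in>test_functions \<Omega>. \<forall>\<eta>\<ge>0. slobodeckij_energy s p \<Omega> u \<le> ennreal \<eta> \<longrightarrow> \<bar>set_average P u\<bar> \<le> D * \<eta> powr (1 / p))"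
proof -
  let ?E = "frontier \<Omega>" and ?d = "real DIM('a)"
  have E: "compact ?E" using \<Omega>(2) by (rule compact_frontier_bounded)
  then have E_bounded: "bounded ?E" by (rule compact_imp_bounded)
  define t where "t = ?d - (q + s * p) / 2"
  define \<gamma> where "\<gamma> = (s * p - q) / 2"
  have \<gamma>: "\<gamma> > 0" using q by (simp add: \<gamma>_def)
  have "\<exists>l>0. l \<le> 1 / 4 \<and> (\<forall>x\<in>?E. \<forall>R>0. less_diameter R ?E \<longrightarrow>
    (\<exists>F. finite F \<and> F \<subseteq> ?E \<and> (\<forall>y\<in>F. ball y (l * R) \<subseteq> ball x R) \<and>
      (\<forall>y\<in>F. \<forall>z\<in>F. y \<noteq> z \<longrightarrow> ball y (l * R) \<inter> ball z (l * R) = {}) \<and>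
      1 \<le> real (card F) * l powr t))"
    unfolding t_def by (rule many_disjoint_balls[OF E q c]) (rule lower)
  then obtain l where l: "0 < l" "l \<le> 1 / 4" and packing: "\<forall>x\<in>?E. \<forall>R>0. less_diameter R ?E \<longrightarrow>
    (\<exists>F. finite F \<and> F \<subseteq> ?E \<and> (\<forall>y\<in>F. ball y (l * R) \<subseteq> ball x R) \<and>
      (\<forall>y\<in>F. \<forall>z\<in>F. y \<noteq> z \<longrightarrow> ball y (l * R) \<inter> ball z (l * R) = {}) \<and>
      1 \<le> real (card F) * l powr t)" by blast
  define \<rho> where "\<rho> n = l ^ n * R" for n :: nat
  have \<rho>: "\<rho> n > 0" "\<rho> n \<le> R" "\<rho> (Suc n) = l * \<rho> n" for n
    using l R(1) power_le_one[of l n] by (auto simp: \<rho>_def mult_left_le_one_le)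
  have \<rho>_diam: "less_diameter (\<rho> n) ?E" for n
    using \<rho>(2)[of n] R(2) by (simp add: less_diameter_def)
  have "\<exists>z. dist x z \<le> \<rho> n / 2 \<and> ball z (\<kappa> * (\<rho> n / 2)) \<subseteq> \<Omega>" if x: "x \<in> ?E" for x n
  proof -
    have "diameter ?E \<le> diameter (closure \<Omega>)"
      using \<Omega>(2) by (intro diameter_subset) (auto simp: frontier_def)
    then have "\<rho> n / 2 < diameter \<Omega>"
      using \<rho>(1,2)[of n] R(2) \<Omega>(2) by (simp add: diameter_closure)
    then have "less_diameter (\<rho> n / 2) \<Omega>" by (simp add: less_diameter_def)
    moreover have "x \<in> closure \<Omega>" using x by (simp add: frontier_def)
    ultimately show ?thesis
      using \<kappa>(3) \<rho>(1)[of n] unfolding plump_def by (metis half_gt_zero mem_cball)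
  qed
  then obtain \<zeta> where \<zeta>: "\<And>x n. x \<in> ?E \<Longrightarrow> dist x (\<zeta> x n) \<le> \<rho> n / 2"
    "\<And>x n. x \<in> ?E \<Longrightarrow> ball (\<zeta> x n) (\<kappa> * (\<rho> n / 2)) \<subseteq> \<Omega>" by metis
  define P where "P x n = ball (\<zeta> x n) (\<kappa> * (\<rho> n / 2))" for x n
  have P_borel: "P x n \<in> sets borel" for x n by (simp add: P_def)
  have P_fin: "emeasure lborel (P x n) < \<infinity>" for x n
    unfolding P_def by (rule emeasure_lborel_ball_finite)
  have P_meas: "measure lborel (P x n) = unit_ball_vol ?d * (\<kappa> * (\<rho> n / 2)) ^ DIM('a)" for x n
    using \<kappa>(1) \<rho>(1)[of n] by (simp add: P_def content_ball)
  have P_pos: "measure lborel (P x n) > 0" for x n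
    using \<kappa>(1) \<rho>(1)[of n] by (simp add: P_meas)
  have P_sub: "P x n \<subseteq> \<Omega> \<inter> ball x (\<rho> n)" if x: "x \<in> ?E" for x n
  proof
    fix y assume y: "y \<in> P x n"
    have "\<kappa> * (\<rho> n / 2) < \<rho> n / 2" using \<kappa> \<rho>(1)[of n] by simp
    moreover have "dist (\<zeta> x n) y < \<kappa> * (\<rho> n / 2)" using y by (simp add: P_def)
    ultimately have "dist x y < \<rho> n"
      using \<zeta>(1)[OF x, of n] dist_triangle[of x y "\<zeta> x n"] by linarith
    moreover have "y \<in> \<Omega>" using \<zeta>(2)[OF x, of n] y unfolding P_def by blast
    ultimately show "y \<in> \<Omega> \<inter> ball x (\<rho> n)" by simp
  qed
  define A where "A = 2 powr (?d + s * p) / ((unit_ball_vol ?d)\<^sup>2 * (\<kappa> / 2) ^ DIM('a) * (\<kappa> / 2) ^ DIM('a) * l ^ DIM('a))"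
  have A: "A \<ge> 0" using l \<kappa>(1) by (simp add: A_def)
  define \<theta> where "\<theta> = l powr (\<gamma> / p)"
  have \<theta>: "0 \<le> \<theta>" "\<theta> < 1"
    using l \<gamma> p powr_less_mono2[of "\<gamma> / p" l 1] by (auto simp: \<theta>_def)
  define D where "D = (A * R powr (s * p - ?d)) powr (1 / p) / (1 - \<theta>)"
  have D: "D \<ge> 0" using \<theta> by (simp add: D_def)
  have coeff: "(2 * \<rho> n) powr (?d + s * p) / (measure lborel (P x n) * measure lborel (P y (Suc n))) * l powr (t * n)
    = A * R powr (s * p - ?d) * (l powr \<gamma>) ^ n" for x y n
  proof -
    have "measure lborel (P x n) * measure lborel (P y (Suc n))
      = (unit_ball_vol ?d)\<^sup>2 * (\<kappa> / 2) ^ DIM('a) * (\<kappa> / 2) ^ DIM('a) * l ^ DIM('a) * (\<rho> n powr ?d * \<rho> n powr ?d)"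
      using \<rho>(1)[of n] by (simp add: P_meas \<rho>(3) power_mult_distrib power_divide powr_realpow power2_eq_square)
    then have "(2 * \<rho> n) powr (?d + s * p) / (measure lborel (P x n) * measure lborel (P y (Suc n)))
      = A * (\<rho> n powr (?d + s * p) / (\<rho> n powr ?d * \<rho> n powr ?d))"
      by (simp add: A_def powr_mult)
    also have "\<rho> n powr (?d + s * p) / (\<rho> n powr ?d * \<rho> n powr ?d) = \<rho> n powr (s * p - ?d)"
      using \<rho>(1)[of n] by (simp add: powr_add powr_diff)
    also have "\<rho> n = l powr n * R" using l by (simp add: \<rho>_def powr_realpow)
    also have "(l powr n * R) powr (s * p - ?d) = R powr (s * p - ?d) * l powr (n * (s * p - ?d))"
      by (simp add: powr_mult powr_powr)
    finally have "(2 * \<rho> n) powr (?d + s * p) / (measure lborel (P x n) * measure lborel (P y (Suc n))) * l powr (t * n)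
      = A * R powr (s * p - ?d) * (l powr (n * (s * p - ?d)) * l powr (t * n))"
      using l by (simp add: \<rho>_def powr_realpow)
    also have "l powr (n * (s * p - ?d)) * l powr (t * n) = l powr (\<gamma> * n)"
      by (simp add: t_def \<gamma>_def field_simps flip: powr_add)
    also have "\<dots> = (l powr \<gamma>) ^ n"
      using l by (simp add: powr_powr flip: powr_realpow)
    finally show ?thesis .
  qed
  have main: "\<bar>set_average (P x0 0) u\<bar> \<le> D * \<eta> powr (1 / p)"
    if u: "u \<in> test_functions \<Omega>" and \<eta>: "\<eta> \<ge> 0" and energy: "slobodeckij_energy s p \<Omega> u \<le> ennreal \<eta>" for u \<eta>
  proof -
    let ?supp = "closure {x. u x \<noteq> 0}"
    have supp: "compact ?supp" "?supp \<subseteq> \<Omega>" using u unfolding test_functions_def by blast+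
    have u_meas[measurable]: "u \<in> borel_measurable borel"
      by (rule borel_measurable_continuous_onI[OF test_function_continuous[OF u]])
    have zero: "u x = 0" if "x \<notin> ?supp" for x using that closure_subset[of "{x. u x \<noteq> 0}"] by auto
    obtain K where K: "\<And>x. \<bar>u x\<bar> \<le> K" using test_function_bounded[OF u] by blast
    have \<Omega>_borel[measurable]: "\<Omega> \<in> sets borel" using \<Omega>(1) by simp
    let ?e = "\<lambda>x n. slobodeckij_energy s p (\<Omega> \<inter> ball x (\<rho> n)) u"
    \<comment> \<open>The sequence of centres of the nested balls.\<close>
    have "\<exists>f. \<forall>n. (f n \<in> ?E \<and> ?e (f n) n \<le> ennreal (l powr (t * n) * \<eta>) \<and> (n = 0 \<longrightarrow> f n = x0)) \<and>
       ball (f (Suc n)) (\<rho> (Suc n)) \<subseteq> ball (f n) (\<rho> n)"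
    proof (rule dependent_nat_choice)
      have "?e x0 0 \<le> slobodeckij_energy s p \<Omega> u"
        unfolding slobodeckij_energy_def by (intro nn_integral_mono) (auto simp: indicator_def)
      also have "\<dots> \<le> ennreal (l powr (t * real 0) * \<eta>)"
        using energy l(1) by simp
      finally show "\<exists>x. x \<in> ?E \<and> ?e x 0 \<le> ennreal (l powr (t * real 0) * \<eta>) \<and> (0 = (0::nat) \<longrightarrow> x = x0)"
        using x0 by blast
    next
      fix x n
      assume x: "x \<in> ?E \<and> ?e x n \<le> ennreal (l powr (t * real n) * \<eta>) \<and> (n = 0 \<longrightarrow> x = x0)"
      then have xE: "x \<in> ?E" by blast
      obtain F where F: "finite F" "F \<subseteq> ?E" "\<forall>y\<in>F. ball y (l * \<rho> n) \<subseteq> ball x (\<rho> n)"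
        "\<forall>y\<in>F. \<forall>z\<in>F. y \<noteq> z \<longrightarrow> ball y (l * \<rho> n) \<inter> ball z (l * \<rho> n) = {}" "1 \<le> real (card F) * l powr t"
        using packing[rule_format, OF xE \<rho>(1)[of n] \<rho>_diam[of n]] by (elim exE conjE) (rule that)
      have "\<exists>y\<in>F. slobodeckij_energy s p (\<Omega> \<inter> ball y (l * \<rho> n)) u \<le> ennreal (l powr t) * ?e x n"
        by (rule energy_concentrates[OF u_meas \<Omega>_borel F(1) _ _ F(5)]) (use F(3,4) in blast)+
      then obtain y where y: "y \<in> F" "?e y (Suc n) \<le> ennreal (l powr t) * ?e x n"
        unfolding \<rho>(3) by blast
      note y(2)
      also have "ennreal (l powr t) * ?e x n \<le> ennreal (l powr t) * ennreal (l powr (t * real n) * \<eta>)"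
        using x by (intro mult_left_mono) auto
      also have "\<dots> = ennreal (l powr (t * real (Suc n)) * \<eta>)"
        by (simp add: ennreal_mult'[symmetric] distrib_left powr_add mult_ac)
      finally show "\<exists>y. (y \<in> ?E \<and> ?e y (Suc n) \<le> ennreal (l powr (t * real (Suc n)) * \<eta>) \<and> (Suc n = 0 \<longrightarrow> y = x0)) \<and>
          ball y (\<rho> (Suc n)) \<subseteq> ball x (\<rho> n)"
        using y(1) F(2,3) unfolding \<rho>(3) by (intro exI[of _ y]) auto
    qed
    then obtain f where f: "\<And>n. f n \<in> ?E" "\<And>n. ?e (f n) n \<le> ennreal (l powr (t * n) * \<eta>)" "f 0 = x0"
      "\<And>n. ball (f (Suc n)) (\<rho> (Suc n)) \<subseteq> ball (f n) (\<rho> n)"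
      by blast
    define a where "a n = set_average (P (f n) n) u" for n
    have step: "\<bar>a n - a (Suc n)\<bar> \<le> (A * R powr (s * p - ?d) * \<eta>) powr (1 / p) * \<theta> ^ n" for n
    proof -
      let ?c = "(2 * \<rho> n) powr (?d + s * p) / (measure lborel (P (f n) n) * measure lborel (P (f (Suc n)) (Suc n)))"
      have "ennreal (\<bar>a n - a (Suc n)\<bar> powr p) \<le> ennreal ?c * ?e (f n) n"
        unfolding a_def
      proof (rule set_average_diff_le_energy[OF P_borel P_fin P_pos P_borel P_fin P_pos _ _ _ _ u_meas K p s])
        show "norm (y - z) \<le> 2 * \<rho> n" if "y \<in> \<Omega> \<inter> ball (f n) (\<rho> n)" "z \<in> \<Omega> \<inter> ball (f n) (\<rho> n)" for y z
        proof -
          have "dist y z \<le> dist (f n) y + dist (f n) z" by (rule dist_triangle3)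
          then show ?thesis using that by (simp add: dist_norm)
        qed
        show "P (f (Suc n)) (Suc n) \<subseteq> \<Omega> \<inter> ball (f n) (\<rho> n)"
          using P_sub[OF f(1), of "Suc n" "Suc n"] f(4)[of n] by blast
      qed (use P_sub[OF f(1)] in simp_all)
      also have "\<dots> \<le> ennreal ?c * ennreal (l powr (t * n) * \<eta>)"
        by (intro mult_left_mono f(2)) simp
      also have "\<dots> = ennreal (?c * l powr (t * n) * \<eta>)"
        using P_pos \<eta> by (simp add: ennreal_mult'[symmetric] mult_ac)
      also have "?c * l powr (t * n) * \<eta> = A * R powr (s * p - ?d) * \<eta> * (l powr \<gamma>) ^ n"
        unfolding coeff by (simp add: mult_ac)
      finally have "\<bar>a n - a (Suc n)\<bar> powr p \<le> A * R powr (s * p - ?d) * \<eta> * (l powr \<gamma>) ^ n"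
        using A \<eta> by simp
      then have "(\<bar>a n - a (Suc n)\<bar> powr p) powr (1 / p) \<le> (A * R powr (s * p - ?d) * \<eta> * (l powr \<gamma>) ^ n) powr (1 / p)"
        using p by (intro powr_mono2) auto
      also have "\<dots> = (A * R powr (s * p - ?d) * \<eta>) powr (1 / p) * ((l powr \<gamma>) ^ n) powr (1 / p)"
        by (rule powr_mult)
      also have "((l powr \<gamma>) ^ n) powr (1 / p) = \<theta> ^ n"
        using l by (simp add: \<theta>_def powr_powr mult_ac flip: powr_realpow)
      finally show ?thesis using p by (simp add: powr_powr)
    qed
    have "\<exists>N. a N = 0"
    proof -
      have "?supp \<inter> ?E = {}" using supp(2) \<Omega>(1) by (auto simp: frontier_def interior_open)
      then have "\<exists>e>0. \<forall>x\<in>?supp. \<forall>y\<in>?E. e \<le> dist x y"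
        by (rule separate_compact_closed[OF supp(1) frontier_closed])
      then obtain e where e: "e > 0" "\<forall>x\<in>?supp. \<forall>y\<in>?E. e \<le> dist x y"
        by (elim exE conjE) (rule that)
      have "(\<lambda>n. l ^ n * R) \<longlonglongrightarrow> 0 * R"
        using l by (intro tendsto_mult LIMSEQ_realpow_zero tendsto_const) auto
      then have "\<forall>\<^sub>F n in sequentially. l ^ n * R < e" using e(1) by (intro order_tendstoD) auto
      then obtain N where N: "\<rho> N < e" by (auto simp: eventually_sequentially \<rho>_def)
      have "u y = 0" if "y \<in> P (f N) N" for y
      proof (rule zero)
        show "y \<notin> ?supp"
        proof
          assume "y \<in> ?supp"
          then have "e \<le> dist y (f N)" by (rule e(2)[rule_format]) (rule f(1))
          moreover have "dist (f N) y < \<rho> N" using P_sub[OF f(1), of N N] that by auto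
          ultimately show False using N by (simp add: dist_commute)
        qed
      qed
      then show ?thesis unfolding a_def by (intro exI[of _ N] set_average_eq_0)
    qed
    then obtain N where "a N = 0" ..
    from telescoping_geometric_bound[OF step \<theta> this]
    have "\<bar>a 0\<bar> \<le> (A * R powr (s * p - ?d) * \<eta>) powr (1 / p) / (1 - \<theta>)" .
    also have "(A * R powr (s * p - ?d) * \<eta>) powr (1 / p) = (A * R powr (s * p - ?d)) powr (1 / p) * \<eta> powr (1 / p)"
      by (rule powr_mult)
    finally show ?thesis by (simp add: a_def f(3) D_def)
  qed
  have "P x0 0 \<subseteq> \<Omega>" using P_sub[OF x0] by blast
  then show ?thesis
    using P_borel P_fin P_pos D main by (intro exI[of _ "P x0 0"] exI[of _ D]) blast
qed

text \<open>The constant function one cannot be approximated: the average of an approximating test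
  function over the fixed set \<open>P\<close> would be close to one, and also close to zero because its energy is that
  of \<open>1 - \<phi>\<close>.\<close>

proposition plump_implies_not_dense:
  fixes \<Omega> :: "'a::euclidean_space set"
  assumes \<Omega>: "open \<Omega>" "bounded \<Omega>" "\<Omega> \<noteq> {}" and \<kappa>: "0 < \<kappa>" "\<kappa> < 1" "plump \<kappa> \<Omega>"
    and x0: "x0 \<in> frontier \<Omega>" and diam: "0 < diameter (frontier \<Omega>)"
    and s: "0 < s" and p: "1 \<le> p" and codim: "upper_assouad_codim (frontier \<Omega>) < ereal (s * p)"
  shows "frac_sobolev_0 s p \<Omega> \<noteq> frac_sobolev s p \<Omega>"
proof
  let ?one = "\<lambda>x::'a. 1::real"
  assume dense: "frac_sobolev_0 s p \<Omega> = frac_sobolev s p \<Omega>"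
  obtain q c where q: "q < s * p" and c: "c > 0" and lower: "\<And>x r R. x \<in> frontier \<Omega> \<Longrightarrow> 0 < r \<Longrightarrow> r < R \<Longrightarrow>
      less_diameter R (frontier \<Omega>) \<Longrightarrow>
        measure lebesgue (closed_nbhd (frontier \<Omega>) r \<inter> ball x R) \<ge> c * measure lebesgue (ball x R) * (r / R) powr q"
    using codim unfolding upper_assouad_codim_def Inf_less_iff by auto
  have R: "0 < diameter (frontier \<Omega>) / 2" "diameter (frontier \<Omega>) / 2 < diameter (frontier \<Omega>)" using diam by auto
  obtain P D where P: "P \<in> sets borel" "P \<subseteq> \<Omega>" "emeasure lborel P < \<infinity>" "measure lborel P > 0" and D: "D \<ge> 0"
    and avg: "\<And>u \<eta>. u \<in> test_functions \<Omega> \<Longrightarrow> \<eta> \<ge> 0 \<Longrightarrow> slobodeckij_energy s p \<Omega> u \<le> ennreal \<eta> \<Longrightarrow>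
      \<bar>set_average P u\<bar> \<le> D * \<eta> powr (1 / p)"
  proof -
    have "\<exists>P D. P \<in> sets borel \<and> P \<subseteq> \<Omega> \<and> emeasure lborel P < \<infinity> \<and> measure lborel P > 0 \<and> D \<ge> 0 \<and>
      (\<forall>u\<in>test_functions \<Omega>. \<forall>\<eta>\<ge>0. slobodeckij_energy s p \<Omega> u \<le> ennreal \<eta> \<longrightarrow> \<bar>set_average P u\<bar> \<le> D * \<eta> powr (1 / p))"
      by (rule average_controlled_by_energy[OF \<Omega>(1,2) \<kappa> x0 R s p q c]) (rule lower)
    then show ?thesis using that by blast
  qed
  have \<Omega>_borel[measurable]: "\<Omega> \<in> sets borel" using \<Omega>(1) by simp
  have one_norms: "Lp_norm p \<Omega> ?one = ennroot p (Lp_modular p \<Omega> ?one)"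
    "gagliardo_seminorm s p \<Omega> ?one = ennroot p (slobodeckij_energy s p \<Omega> ?one)"
    by (rule sobolev_modular_borel_version[OF \<Omega>(1)]; simp)+
  have "Lp_modular p \<Omega> ?one = emeasure lborel \<Omega>"
    by (simp add: Lp_modular_def)
  then have "Lp_modular p \<Omega> ?one < \<infinity>" using emeasure_bounded_finite[OF \<Omega>(2)] by simp
  moreover have "slobodeckij_energy s p \<Omega> ?one < \<infinity>"
    by (simp add: slobodeckij_energy_def slobodeckij_quotient_def)
  ultimately have "?one \<in> frac_sobolev s p \<Omega>"
    unfolding frac_sobolev_def Lp_space_def using one_norms by (simp add: ennroot_less_top_iff[unfolded infinity_ennreal_def])
  then have "?one \<in> frac_sobolev_0 s p \<Omega>" unfolding dense .
  then have approx: "\<forall>\<epsilon>>0. \<exists>\<phi>\<in>test_functions \<Omega>. frac_sobolev_norm s p \<Omega> (\<lambda>x. 1 - \<phi> x) < ennreal \<epsilon>"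
    unfolding frac_sobolev_0_def mem_Collect_eq by (rule conjunct2)
  define m where "m = (1 / measure lborel P) powr (1 / p)"
  have m: "m \<ge> 0" by (simp add: m_def)
  \<comment> \<open>Small enough for \<open>D * \<epsilon> + m * \<epsilon> < 1\<close>.\<close>
  define \<epsilon> where "\<epsilon> = 1 / (2 * (D + m + 1))"
  have \<epsilon>: "\<epsilon> > 0" using D m by (simp add: \<epsilon>_def)
  obtain \<phi> where \<phi>: "\<phi> \<in> test_functions \<Omega>" "frac_sobolev_norm s p \<Omega> (\<lambda>x. 1 - \<phi> x) < ennreal \<epsilon>"
    using approx[rule_format, OF \<epsilon>] by (elim bexE) (rule that)
  have \<phi>_meas[measurable]: "\<phi> \<in> borel_measurable borel"
    by (rule borel_measurable_continuous_onI[OF test_function_continuous[OF \<phi>(1)]])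
  obtain K where K: "\<And>x. \<bar>\<phi> x\<bar> \<le> K" using test_function_bounded[OF \<phi>(1)] by blast
  have meas1: "(\<lambda>x. 1 - \<phi> x) \<in> borel_measurable borel" by simp
  note small = modulars_less_if_frac_sobolev_norm_less[OF \<Omega>(1) meas1 p \<epsilon> \<phi>(2)]
  have "slobodeckij_energy s p \<Omega> \<phi> = slobodeckij_energy s p \<Omega> (\<lambda>x. 1 - \<phi> x)"
    by (simp add: slobodeckij_energy_def slobodeckij_quotient_def abs_minus_commute)
  then have "\<bar>set_average P \<phi>\<bar> \<le> D * (\<epsilon> powr p) powr (1 / p)"
    using small(2) by (intro avg \<phi>(1)) simp_all
  then have near_0: "\<bar>set_average P \<phi>\<bar> \<le> D * \<epsilon>" using p \<epsilon> by (simp add: powr_powr)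
  have "ennreal (\<bar>set_average P \<phi> - 1\<bar> powr p)
    \<le> (\<integral>\<^sup>+y. ennreal (indicator P y / measure lborel P * \<bar>\<phi> y - 1\<bar> powr p) \<partial>lborel)"
    by (rule set_average_diff_const_le[OF P(1,3,4) \<phi>_meas K p])
  also have "\<dots> \<le> (\<integral>\<^sup>+y. ennreal (1 / measure lborel P) * (ennreal (\<bar>1 - \<phi> y\<bar> powr p) * indicator \<Omega> y) \<partial>lborel)"
    using P(2,4) by (intro nn_integral_mono) (auto simp: indicator_def abs_minus_commute simp flip: ennreal_mult')
  also have "\<dots> = ennreal (1 / measure lborel P) * Lp_modular p \<Omega> (\<lambda>x. 1 - \<phi> x)"
    unfolding Lp_modular_def by (rule nn_integral_cmult) measurable
  also have "\<dots> \<le> ennreal (1 / measure lborel P) * ennreal (\<epsilon> powr p)"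
    using small(1) by (intro mult_left_mono) auto
  also have "\<dots> = ennreal (1 / measure lborel P * \<epsilon> powr p)"
    using P(4) by (simp flip: ennreal_mult')
  finally have "\<bar>set_average P \<phi> - 1\<bar> powr p \<le> 1 / measure lborel P * \<epsilon> powr p"
    using P(4) by simp
  then have "(\<bar>set_average P \<phi> - 1\<bar> powr p) powr (1 / p) \<le> (1 / measure lborel P * \<epsilon> powr p) powr (1 / p)"
    using p by (intro powr_mono2) auto
  also have "\<dots> = m * (\<epsilon> powr p) powr (1 / p)"
    unfolding m_def by (rule powr_mult)
  finally have near_1: "\<bar>set_average P \<phi> - 1\<bar> \<le> m * \<epsilon>" using p \<epsilon> by (simp add: powr_powr)
  have "1 \<le> (D + m) * \<epsilon>" using near_0 near_1 by (simp add: distrib_right)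
  also have "\<dots> < 1" using D m by (simp add: \<epsilon>_def)
  finally show False by simp
qed

section \<open>Density and the Assouad codimensions\<close>

theorem theorem2:
  fixes \<Omega> :: "'a::euclidean_space set" and s p :: real
  assumes "open \<Omega>" and "bounded \<Omega>" and "\<Omega> \<noteq> {}"
    and "0 < s" and "s < 1" and "1 \<le> p"
  shows "(ereal (s * p) < lower_assouad_codim (frontier \<Omega>) \<longrightarrow>
            frac_sobolev_0 s p \<Omega> = frac_sobolev s p \<Omega>)
       \<and> (homogeneous_set (real DIM('a) - s * p) (frontier \<Omega>) \<and>
            ereal (s * p) = lower_assouad_codim (frontier \<Omega>) \<and> p > 1 \<longrightarrow>
            frac_sobolev_0 s p \<Omega> = frac_sobolev s p \<Omega>)
       \<and> ((\<exists>\<kappa>. 0 < \<kappa> \<and> \<kappa> < 1 \<and> plump \<kappa> \<Omega>) \<and>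
            ereal (s * p) > upper_assouad_codim (frontier \<Omega>) \<longrightarrow>
            frac_sobolev_0 s p \<Omega> \<noteq> frac_sobolev s p \<Omega>)"
proof (intro conjI impI)
  note \<Omega> = assms(1-3) and s = assms(4,5) and p = assms(6)
  show "frac_sobolev_0 s p \<Omega> = frac_sobolev s p \<Omega>" if codim: "ereal (s * p) < lower_assouad_codim (frontier \<Omega>)"
  proof -
    obtain q B t0 where "q > s * p" "B \<ge> 0" "t0 > 0" and
      "\<forall>t. 0 < t \<longrightarrow> t \<le> t0 \<longrightarrow> emeasure lborel {x\<in>\<Omega>. infdist x (frontier \<Omega>) \<le> t} \<le> ennreal (B * t powr q)"
      using thin_collars_if_lower_assouad_codim[OF \<Omega> codim] by blast
    then show ?thesis
      by (intro density_if_thin_collars[OF \<Omega> s p, of t0 B q]) simp_all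
  qed
  show "frac_sobolev_0 s p \<Omega> = frac_sobolev s p \<Omega>"
    if *: "homogeneous_set (real DIM('a) - s * p) (frontier \<Omega>) \<and>
      ereal (s * p) = lower_assouad_codim (frontier \<Omega>) \<and> p > 1"
  proof -
    have hom: "homogeneous_set (real DIM('a) - s * p) (frontier \<Omega>)" and p1: "1 < p" using * by blast+
    obtain B where "B \<ge> 0" and
      "\<forall>t. 0 < t \<longrightarrow> t \<le> 1 \<longrightarrow> emeasure lborel {x\<in>\<Omega>. infdist x (frontier \<Omega>) \<le> t} \<le> ennreal (B * t powr (s * p))"
      using thin_collars_if_homogeneous[OF \<Omega> hom] by blast
    then show ?thesis
      using p1 by (intro density_if_thin_collars[OF \<Omega> s p, of 1 B "s * p"]) simp_all
  qed
  show "frac_sobolev_0 s p \<Omega> \<noteq> frac_sobolev s p \<Omega>"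
    if *: "(\<exists>\<kappa>. 0 < \<kappa> \<and> \<kappa> < 1 \<and> plump \<kappa> \<Omega>) \<and> ereal (s * p) > upper_assouad_codim (frontier \<Omega>)"
  proof -
    obtain \<kappa> where \<kappa>: "0 < \<kappa>" "\<kappa> < 1" "plump \<kappa> \<Omega>" using * by blast
    obtain x0 where x0: "x0 \<in> frontier \<Omega>" using frontier_nonempty[OF \<Omega>(2,3)] by blast
    have codim: "upper_assouad_codim (frontier \<Omega>) < ereal (s * p)" using * by blast
    show ?thesis
      by (rule plump_implies_not_dense[OF \<Omega> \<kappa> x0 frontier_diameter_pos[OF \<Omega>] s(1) p codim])
  qed
qed

end
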